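(* Let $m,n,p\geq 1$ and $i,j$ be integers such that $1\leq i\leq m$ and $1\leq j\leq n$. Then there is a natural isomorphism of functors from $\mathcal{A}_{m+n+p-2}$ to $\mathcal{A}_{m,n,p}$: $$(\operatorname{Id}_m\times \nabla_{n;j}^{p})\,\nabla_{m;i}^{n+p-1}\;\simeq\;(\nabla_{m;i}^{n}\times \operatorname{Id}_p)\,\nabla_{m+n-1;j+i-1}^{p}.$$
   Context: Fix a field $k$. For $n\ge 1$ let $A_n$ be the path algebra over $k$ of the quiver $\overrightarrow{\mathbb{A}}_n: 1\to 2\to\cdots\to n$, and let $\mathcal{A}_n$ be the category of finite-dimensional right $A_n$-modules, identified with representations of the quiver (so that the projective module $P_j$ has dimension $1$ exactly at the vertices $\ell\ge j$). More generally $\mathcal{A}_{m_1,\dots,m_r}$ is the category of finite-dimensional right modules over $A_{m_1}\otimes_k\cdots\otimes_k A_{m_r}$, i.e. representations of the product quiver $\overrightarrow{\mathbb{A}}_{m_1}\times\cdots\times\overrightarrow{\mathbb{A}}_{m_r}$ with all commutation relations. A module over a product with first factor $\overrightarrow{\mathbb{A}}_a^{op}$ is a module with a left $A_a$-action commuting with the right actions of the other factors (arrows in that factor are reversed). A module over a product quiver is standard with support $\mathsf{S}$ (a set of vertices) if, up to isomorphism, it is $k$ at each vertex of $\mathsf{S}$, $0$ elsewhere, with identity maps along arrows between two vertices of $\mathsf{S}$. For $1\le i\le m$ and $n\ge1$ let $\mathsf{S}_{m;i}^{n}$ be the set of triples $(\gamma,\mu,\nu)\in[1,m+n-1]\times[1,m]\times[1,n]$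 such that ($\mu\le i-1$ and $\gamma\le\mu$) or ($\mu=i$ and $\gamma\le i+\nu-1$) or ($\mu\ge i+1$ and $\gamma\le \mu+n-1$). Let $M_{m;i}^{n}$ be the standard $\overrightarrow{\mathbb{A}}_{m+n-1}^{op}\times\overrightarrow{\mathbb{A}}_m\times\overrightarrow{\mathbb{A}}_n$-module with support $\mathsf{S}_{m;i}^{n}$, and let $\nabla_{m;i}^{n}=\;?\otimes_{A_{m+n-1}}M_{m;i}^{n}:\mathcal{A}_{m+n-1}\to\mathcal{A}_{m,n}$. $\nabla\times\operatorname{Id}$ and $\operatorname{Id}\times\nabla$ denote the functors on modules over a product obtained by applying $\nabla$ (tensoring with the corresponding $M$) with respect to one factor, the other factor being carried along: $\operatorname{Id}_m\times\nabla_{n;j}^p:\mathcal{A}_{m,n+p-1}\to\mathcal{A}_{m,n,p}$ and $\nabla_{m;i}^n\times\operatorname{Id}_p:\mathcal{A}_{m+n-1,p}\to\mathcal{A}_{m,n,p}$. *)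

theory Defs
  imports "Jordan_Normal_Form.Missing_VectorSpace" "HOL-Algebra.AbelCoset"
begin

section \<open>Categories, functors, natural isomorphisms\<close>

text \<open>Morphisms do not carry their domain and codomain (hom-sets may overlap), so composition and
  the action of a functor on morphisms take the objects involved as additional arguments.\<close>

record ('o, 'm) category =
  Obj :: "'o set"
  Hom :: "'o \<Rightarrow> 'o \<Rightarrow> 'm set"
  Ident :: "'o \<Rightarrow> 'm"
  Cmp :: "'o \<Rightarrow> 'o \<Rightarrow> 'o \<Rightarrow> 'm \<Rightarrow> 'm \<Rightarrow> 'm"

record ('o, 'm, 'p, 'q) functor_data =
  fobj :: "'o \<Rightarrow> 'p"
  farr :: "'o \<Rightarrow> 'o \<Rightarrow> 'm \<Rightarrow> 'q"

definition is_functor ::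
  "('o, 'm) category \<Rightarrow> ('p, 'q) category \<Rightarrow> ('o, 'm, 'p, 'q) functor_data \<Rightarrow> bool" where
  "is_functor C D F \<longleftrightarrow>
     (\<forall>X \<in> Obj C. fobj F X \<in> Obj D) \<and>
     (\<forall>X \<in> Obj C. \<forall>Y \<in> Obj C. \<forall>f \<in> Hom C X Y. farr F X Y f \<in> Hom D (fobj F X) (fobj F Y)) \<and>
     (\<forall>X \<in> Obj C. farr F X X (Ident C X) = Ident D (fobj F X)) \<and>
     (\<forall>X \<in> Obj C. \<forall>Y \<in> Obj C. \<forall>Z \<in> Obj C. \<forall>f \<in> Hom C X Y. \<forall>g \<in> Hom C Y Z.
        farr F X Z (Cmp C X Y Z g f) =
        Cmp D (fobj F X) (fobj F Y) (fobj F Z) (farr F Y Z g) (farr F X Y f))"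

definition functor_comp ::
  "('p, 'q, 's, 't) functor_data \<Rightarrow> ('o, 'm, 'p, 'q) functor_data \<Rightarrow> ('o, 'm, 's, 't) functor_data"
  (infixl \<open>\<circ>\<^sub>F\<close> 55) where
  "G \<circ>\<^sub>F F = \<lparr>fobj = (\<lambda>X. fobj G (fobj F X)),
             farr = (\<lambda>X Y f. farr G (fobj F X) (fobj F Y) (farr F X Y f))\<rparr>"

definition is_iso :: "('o, 'm) category \<Rightarrow> 'o \<Rightarrow> 'o \<Rightarrow> 'm \<Rightarrow> bool" where
  "is_iso C X Y f \<longleftrightarrow> f \<in> Hom C X Y \<and>
     (\<exists>g \<in> Hom C Y X. Cmp C X Y X g f = Ident C X \<and> Cmp C Y X Y f g = Ident C Y)"

definition naturally_isomorphic ::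
  "('o, 'm) category \<Rightarrow> ('p, 'q) category \<Rightarrow>
   ('o, 'm, 'p, 'q) functor_data \<Rightarrow> ('o, 'm, 'p, 'q) functor_data \<Rightarrow> bool" where
  "naturally_isomorphic C D F G \<longleftrightarrow>
     is_functor C D F \<and> is_functor C D G \<and>
     (\<exists>\<eta>. (\<forall>X \<in> Obj C. is_iso D (fobj F X) (fobj G X) (\<eta> X)) \<and>
          (\<forall>X \<in> Obj C. \<forall>Y \<in> Obj C. \<forall>f \<in> Hom C X Y.
             Cmp D (fobj F X) (fobj F Y) (fobj G Y) (\<eta> Y) (farr F X Y f) =
             Cmp D (fobj F X) (fobj G X) (fobj G Y) (farr G X Y f) (\<eta> X)))"

section \<open>Path algebras and their finite-dimensional modules\<close>

text \<open>The path algebra of the quiver \<open>1 \<rightarrow> 2 \<rightarrow> \<cdots> \<rightarrow> n\<close>. There is exactly one path from \<open>a\<close> to \<open>b\<close> if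
  \<open>a \<le> b\<close> (and none otherwise), and it is encoded by the pair \<open>(a, b)\<close>; an element of the algebra is
  given by its coefficients on paths. The product \<open>(a, c) (c, b) = (a, b)\<close> is written in the order
  in which paths are traversed, so right modules are covariant representations: the path \<open>(a, b)\<close>
  acts on a right module as a map from the space at \<open>a\<close> to the space at \<open>b\<close>.\<close>

definition path_algebra :: "('k, 'r) ring_scheme \<Rightarrow> nat \<Rightarrow> ('k, nat \<times> nat \<Rightarrow> 'k) module" where
  "path_algebra K n =
     \<lparr>carrier = {f. \<forall>a b. if 1 \<le> a \<and> a \<le> b \<and> b \<le> n then f (a, b) \<in> carrier K
                         else f (a, b) = \<zero>\<^bsub>K\<^esub>},
      mult = (\<lambda>f g (a, b). \<Oplus>\<^bsub>K\<^esub>c\<in>{a..b}. f (a, c) \<otimes>\<^bsub>K\<^esub> g (c, b)),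
      one = (\<lambda>(a, b). if a = b \<and> 1 \<le> a \<and> a \<le> n then \<one>\<^bsub>K\<^esub> else \<zero>\<^bsub>K\<^esub>),
      zero = (\<lambda>_. \<zero>\<^bsub>K\<^esub>),
      add = (\<lambda>f g x. f x \<oplus>\<^bsub>K\<^esub> g x),
      smult = (\<lambda>c f x. c \<otimes>\<^bsub>K\<^esub> f x)\<rparr>"

text \<open>A right module over \<open>A\<^sub>m\<^sub>1 \<otimes> \<cdots> \<otimes> A\<^sub>m\<^sub>r\<close> is a vector space with \<open>r\<close> pairwise commuting right
  actions, of \<open>A\<^sub>m\<^sub>1, \<dots>, A\<^sub>m\<^sub>r\<close>. The action of the factor with (0-based) index \<open>t\<close> is \<open>ract V t\<close>.
  A bimodule has an additional left action of one more path algebra. (As in every record extending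
  the library's modules, the fields \<open>mult\<close> and \<open>one\<close> are irrelevant.)\<close>

record ('k, 'a) multimod = "('k, 'a) module" +
  ract :: "nat \<Rightarrow> 'a \<Rightarrow> (nat \<times> nat \<Rightarrow> 'k) \<Rightarrow> 'a"

record ('k, 'a) bimod = "('k, 'a) multimod" +
  lact :: "(nat \<times> nat \<Rightarrow> 'k) \<Rightarrow> 'a \<Rightarrow> 'a"

definition right_action ::
  "('k, 'r) ring_scheme \<Rightarrow> ('k, 'p, 'z) module_scheme \<Rightarrow> ('k, 'a, 'y) module_scheme \<Rightarrow>
   ('a \<Rightarrow> 'p \<Rightarrow> 'a) \<Rightarrow> bool" where
  "right_action K A V r \<longleftrightarrow>
     (\<forall>v \<in> carrier V. \<forall>a \<in> carrier A. r v a \<in> carrier V) \<and>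
     (\<forall>v \<in> carrier V. \<forall>w \<in> carrier V. \<forall>a \<in> carrier A. r (v \<oplus>\<^bsub>V\<^esub> w) a = r v a \<oplus>\<^bsub>V\<^esub> r w a) \<and>
     (\<forall>v \<in> carrier V. \<forall>a \<in> carrier A. \<forall>b \<in> carrier A. r v (a \<oplus>\<^bsub>A\<^esub> b) = r v a \<oplus>\<^bsub>V\<^esub> r v b) \<and>
     (\<forall>c \<in> carrier K. \<forall>v \<in> carrier V. \<forall>a \<in> carrier A.
        r (c \<odot>\<^bsub>V\<^esub> v) a = c \<odot>\<^bsub>V\<^esub> r v a \<and> r v (c \<odot>\<^bsub>A\<^esub> a) = c \<odot>\<^bsub>V\<^esub> r v a) \<and>
     (\<forall>v \<in> carrier V. r v \<one>\<^bsub>A\<^esub> = v) \<and>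
     (\<forall>v \<in> carrier V. \<forall>a \<in> carrier A. \<forall>b \<in> carrier A. r v (a \<otimes>\<^bsub>A\<^esub> b) = r (r v a) b)"

definition fd_module :: "('k, 'r) ring_scheme \<Rightarrow> nat list \<Rightarrow> ('k, 'a) multimod \<Rightarrow> bool" where
  "fd_module K ms V \<longleftrightarrow>
     vectorspace K V \<and> vectorspace.fin_dim K V \<and>
     (\<forall>t < length ms. right_action K (path_algebra K (ms ! t)) V (ract V t)) \<and>
     (\<forall>s < length ms. \<forall>t < length ms. s \<noteq> t \<longrightarrow>
        (\<forall>a \<in> carrier (path_algebra K (ms ! s)). \<forall>b \<in> carrier (path_algebra K (ms ! t)).
         \<forall>v \<in> carrier V. ract V t (ract V s v a) b = ract V s (ract V t v b) a))"

text \<open>The category of finite-dimensional right modules over \<open>A\<^sub>m\<^sub>1 \<otimes> \<cdots> \<otimes> A\<^sub>m\<^sub>r\<close>, where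
  \<open>ms = [m\<^sub>1, \<dots>, m\<^sub>r]\<close>. Morphisms are functions restricted to the carrier of their domain, so that
  equality of morphisms is equality on the carrier.\<close>

definition mod_cat ::
  "('k, 'r) ring_scheme \<Rightarrow> nat list \<Rightarrow> (('k, 'a) multimod, 'a \<Rightarrow> 'a) category" where
  "mod_cat K ms =
     \<lparr>Obj = {V. fd_module K ms V},
      Hom = (\<lambda>V W. {f \<in> carrier V \<rightarrow>\<^sub>E carrier W.
               f \<in> LinearCombinations.module_hom K V W \<and>
               (\<forall>t < length ms. \<forall>a \<in> carrier (path_algebra K (ms ! t)). \<forall>v \<in> carrier V.
                  f (ract V t v a) = ract W t (f v) a)}),
      Ident = (\<lambda>V. \<lambda>v \<in> carrier V. v),
      Cmp = (\<lambda>U V W g f. compose (carrier U) g f)\<rparr>"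

section \<open>Tensor products over a \<open>K\<close>-algebra\<close>

definition free_space :: "('k, 'r) ring_scheme \<Rightarrow> 'b set \<Rightarrow> ('k, 'b \<Rightarrow> 'k) module" where
  "free_space K B =
     \<lparr>carrier = {f. (\<forall>x \<in> B. f x \<in> carrier K) \<and> (\<forall>x. x \<notin> B \<longrightarrow> f x = \<zero>\<^bsub>K\<^esub>) \<and>
                    finite {x. f x \<noteq> \<zero>\<^bsub>K\<^esub>}},
      mult = (\<lambda>_ _ _. \<zero>\<^bsub>K\<^esub>),
      one = (\<lambda>_. \<zero>\<^bsub>K\<^esub>),
      zero = (\<lambda>_. \<zero>\<^bsub>K\<^esub>),
      add = (\<lambda>f g x. f x \<oplus>\<^bsub>K\<^esub> g x),
      smult = (\<lambda>c f x. c \<otimes>\<^bsub>K\<^esub> f x)\<rparr>"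

definition free_gen :: "('k, 'r) ring_scheme \<Rightarrow> 'b \<Rightarrow> 'b \<Rightarrow> 'k" where
  "free_gen K x = (\<lambda>y. if y = x then \<one>\<^bsub>K\<^esub> else \<zero>\<^bsub>K\<^esub>)"

text \<open>The linear map between free spaces that sends the generator \<open>x\<close> to the generator \<open>g x\<close>.\<close>

definition free_map :: "('k, 'r) ring_scheme \<Rightarrow> ('b \<Rightarrow> 'c) \<Rightarrow> ('b \<Rightarrow> 'k) \<Rightarrow> 'c \<Rightarrow> 'k" where
  "free_map K g f = (\<lambda>z. \<Oplus>\<^bsub>K\<^esub>y\<in>{y. f y \<noteq> \<zero>\<^bsub>K\<^esub> \<and> g y = z}. f y)"

text \<open>The map \<open>V/N \<rightarrow> V'/N'\<close> induced by a linear map \<open>h : V \<rightarrow> V'\<close> with \<open>h(N) \<subseteq> N'\<close>; all the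
  cosets in the union then coincide.\<close>

definition coset_map ::
  "('k, 'c, 'z) module_scheme \<Rightarrow> 'c set \<Rightarrow> ('b \<Rightarrow> 'c) \<Rightarrow> 'b set \<Rightarrow> 'c set" where
  "coset_map V' N' h C = (\<Union>x\<in>C. N' +>\<^bsub>V'\<^esub> h x)"

definition quotient_space ::
  "('k, 'b, 'z) module_scheme \<Rightarrow> 'b set \<Rightarrow> ('k, 'b set) module" where
  "quotient_space V N =
     \<lparr>carrier = a_rcosets\<^bsub>V\<^esub> N,
      mult = (\<lambda>_ _. N),
      one = N,
      zero = N,
      add = set_add V,
      smult = (\<lambda>c. coset_map V N (\<lambda>v. c \<odot>\<^bsub>V\<^esub> v))\<rparr>"

text \<open>\<open>V \<otimes>\<^sub>R M\<close> for a right \<open>R\<close>-module \<open>V\<close> with action \<open>r\<close> and a left \<open>R\<close>-module \<open>M\<close> with action \<open>l\<close>.\<close>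

abbreviation tensor_free ::
  "('k, 'r) ring_scheme \<Rightarrow> ('k, 'a, 'x) module_scheme \<Rightarrow> ('k, 'b, 'y) module_scheme \<Rightarrow>
   ('k, 'a \<times> 'b \<Rightarrow> 'k) module" where
  "tensor_free K V M \<equiv> free_space K (carrier V \<times> carrier M)"

definition tensor_rels ::
  "('k, 'r) ring_scheme \<Rightarrow> ('k, 'p, 'z) module_scheme \<Rightarrow>
   ('k, 'a, 'x) module_scheme \<Rightarrow> ('a \<Rightarrow> 'p \<Rightarrow> 'a) \<Rightarrow>
   ('k, 'b, 'y) module_scheme \<Rightarrow> ('p \<Rightarrow> 'b \<Rightarrow> 'b) \<Rightarrow> ('a \<times> 'b \<Rightarrow> 'k) set" where
  "tensor_rels K R V r M l =
     (let F = tensor_free K V M; \<delta> = (\<lambda>v x. free_gen K (v, x)) in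
       {\<delta> (v \<oplus>\<^bsub>V\<^esub> w) x \<ominus>\<^bsub>F\<^esub> (\<delta> v x \<oplus>\<^bsub>F\<^esub> \<delta> w x) | v w x.
          v \<in> carrier V \<and> w \<in> carrier V \<and> x \<in> carrier M} \<union>
       {\<delta> v (x \<oplus>\<^bsub>M\<^esub> y) \<ominus>\<^bsub>F\<^esub> (\<delta> v x \<oplus>\<^bsub>F\<^esub> \<delta> v y) | v x y.
          v \<in> carrier V \<and> x \<in> carrier M \<and> y \<in> carrier M} \<union>
       {\<delta> (c \<odot>\<^bsub>V\<^esub> v) x \<ominus>\<^bsub>F\<^esub> (c \<odot>\<^bsub>F\<^esub> \<delta> v x) | c v x.
          c \<in> carrier K \<and> v \<in> carrier V \<and> x \<in> carrier M} \<union>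
       {\<delta> v (c \<odot>\<^bsub>M\<^esub> x) \<ominus>\<^bsub>F\<^esub> (c \<odot>\<^bsub>F\<^esub> \<delta> v x) | c v x.
          c \<in> carrier K \<and> v \<in> carrier V \<and> x \<in> carrier M} \<union>
       {\<delta> (r v a) x \<ominus>\<^bsub>F\<^esub> \<delta> v (l a x) | v a x.
          v \<in> carrier V \<and> a \<in> carrier R \<and> x \<in> carrier M})"

definition tensor_ker ::
  "('k, 'r) ring_scheme \<Rightarrow> ('k, 'p, 'z) module_scheme \<Rightarrow>
   ('k, 'a, 'x) module_scheme \<Rightarrow> ('a \<Rightarrow> 'p \<Rightarrow> 'a) \<Rightarrow>
   ('k, 'b, 'y) module_scheme \<Rightarrow> ('p \<Rightarrow> 'b \<Rightarrow> 'b) \<Rightarrow> ('a \<times> 'b \<Rightarrow> 'k) set" where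
  "tensor_ker K R V r M l =
     LinearCombinations.module.span K (tensor_free K V M) (tensor_rels K R V r M l)"

definition tensor ::
  "('k, 'r) ring_scheme \<Rightarrow> ('k, 'p, 'z) module_scheme \<Rightarrow>
   ('k, 'a, 'x) module_scheme \<Rightarrow> ('a \<Rightarrow> 'p \<Rightarrow> 'a) \<Rightarrow>
   ('k, 'b, 'y) module_scheme \<Rightarrow> ('p \<Rightarrow> 'b \<Rightarrow> 'b) \<Rightarrow> ('k, ('a \<times> 'b \<Rightarrow> 'k) set) module" where
  "tensor K R V r M l = quotient_space (tensor_free K V M) (tensor_ker K R V r M l)"

text \<open>Tensoring with respect to one factor. Let \<open>V\<close> be a right module over a product whose factor
  with index \<open>t\<close> is \<open>A\<^sub>N\<close>, and let \<open>M\<close> have a left \<open>A\<^sub>N\<close>-action and two right actions, with indices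
  \<open>0\<close> and \<open>1\<close>. The tensor product over \<open>A\<^sub>N\<close> has the two factors of \<open>M\<close> in place of the factor
  \<open>t\<close> of \<open>V\<close>; the remaining factors of \<open>V\<close> are carried along, those after \<open>t\<close> being shifted by one.\<close>

definition tensor_factor_ker ::
  "('k, 'r) ring_scheme \<Rightarrow> nat \<Rightarrow> nat \<Rightarrow> ('k, 'a) multimod \<Rightarrow> ('k, 'b) bimod \<Rightarrow>
   ('a \<times> 'b \<Rightarrow> 'k) set" where
  "tensor_factor_ker K N t V M = tensor_ker K (path_algebra K N) V (ract V t) M (lact M)"

definition tensor_factor ::
  "('k, 'r) ring_scheme \<Rightarrow> nat \<Rightarrow> nat \<Rightarrow> ('k, 'a) multimod \<Rightarrow> ('k, 'b) bimod \<Rightarrow>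
   ('k, ('a \<times> 'b \<Rightarrow> 'k) set) multimod" where
  "tensor_factor K N t V M =
     module.extend (tensor K (path_algebra K N) V (ract V t) M (lact M))
       (multimod.fields (\<lambda>s C b.
          coset_map (tensor_free K V M) (tensor_factor_ker K N t V M)
            (free_map K (\<lambda>(v, x). if s < t then (ract V s v b, x)
                                  else if s < t + 2 then (v, ract M (s - t) x b)
                                  else (ract V (s - 1) v b, x))) C))"

definition tensor_factor_map ::
  "('k, 'r) ring_scheme \<Rightarrow> nat \<Rightarrow> nat \<Rightarrow> ('k, 'b) bimod \<Rightarrow>
   ('k, 'a) multimod \<Rightarrow> ('k, 'a) multimod \<Rightarrow> ('a \<Rightarrow> 'a) \<Rightarrow>
   ('a \<times> 'b \<Rightarrow> 'k) set \<Rightarrow> ('a \<times> 'b \<Rightarrow> 'k) set" where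
  "tensor_factor_map K N t M V W f =
     (\<lambda>C \<in> carrier (tensor_factor K N t V M).
        coset_map (tensor_free K W M) (tensor_factor_ker K N t W M)
          (free_map K (\<lambda>(v, x). (f v, x))) C)"

section \<open>Standard modules and the functors \<open>\<nabla>\<close>\<close>

text \<open>The standard module with finite support \<open>S\<close> over a product quiver with first factor opposite.
  A vertex is a pair \<open>(\<gamma>, y)\<close> of the vertex \<open>\<gamma>\<close> of the first factor and the list \<open>y\<close> of the vertices
  of the others. The representation with \<open>K\<close> at the vertices in \<open>S\<close> and identities along the arrows
  between them is identified with its total space, the functions with support in \<open>S\<close>. A path acts by
  the composite of the maps along its arrows, hence as the identity if it runs inside \<open>S\<close> and as zero
  otherwise.\<close>

definition standard_bimod ::
  "('k, 'r) ring_scheme \<Rightarrow> (nat \<times> nat list) set \<Rightarrow> ('k, nat \<times> nat list \<Rightarrow> 'k) bimod" where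
  "standard_bimod K S =
     \<lparr>carrier = {f. (\<forall>x \<in> S. f x \<in> carrier K) \<and> (\<forall>x. x \<notin> S \<longrightarrow> f x = \<zero>\<^bsub>K\<^esub>)},
      mult = (\<lambda>_ _ _. \<zero>\<^bsub>K\<^esub>),
      one = (\<lambda>_. \<zero>\<^bsub>K\<^esub>),
      zero = (\<lambda>_. \<zero>\<^bsub>K\<^esub>),
      add = (\<lambda>f g x. f x \<oplus>\<^bsub>K\<^esub> g x),
      smult = (\<lambda>c f x. c \<otimes>\<^bsub>K\<^esub> f x),
      ract = (\<lambda>t f a (\<gamma>, y).
        \<Oplus>\<^bsub>K\<^esub>c\<in>{c. c \<le> y ! t \<and> (\<forall>d \<in> {c..y ! t}. (\<gamma>, y[t := d]) \<in> S)}.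
          f (\<gamma>, y[t := c]) \<otimes>\<^bsub>K\<^esub> a (c, y ! t)),
      lact = (\<lambda>a f (\<gamma>, y).
        \<Oplus>\<^bsub>K\<^esub>c\<in>{c. \<gamma> \<le> c \<and> (\<forall>d \<in> {\<gamma>..c}. (d, y) \<in> S)}.
          a (\<gamma>, c) \<otimes>\<^bsub>K\<^esub> f (c, y))\<rparr>"

definition nabla_support :: "nat \<Rightarrow> nat \<Rightarrow> nat \<Rightarrow> (nat \<times> nat list) set" where
  "nabla_support m i n =
     {(\<gamma>, [\<mu>, \<nu>]) | \<gamma> \<mu> \<nu>.
        \<gamma> \<in> {1..m + n - 1} \<and> \<mu> \<in> {1..m} \<and> \<nu> \<in> {1..n} \<and>
        (\<mu> \<le> i - 1 \<and> \<gamma> \<le> \<mu> \<or> \<mu> = i \<and> \<gamma> \<le> i + \<nu> - 1 \<or> \<mu> \<ge> i + 1 \<and> \<gamma> \<le> \<mu> + n - 1)}"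

definition nabla_bimod ::
  "('k, 'r) ring_scheme \<Rightarrow> nat \<Rightarrow> nat \<Rightarrow> nat \<Rightarrow> ('k, nat \<times> nat list \<Rightarrow> 'k) bimod" where
  "nabla_bimod K m i n = standard_bimod K (nabla_support m i n)"

text \<open>\<open>nabla_factor K t m i n\<close> is \<open>\<nabla>\<close> (with parameters \<open>m\<close>, \<open>i\<close>, \<open>n\<close>) applied with respect to the
  factor with index \<open>t\<close>, which must be \<open>A\<^sub>N\<close> for \<open>N = m + n - 1\<close>. The factors carried along
  do not occur as parameters; they are given by the categories between which the functor is taken.\<close>

definition nabla_factor ::
  "('k, 'r) ring_scheme \<Rightarrow> nat \<Rightarrow> nat \<Rightarrow> nat \<Rightarrow> nat \<Rightarrow>
   (('k, 'a) multimod, 'a \<Rightarrow> 'a,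
    ('k, ('a \<times> (nat \<times> nat list \<Rightarrow> 'k) \<Rightarrow> 'k) set) multimod,
    ('a \<times> (nat \<times> nat list \<Rightarrow> 'k) \<Rightarrow> 'k) set \<Rightarrow> ('a \<times> (nat \<times> nat list \<Rightarrow> 'k) \<Rightarrow> 'k) set)
   functor_data" where
  "nabla_factor K t m i n =
     \<lparr>fobj = (\<lambda>V. tensor_factor K (m + n - 1) t V (nabla_bimod K m i n)),
      farr = tensor_factor_map K (m + n - 1) t (nabla_bimod K m i n)\<rparr>"

text \<open>\<open>\<nabla>\<close> itself, \<open>\<nabla> \<times> Id\<close> and \<open>Id \<times> \<nabla>\<close> (for two factors).\<close>

abbreviation "nabla K m i n \<equiv> nabla_factor K 0 m i n"
abbreviation "nabla_Id K m i n \<equiv> nabla_factor K 0 m i n"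
abbreviation "Id_nabla K m i n \<equiv> nabla_factor K 1 m i n"

end

theory Submission
  imports Defs
begin

text \<open>For a fixed vertex \<open>(\<mu>, \<nu>)\<close> the support of the bimodule that defines \<open>\<nabla>\<close> consists of the \<open>\<gamma>\<close> with
\<open>1 \<le> \<gamma> \<le> h (\<mu>, \<nu>)\<close>, where \<open>h\<close> is a monotone map from the product of two chains to a chain. As a left module this
part of the bimodule is the projective module generated by the trivial path at \<open>h (\<mu>, \<nu>)\<close>, and tensoring a
representation \<open>V\<close> with it gives the space of \<open>V\<close> at \<open>h (\<mu>, \<nu>)\<close>. Since \<open>h\<close> is monotone, the arrows act accordingly. In
other words, \<open>\<nabla>\<close> is the pullback of representations along \<open>h\<close>, and the same holds for \<open>\<nabla>\<close> applied to one factor of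
a product. A composite of two such functors is the pullback along the composite of two monotone maps, and the
two composites in the theorem belong to the same map from a product of three chains to one chain
(\<open>nabla_height_assoc\<close>).

The argument is carried out with coordinates, not with the pulled back representation itself. The locale
\<open>pullback_coords\<close> states that a module \<open>W\<close> is the pullback of \<open>V\<close> along \<open>H\<close> by means of a family of linear maps
from \<open>W\<close> to \<open>V\<close>. It implies that \<open>W\<close> is a finite-dimensional module, and that a map between such modules is
determined by its effect on coordinates. Therefore two functors with natural coordinates along the same \<open>H\<close> are
naturally isomorphic (\<open>coord_functors_isomorphic\<close>).

It remains to find coordinates for the tensor products. The central fact is that the submodule of tensor
relations is the common kernel of the maps \<open>w \<otimes> x \<mapsto> w x\<^sub>y\<close>, where \<open>x\<^sub>y\<close> is the part of \<open>x\<close> at \<open>y\<close> viewed in the path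
algebra (\<open>Nker_iff\<close>). It follows from a normal form for tensors, and it makes all operations on the quotient
computable in coordinates. The lemma \<open>coords_T\<close> then composes these coordinates with those of the module that is
tensored, so that both composites are treated by two applications of one lemma, starting from the identity functor.\<close>

section \<open>Linear maps and finite sums\<close>

lemma module_homI:
  assumes "\<And>v. v \<in> carrier M \<Longrightarrow> f v \<in> carrier N"
    and "\<And>v w. v \<in> carrier M \<Longrightarrow> w \<in> carrier M \<Longrightarrow> f (v \<oplus>\<^bsub>M\<^esub> w) = f v \<oplus>\<^bsub>N\<^esub> f w"
    and "\<And>c v. c \<in> carrier K \<Longrightarrow> v \<in> carrier M \<Longrightarrow> f (c \<odot>\<^bsub>M\<^esub> v) = c \<odot>\<^bsub>N\<^esub> f v"
  shows "f \<in> module_hom K M N"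
  using assms unfolding module_hom_def by auto

lemma module_hom_comp:
  "f \<in> module_hom K M N \<Longrightarrow> g \<in> module_hom K N L \<Longrightarrow> (\<lambda>v. g (f v)) \<in> module_hom K M L"
  unfolding module_hom_def by (auto simp: Pi_iff)

lemma module_hom_in: "f \<in> module_hom K M N \<Longrightarrow> v \<in> carrier M \<Longrightarrow> f v \<in> carrier N"
  unfolding module_hom_def by auto

lemma module_hom_zero:
  assumes "module K M" "module K N" "f \<in> module_hom K M N"
  shows "f \<zero>\<^bsub>M\<^esub> = \<zero>\<^bsub>N\<^esub>"
  using assms mod_hom.f0_is_0[of K M N f] by (auto simp: mod_hom_def mod_hom_axioms_def)

lemma module_hom_finsum:
  assumes "module K M" "module K N" "f \<in> module_hom K M N" "g \<in> I \<rightarrow> carrier M"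
  shows "f (\<Oplus>\<^bsub>M\<^esub>i\<in>I. g i) = (\<Oplus>\<^bsub>N\<^esub>i\<in>I. f (g i))"
proof -
  interpret M: module K M by fact
  interpret N: module K N by fact
  show ?thesis using assms(4)
  proof (induct I rule: infinite_finite_induct)
    case (insert a A)
    then have "(\<Oplus>\<^bsub>M\<^esub>i\<in>insert a A. g i) = g a \<oplus>\<^bsub>M\<^esub> (\<Oplus>\<^bsub>M\<^esub>i\<in>A. g i)"
      by (intro M.finsum_insert) auto
    moreover have "(\<Oplus>\<^bsub>N\<^esub>i\<in>insert a A. f (g i)) = f (g a) \<oplus>\<^bsub>N\<^esub> (\<Oplus>\<^bsub>N\<^esub>i\<in>A. f (g i))"
      using insert module_hom_in[OF assms(3)] by (intro N.finsum_insert) auto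
    ultimately show ?case using insert assms(3) by (auto simp: module_hom_add)
  qed (auto simp: module_hom_zero[OF assms(1-3)])
qed

text \<open>Maps between tensor products will be compared on generators only. That requires both sides to be
known as linear maps, and one of them is typically a finite linear combination of linear maps.\<close>

lemma (in module) module_hom_sum:
  assumes "\<And>i. i \<in> I \<Longrightarrow> \<phi> i \<in> module_hom R N M"
  shows "(\<lambda>v. \<Oplus>\<^bsub>M\<^esub>i\<in>I. \<phi> i v) \<in> module_hom R N M"
proof (rule module_homI, goal_cases)
  case (1 v) show ?case using module_hom_in[OF assms] 1 by (intro finsum_closed) auto
next
  case (2 v w)
  have "(\<Oplus>\<^bsub>M\<^esub>i\<in>I. \<phi> i (v \<oplus>\<^bsub>N\<^esub> w)) = (\<Oplus>\<^bsub>M\<^esub>i\<in>I. \<phi> i v \<oplus>\<^bsub>M\<^esub> \<phi> i w)"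
    using module_hom_in[OF assms] 2 by (intro finsum_cong') (auto simp: module_hom_add[OF assms])
  also have "\<dots> = (\<Oplus>\<^bsub>M\<^esub>i\<in>I. \<phi> i v) \<oplus>\<^bsub>M\<^esub> (\<Oplus>\<^bsub>M\<^esub>i\<in>I. \<phi> i w)"
    using module_hom_in[OF assms] 2 by (intro finsum_addf) auto
  finally show ?case .
next
  case (3 c v)
  have "(\<Oplus>\<^bsub>M\<^esub>i\<in>I. \<phi> i (c \<odot>\<^bsub>N\<^esub> v)) = (\<Oplus>\<^bsub>M\<^esub>i\<in>I. c \<odot>\<^bsub>M\<^esub> \<phi> i v)"
    using module_hom_in[OF assms] 3 by (intro finsum_cong') (auto simp: module_hom_smult[OF assms])
  also have "\<dots> = c \<odot>\<^bsub>M\<^esub> (\<Oplus>\<^bsub>M\<^esub>i\<in>I. \<phi> i v)"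
  proof -
    have "(\<lambda>u. c \<odot>\<^bsub>M\<^esub> u) \<in> module_hom R M M"
      using 3 by (intro module_homI) (auto simp: smult_r_distr smult_assoc1[symmetric] R.m_comm)
    from module_hom_finsum[OF module_axioms module_axioms this, of "\<lambda>i. \<phi> i v" I]
    show ?thesis using module_hom_in[OF assms] 3 by auto
  qed
  finally show ?case .
qed

lemma (in module) module_hom_scale:
  assumes "c \<in> carrier R" "\<phi> \<in> module_hom R N M"
  shows "(\<lambda>v. c \<odot>\<^bsub>M\<^esub> \<phi> v) \<in> module_hom R N M"
  using assms
  by (intro module_homI)
    (auto simp: module_hom_in module_hom_add module_hom_smult smult_r_distr smult_assoc1[symmetric] R.m_comm)

lemma (in module) smult_finsum:
  assumes "c \<in> carrier R" "g \<in> I \<rightarrow> carrier M"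
  shows "c \<odot>\<^bsub>M\<^esub> (\<Oplus>\<^bsub>M\<^esub>i\<in>I. g i) = (\<Oplus>\<^bsub>M\<^esub>i\<in>I. c \<odot>\<^bsub>M\<^esub> g i)"
proof -
  have "(\<lambda>u. c \<odot>\<^bsub>M\<^esub> u) \<in> module_hom R M M"
    using assms(1) by (intro module_homI) (auto simp: smult_r_distr smult_assoc1[symmetric] R.m_comm)
  from module_hom_finsum[OF module_axioms module_axioms this assms(2)] show ?thesis .
qed

lemma (in module) finsum_smult_left:
  assumes "v \<in> carrier M" "g \<in> I \<rightarrow> carrier R"
  shows "(\<Oplus>\<^bsub>R\<^esub>i\<in>I. g i) \<odot>\<^bsub>M\<^esub> v = (\<Oplus>\<^bsub>M\<^esub>i\<in>I. g i \<odot>\<^bsub>M\<^esub> v)"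
  using assms(2)
proof (induct I rule: infinite_finite_induct)
  case (insert a A)
  then have "(\<Oplus>\<^bsub>R\<^esub>i\<in>insert a A. g i) = g a \<oplus>\<^bsub>R\<^esub> (\<Oplus>\<^bsub>R\<^esub>i\<in>A. g i)"
    by (intro R.finsum_insert) auto
  moreover have "(\<Oplus>\<^bsub>M\<^esub>i\<in>insert a A. g i \<odot>\<^bsub>M\<^esub> v) = g a \<odot>\<^bsub>M\<^esub> v \<oplus>\<^bsub>M\<^esub> (\<Oplus>\<^bsub>M\<^esub>i\<in>A. g i \<odot>\<^bsub>M\<^esub> v)"
    using insert assms(1) by (intro finsum_insert) auto
  ultimately show ?case using insert assms(1) by (auto simp: smult_l_distr Pi_iff)
qed (use assms in auto)

lemma (in abelian_monoid) finsum_single: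
  assumes "finite I" "k \<in> I" "f k \<in> carrier G" "\<And>i. i \<in> I \<Longrightarrow> i \<noteq> k \<Longrightarrow> f i = \<zero>"
  shows "(\<Oplus>i\<in>I. f i) = f k"
proof -
  have "(\<Oplus>i\<in>I. f i) = (\<Oplus>i\<in>I. if i = k then f i else \<zero>)"
    using assms by (intro finsum_cong') auto
  also have "\<dots> = f k"
  proof -
    have "f \<in> I \<rightarrow> carrier G" using assms by (metis Pi_I zero_closed)
    from finsum_singleton[OF assms(2,1) this] show ?thesis by (simp add: eq_commute[of k])
  qed
  finally show ?thesis .
qed

lemma (in abelian_monoid) finsum_sup:
  assumes "finite J" "I \<subseteq> J" "f \<in> I \<rightarrow> carrier G"  "\<And>i. i \<in> J - I \<Longrightarrow> f i = \<zero>"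
  shows "(\<Oplus>i\<in>I. f i) = (\<Oplus>i\<in>J. f i)"
  using assms by (intro add.finprod_mono_neutral_cong_left) auto

lemma (in abelian_monoid) finsum_swap2:
  assumes "finite I" "finite J" "\<And>i j. i \<in> I \<Longrightarrow> j \<in> J \<Longrightarrow> f i j \<in> carrier G"
  shows "(\<Oplus>i\<in>I. \<Oplus>j\<in>J. f i j) = (\<Oplus>j\<in>J. \<Oplus>i\<in>I. f i j)"
  using assms by (intro add.finprod_finprod_swap) auto

section \<open>Right actions of the path algebra\<close>

definition path :: "('k, 'r) ring_scheme \<Rightarrow> nat \<Rightarrow> nat \<Rightarrow> nat \<times> nat \<Rightarrow> 'k" where
  "path K c d = free_gen K (c, d)"

lemma in_path_algebra:
  "a \<in> carrier (path_algebra K N) \<longleftrightarrow>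
     (\<forall>c d. if 1 \<le> c \<and> c \<le> d \<and> d \<le> N then a (c, d) \<in> carrier K else a (c, d) = \<zero>\<^bsub>K\<^esub>)"
  by (simp add: path_algebra_def)

locale path_rep = vectorspace K V for K :: "('k, 'r) ring_scheme" and V :: "('k, 'a, 'z) module_scheme" +
  fixes N :: nat and r :: "'a \<Rightarrow> (nat \<times> nat \<Rightarrow> 'k) \<Rightarrow> 'a"
  assumes right_action: "right_action K (path_algebra K N) V r"
begin

abbreviation "A \<equiv> carrier (path_algebra K N)"

text \<open>The map that the path from \<open>c\<close> to \<open>d\<close> induces on the representation belonging to the module. For \<open>c = d\<close> it
is the projection onto the space at the vertex \<open>c\<close>, so \<open>tr d d v = v\<close> is how membership of \<open>v\<close> in that
space is expressed below.\<close>

definition tr :: "nat \<Rightarrow> nat \<Rightarrow> 'a \<Rightarrow> 'a" where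
  "tr c d v = r v (path K c d)"

lemma coeff_in: "a \<in> carrier (path_algebra K n) \<Longrightarrow> a (c, d) \<in> carrier K"
  by (cases "1 \<le> c \<and> c \<le> d \<and> d \<le> n") (auto simp: in_path_algebra dest!: spec[of _ c] spec[of _ d])

lemma coeff_zero: "a \<in> A \<Longrightarrow> \<not> (1 \<le> c \<and> c \<le> d \<and> d \<le> N) \<Longrightarrow> a (c, d) = \<zero>\<^bsub>K\<^esub>"
  unfolding in_path_algebra by meson

lemma path_in: "1 \<le> c \<Longrightarrow> c \<le> d \<Longrightarrow> d \<le> n \<Longrightarrow> path K c d \<in> carrier (path_algebra K n)"
  by (auto simp: in_path_algebra path_def free_gen_def)

lemma zero_in: "(\<lambda>_. \<zero>\<^bsub>K\<^esub>) \<in> A"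
  by (auto simp: in_path_algebra)

lemma add_in: "a \<in> A \<Longrightarrow> b \<in> A \<Longrightarrow> (\<lambda>z. a z \<oplus>\<^bsub>K\<^esub> b z) \<in> A"
  by (auto simp: in_path_algebra)

lemma smult_in: "c \<in> carrier K \<Longrightarrow> b \<in> A \<Longrightarrow> (\<lambda>z. c \<otimes>\<^bsub>K\<^esub> b z) \<in> A"
  by (auto simp: in_path_algebra)

lemma act_in: "v \<in> carrier V \<Longrightarrow> a \<in> A \<Longrightarrow> r v a \<in> carrier V"
  using right_action by (auto simp: right_action_def)

lemma act_hom: "a \<in> A \<Longrightarrow> (\<lambda>v. r v a) \<in> module_hom K V V"
  using right_action by (intro module_homI) (auto simp: right_action_def)

lemma act_add:
  "v \<in> carrier V \<Longrightarrow> a \<in> A \<Longrightarrow> b \<in> A \<Longrightarrow> r v (\<lambda>z. a z \<oplus>\<^bsub>K\<^esub> b z) = r v a \<oplus>\<^bsub>V\<^esub> r v b"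
  using right_action unfolding right_action_def by (auto simp: path_algebra_def)

lemma act_smult:
  "v \<in> carrier V \<Longrightarrow> a \<in> A \<Longrightarrow> c \<in> carrier K \<Longrightarrow> r v (\<lambda>z. c \<otimes>\<^bsub>K\<^esub> a z) = c \<odot>\<^bsub>V\<^esub> r v a"
  using right_action unfolding right_action_def by (auto simp: path_algebra_def)

lemma act_zero: "v \<in> carrier V \<Longrightarrow> r v (\<lambda>_. \<zero>\<^bsub>K\<^esub>) = \<zero>\<^bsub>V\<^esub>"
  using act_smult[of v "\<lambda>_. \<zero>\<^bsub>K\<^esub>" "\<zero>\<^bsub>K\<^esub>"] by (simp add: zero_in act_in)

text \<open>An action distributes over sums in the path algebra, which are written pointwise.\<close>

lemma act_sum:
  assumes "v \<in> carrier V" "finite I" "\<And>i. i \<in> I \<Longrightarrow> g i \<in> A"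
  shows "(\<lambda>z. \<Oplus>\<^bsub>K\<^esub>i\<in>I. g i z) \<in> A \<and> r v (\<lambda>z. \<Oplus>\<^bsub>K\<^esub>i\<in>I. g i z) = (\<Oplus>\<^bsub>V\<^esub>i\<in>I. r v (g i))"
  using assms(2,3)
proof (induct I)
  case empty then show ?case using assms(1) by (simp add: zero_in act_zero)
next
  case (insert i I)
  have g: "g i z \<in> carrier K" if "i \<in> insert i I" "g i \<in> A" for i z
    using coeff_in[where a = "g i" and c = "fst z" and d = "snd z"] that by simp
  have "(\<lambda>z. \<Oplus>\<^bsub>K\<^esub>i\<in>insert i I. g i z) = (\<lambda>z. g i z \<oplus>\<^bsub>K\<^esub> (\<Oplus>\<^bsub>K\<^esub>i\<in>I. g i z))"
    using insert(1,2,4) g by (intro ext R.finsum_insert) auto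
  then show ?case using insert assms(1)
    by (simp add: add_in act_add act_in)
qed

lemma act_mult:
  assumes "v \<in> carrier V" "a \<in> A" "b \<in> A"
  shows "r (r v a) b = r v (\<lambda>(c, d). \<Oplus>\<^bsub>K\<^esub>e\<in>{c..d}. a (c, e) \<otimes>\<^bsub>K\<^esub> b (e, d))"
proof -
  have "mult (path_algebra K N) a b = (\<lambda>(c, d). \<Oplus>\<^bsub>K\<^esub>e\<in>{c..d}. a (c, e) \<otimes>\<^bsub>K\<^esub> b (e, d))"
    by (simp add: path_algebra_def)
  moreover have "\<forall>v \<in> carrier V. \<forall>a \<in> A. \<forall>b \<in> A. r v (a \<otimes>\<^bsub>path_algebra K N\<^esub> b) = r (r v a) b"
    using right_action unfolding right_action_def by (elim conjE)
  ultimately show ?thesis using assms by (metis (no_types))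
qed

lemma act_one: "v \<in> carrier V \<Longrightarrow> r v (\<lambda>(a, b). if a = b \<and> 1 \<le> a \<and> a \<le> N then \<one>\<^bsub>K\<^esub> else \<zero>\<^bsub>K\<^esub>) = v"
  using right_action unfolding right_action_def by (auto simp: path_algebra_def)

lemma tr_hom: "1 \<le> c \<Longrightarrow> c \<le> d \<Longrightarrow> d \<le> N \<Longrightarrow> tr c d \<in> module_hom K V V"
  unfolding tr_def[abs_def] by (intro act_hom path_in)

lemma tr_in: "1 \<le> c \<Longrightarrow> c \<le> d \<Longrightarrow> d \<le> N \<Longrightarrow> v \<in> carrier V \<Longrightarrow> tr c d v \<in> carrier V"
  unfolding tr_def by (intro act_in path_in)

lemma mult_path:
  assumes "a \<in> A"
  shows "(\<lambda>(c', d'). \<Oplus>\<^bsub>K\<^esub>e\<in>{c'..d'}. a (c', e) \<otimes>\<^bsub>K\<^esub> path K c d (e, d'))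
       = (\<lambda>(c', d'). if c \<le> d \<and> d' = d then a (c', c) else \<zero>\<^bsub>K\<^esub>)"
proof (intro ext, clarify)
  fix c' d'
  show "(\<Oplus>\<^bsub>K\<^esub>e\<in>{c'..d'}. a (c', e) \<otimes>\<^bsub>K\<^esub> path K c d (e, d')) = (if c \<le> d \<and> d' = d then a (c', c) else \<zero>\<^bsub>K\<^esub>)"
  proof (cases "c \<le> d \<and> d' = d \<and> c' \<le> c")
    case True
    then have "(\<Oplus>\<^bsub>K\<^esub>e\<in>{c'..d'}. a (c', e) \<otimes>\<^bsub>K\<^esub> path K c d (e, d')) = a (c', c) \<otimes>\<^bsub>K\<^esub> path K c d (c, d')"
      using assms by (intro R.finsum_single) (auto simp: path_def free_gen_def coeff_in[OF assms])
    then show ?thesis using True assms by (simp add: path_def free_gen_def coeff_in[OF assms])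
  next
    case False
    have "(\<Oplus>\<^bsub>K\<^esub>e\<in>{c'..d'}. a (c', e) \<otimes>\<^bsub>K\<^esub> path K c d (e, d')) = \<zero>\<^bsub>K\<^esub>"
      using assms False by (intro R.add.finprod_one_eqI) (auto simp: path_def free_gen_def coeff_in[OF assms])
    then show ?thesis using False coeff_zero[OF assms, of c' c] by auto
  qed
qed

lemma tr_act:
  assumes "v \<in> carrier V" "a \<in> A" "1 \<le> c" "c \<le> d" "d \<le> N"
  shows "tr c d (r v a) = r v (\<lambda>(c', d'). if d' = d then a (c', c) else \<zero>\<^bsub>K\<^esub>)"
proof -
  have "tr c d (r v a) = r v (\<lambda>(c', d'). if c \<le> d \<and> d' = d then a (c', c) else \<zero>\<^bsub>K\<^esub>)"
    unfolding tr_def act_mult[OF assms(1,2) path_in[OF assms(3-5)]] mult_path[OF assms(2)] ..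
  then show ?thesis using assms(4) by (simp only: simp_thms)
qed

lemma tr_tr:
  assumes "v \<in> carrier V" "1 \<le> c" "c \<le> d" "d \<le> e" "e \<le> N"
  shows "tr d e (tr c d v) = tr c e v"
proof -
  have "(\<lambda>(c', d'). if d' = e then path K c d (c', d) else \<zero>\<^bsub>K\<^esub>) = path K c e"
    using assms by (auto simp: fun_eq_iff path_def free_gen_def)
  then show ?thesis
    using tr_act[of v "path K c d" d e] assms path_in[of c d] unfolding tr_def by force
qed

lemma tr_orth:
  assumes "v \<in> carrier V" "1 \<le> c" "c \<le> d" "d \<le> N" "1 \<le> d'" "d' \<le> e" "e \<le> N" "d' \<noteq> d"
  shows "tr d' e (tr c d v) = \<zero>\<^bsub>V\<^esub>"
proof -
  have "(\<lambda>(c', e'). if e' = e then path K c d (c', d') else \<zero>\<^bsub>K\<^esub>) = (\<lambda>_. \<zero>\<^bsub>K\<^esub>)"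
    using assms by (auto simp: fun_eq_iff path_def free_gen_def)
  then show ?thesis
    using tr_act[of v "path K c d" d' e] assms path_in[of c d] act_zero unfolding tr_def by force
qed

text \<open>The component at \<open>d\<close> of \<open>v a\<close> collects what the paths ending at \<open>d\<close> carry there, because the
product of \<open>a\<close> with the trivial path at \<open>d\<close> keeps exactly those paths. So an action of the algebra is determined by the maps of
the representation.\<close>

lemma act_component:
  assumes "v \<in> carrier V" "a \<in> A" "1 \<le> d" "d \<le> N"
  shows "tr d d (r v a) = (\<Oplus>\<^bsub>V\<^esub>c\<in>{1..d}. a (c, d) \<odot>\<^bsub>V\<^esub> tr c d v)"
proof -
  have "(\<lambda>(c', d'). if d' = d then a (c', d) else \<zero>\<^bsub>K\<^esub>) = (\<lambda>z. \<Oplus>\<^bsub>K\<^esub>c\<in>{1..d}. a (c, d) \<otimes>\<^bsub>K\<^esub> path K c d z)"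
  proof (intro ext, clarify)
    fix c' d'
    show "(if d' = d then a (c', d) else \<zero>\<^bsub>K\<^esub>) = (\<Oplus>\<^bsub>K\<^esub>c\<in>{1..d}. a (c, d) \<otimes>\<^bsub>K\<^esub> path K c d (c', d'))"
    proof (cases "d' = d \<and> c' \<in> {1..d}")
      case True
      then have "(\<Oplus>\<^bsub>K\<^esub>c\<in>{1..d}. a (c, d) \<otimes>\<^bsub>K\<^esub> path K c d (c', d')) = a (c', d) \<otimes>\<^bsub>K\<^esub> path K c' d (c', d')"
        using assms by (intro R.finsum_single) (auto simp: path_def free_gen_def coeff_in[OF assms(2)])
      then show ?thesis using True assms by (simp add: path_def free_gen_def coeff_in[OF assms(2)])
    next
      case False
      have "(\<Oplus>\<^bsub>K\<^esub>c\<in>{1..d}. a (c, d) \<otimes>\<^bsub>K\<^esub> path K c d (c', d')) = \<zero>\<^bsub>K\<^esub>"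
        using assms False by (intro R.add.finprod_one_eqI) (auto simp: path_def free_gen_def coeff_in[OF assms(2)])
      then show ?thesis using False coeff_zero[OF assms(2), of c' d] by auto
    qed
  qed
  moreover have "r v (\<lambda>z. \<Oplus>\<^bsub>K\<^esub>c\<in>{1..d}. a (c, d) \<otimes>\<^bsub>K\<^esub> path K c d z) = (\<Oplus>\<^bsub>V\<^esub>c\<in>{1..d}. r v (\<lambda>z. a (c, d) \<otimes>\<^bsub>K\<^esub> path K c d z))"
    using act_sum[OF assms(1), of "{1..d}" "\<lambda>c z. a (c, d) \<otimes>\<^bsub>K\<^esub> path K c d z"] assms
    by (simp add: smult_in path_in coeff_in[OF assms(2)])
  moreover have "\<dots> = (\<Oplus>\<^bsub>V\<^esub>c\<in>{1..d}. a (c, d) \<odot>\<^bsub>V\<^esub> tr c d v)"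
    using assms by (intro finsum_cong') (auto simp: act_smult path_in coeff_in[OF assms(2)] tr_def act_in)
  ultimately show ?thesis using tr_act[of v a d d] assms by simp
qed

lemma component_sum:
  assumes "v \<in> carrier V"
  shows "v = (\<Oplus>\<^bsub>V\<^esub>d\<in>{1..N}. tr d d v)"
proof -
  have "(\<lambda>(a, b). if a = b \<and> 1 \<le> a \<and> a \<le> N then \<one>\<^bsub>K\<^esub> else \<zero>\<^bsub>K\<^esub>) = (\<lambda>z. \<Oplus>\<^bsub>K\<^esub>d\<in>{1..N}. path K d d z)"
  proof (intro ext, clarify)
    fix a b
    show "(if a = b \<and> 1 \<le> a \<and> a \<le> N then \<one>\<^bsub>K\<^esub> else \<zero>\<^bsub>K\<^esub>) = (\<Oplus>\<^bsub>K\<^esub>d\<in>{1..N}. path K d d (a, b))"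
    proof (cases "a = b \<and> a \<in> {1..N}")
      case True
      then have "(\<Oplus>\<^bsub>K\<^esub>d\<in>{1..N}. path K d d (a, b)) = path K a a (a, b)"
        using assms by (intro R.finsum_single) (auto simp: path_def free_gen_def)
      then show ?thesis using True by (simp add: path_def free_gen_def)
    next
      case False
      have "(\<Oplus>\<^bsub>K\<^esub>d\<in>{1..N}. path K d d (a, b)) = \<zero>\<^bsub>K\<^esub>"
        using False by (intro R.add.finprod_one_eqI) (auto simp: path_def free_gen_def)
      then show ?thesis using False by auto
    qed
  qed
  moreover have "r v (\<lambda>z. \<Oplus>\<^bsub>K\<^esub>d\<in>{1..N}. path K d d z) = (\<Oplus>\<^bsub>V\<^esub>d\<in>{1..N}. r v (path K d d))"
    using act_sum[OF assms(1), of "{1..N}" "\<lambda>d. path K d d"] by (simp add: path_in)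
  ultimately show ?thesis using act_one[OF assms] by (simp add: tr_def)
qed

end

section \<open>Modules with coordinates in a representation\<close>

text \<open>The vertices of a product quiver whose factors have the lengths listed in \<open>ls\<close>.\<close>

definition vertices :: "nat list \<Rightarrow> nat list set" where
  "vertices ls = {x. length x = length ls \<and> (\<forall>s < length ls. 1 \<le> x ! s \<and> x ! s \<le> ls ! s)}"

lemma finite_vertices: "finite (vertices ls)"
proof -
  have "set x \<subseteq> {..sum_list ls} \<and> length x = length ls" if x: "x \<in> vertices ls" for x
  proof -
    have "a \<le> sum_list ls" if a: "a \<in> set x" for a
    proof -
      obtain s where s: "s < length x" "a = x ! s" using a by (metis in_set_conv_nth)
      then have "x ! s \<le> ls ! s" "ls ! s \<in> set ls" using x by (auto simp: vertices_def)
      then show ?thesis using s member_le_sum_list[of "ls ! s" ls] by simp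
    qed
    then show ?thesis using x by (auto simp: vertices_def)
  qed
  then have "vertices ls \<subseteq> {x. set x \<subseteq> {..sum_list ls} \<and> length x = length ls}" by blast
  then show ?thesis using finite_lists_length_eq[of "{..sum_list ls}" "length ls"] finite_subset by blast
qed

lemma vertices_update:
  "x \<in> vertices ls \<Longrightarrow> 1 \<le> c \<Longrightarrow> c \<le> x ! s \<Longrightarrow> s < length ls \<Longrightarrow> x[s := c] \<in> vertices ls"
  by (fastforce simp: vertices_def nth_list_update)

lemma (in submodule) finsum_in_submodule:
  assumes "\<And>i. i \<in> I \<Longrightarrow> f i \<in> N"
  shows "(\<Oplus>i\<in>I. f i) \<in> N"
proof -
  interpret module R M by (rule module)
  show ?thesis using assms
  proof (induct I rule: infinite_finite_induct)
    case (insert a A)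
    have "(\<Oplus>i\<in>insert a A. f i) = f a \<oplus> (\<Oplus>i\<in>A. f i)"
      using insert subset by (intro finsum_insert) auto
    then show ?case using insert by auto
  qed auto
qed

text \<open>Let \<open>V\<close> be a representation of the chain with \<open>N\<close> vertices and \<open>H\<close> a monotone map from the vertices of a
product of chains to that chain. The locale says that \<open>W\<close>, with its several right actions, is the pullback
of \<open>V\<close> along \<open>H\<close>: the maps \<open>EV x\<close> are the coordinates of an isomorphism from \<open>W\<close> to the product of the
spaces of \<open>V\<close> at the vertices \<open>H x\<close>, and in these coordinates an arrow of the product quiver acts by the
map of \<open>V\<close> along the image under \<open>H\<close>. Because the coordinates are jointly injective, every identity in \<open>W\<close>,
in particular each module axiom, can be checked in \<open>V\<close>.\<close>

locale pullback_coords = path_rep K V N r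
  for K :: "('k, 'r) ring_scheme" and V :: "('k, 'a, 'z) module_scheme" and N r +
  fixes W :: "('k, 'w) multimod" and ls :: "nat list"
    and H :: "nat list \<Rightarrow> nat" and EV :: "nat list \<Rightarrow> 'w \<Rightarrow> 'a"
  assumes H_range: "x \<in> vertices ls \<Longrightarrow> 1 \<le> H x \<and> H x \<le> N"
    and H_mono: "x \<in> vertices ls \<Longrightarrow> s < length ls \<Longrightarrow> 1 \<le> c \<Longrightarrow> c \<le> x ! s \<Longrightarrow> H (x[s := c]) \<le> H x"
    and zero_W: "\<zero>\<^bsub>W\<^esub> \<in> carrier W"
    and add_W: "w \<in> carrier W \<Longrightarrow> w' \<in> carrier W \<Longrightarrow> w \<oplus>\<^bsub>W\<^esub> w' \<in> carrier W"
    and smult_W: "k \<in> carrier K \<Longrightarrow> w \<in> carrier W \<Longrightarrow> k \<odot>\<^bsub>W\<^esub> w \<in> carrier W"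
    and ract_W: "s < length ls \<Longrightarrow> w \<in> carrier W \<Longrightarrow> a \<in> carrier (path_algebra K (ls ! s)) \<Longrightarrow>
                   ract W s w a \<in> carrier W"
    and EV_hom: "x \<in> vertices ls \<Longrightarrow> EV x \<in> module_hom K W V"
    and EV_zero: "x \<in> vertices ls \<Longrightarrow> EV x \<zero>\<^bsub>W\<^esub> = \<zero>\<^bsub>V\<^esub>"
    and EV_comp: "x \<in> vertices ls \<Longrightarrow> w \<in> carrier W \<Longrightarrow> tr (H x) (H x) (EV x w) = EV x w"
    and EV_ract: "x \<in> vertices ls \<Longrightarrow> s < length ls \<Longrightarrow> w \<in> carrier W \<Longrightarrow>
         a \<in> carrier (path_algebra K (ls ! s)) \<Longrightarrow>
         EV x (ract W s w a) =
           (\<Oplus>\<^bsub>V\<^esub>c\<in>{1..x ! s}. a (c, x ! s) \<odot>\<^bsub>V\<^esub> tr (H (x[s := c])) (H x) (EV (x[s := c]) w))"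
    and EV_inj: "w \<in> carrier W \<Longrightarrow> w' \<in> carrier W \<Longrightarrow> (\<And>x. x \<in> vertices ls \<Longrightarrow> EV x w = EV x w') \<Longrightarrow> w = w'"
    and EV_surj: "(\<And>x. x \<in> vertices ls \<Longrightarrow> u x \<in> carrier V \<and> tr (H x) (H x) (u x) = u x) \<Longrightarrow>
         \<exists>w \<in> carrier W. \<forall>x \<in> vertices ls. EV x w = u x"
begin

lemma EV_in: "x \<in> vertices ls \<Longrightarrow> w \<in> carrier W \<Longrightarrow> EV x w \<in> carrier V"
  using EV_hom by (rule module_hom_in)

lemma EV_add: "x \<in> vertices ls \<Longrightarrow> w \<in> carrier W \<Longrightarrow> w' \<in> carrier W \<Longrightarrow> EV x (w \<oplus>\<^bsub>W\<^esub> w') = EV x w \<oplus>\<^bsub>V\<^esub> EV x w'"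
  using EV_hom by (rule module_hom_add)

lemma EV_smult: "x \<in> vertices ls \<Longrightarrow> k \<in> carrier K \<Longrightarrow> w \<in> carrier W \<Longrightarrow> EV x (k \<odot>\<^bsub>W\<^esub> w) = k \<odot>\<^bsub>V\<^esub> EV x w"
  using EV_hom by (rule module_hom_smult)

lemma tr_H_hom:
  "x \<in> vertices ls \<Longrightarrow> s < length ls \<Longrightarrow> 1 \<le> c \<Longrightarrow> c \<le> x ! s \<Longrightarrow> tr (H (x[s := c])) (H x) \<in> module_hom K V V"
  using H_range[of x] H_range[OF vertices_update[of x ls c s]] H_mono[of x s c] by (intro tr_hom) auto

lemma tr_H_in:
  "x \<in> vertices ls \<Longrightarrow> s < length ls \<Longrightarrow> 1 \<le> c \<Longrightarrow> c \<le> x ! s \<Longrightarrow> v \<in> carrier V \<Longrightarrow>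
     tr (H (x[s := c])) (H x) v \<in> carrier V"
  by (rule module_hom_in[OF tr_H_hom])

lemma summand_in:
  assumes "x \<in> vertices ls" "s < length ls" "w \<in> carrier W" "a \<in> carrier (path_algebra K (ls ! s))" "c \<in> {1..x ! s}"
  shows "a (c, x ! s) \<odot>\<^bsub>V\<^esub> tr (H (x[s := c])) (H x) (EV (x[s := c]) w) \<in> carrier V"
  using assms by (intro smult_closed tr_H_in EV_in vertices_update coeff_in[of a]) auto

sublocale W: vectorspace K W
proof (rule vs_criteria)
  show "field K" by (rule field_axioms)
  show "\<forall>v\<in>carrier W. \<exists>neg_v\<in>carrier W. v \<oplus>\<^bsub>W\<^esub> neg_v = \<zero>\<^bsub>W\<^esub>"
  proof
    fix v assume v: "v \<in> carrier W"
    have "v \<oplus>\<^bsub>W\<^esub> ((\<ominus>\<^bsub>K\<^esub> \<one>\<^bsub>K\<^esub>) \<odot>\<^bsub>W\<^esub> v) = \<zero>\<^bsub>W\<^esub>"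
      by (rule EV_inj)
        (use v in \<open>auto simp: add_W smult_W zero_W EV_add EV_smult EV_zero EV_in smult_minus_1 r_neg\<close>)
    then show "\<exists>neg_v\<in>carrier W. v \<oplus>\<^bsub>W\<^esub> neg_v = \<zero>\<^bsub>W\<^esub>"
      using v by (intro bexI[of _ "(\<ominus>\<^bsub>K\<^esub> \<one>\<^bsub>K\<^esub>) \<odot>\<^bsub>W\<^esub> v"]) (auto simp: smult_W)
  qed
qed (safe intro!: zero_W add_W smult_W EV_inj R.m_closed R.a_closed,
     auto simp: add_W smult_W zero_W EV_add EV_smult EV_zero EV_in a_ac smult_assoc1 smult_l_distr smult_r_distr)

lemma EV_finsum:
  "x \<in> vertices ls \<Longrightarrow> g \<in> I \<rightarrow> carrier W \<Longrightarrow> EV x (\<Oplus>\<^bsub>W\<^esub>i\<in>I. g i) = (\<Oplus>\<^bsub>V\<^esub>i\<in>I. EV x (g i))"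
  using module_hom_finsum[OF W.module_axioms module_axioms EV_hom] .

text \<open>Functoriality of \<open>V\<close> contracts the two maps of \<open>V\<close> that arise from acting twice into one. This holds for
equal as well as for distinct factors, and gives associativity in the first case and commutation of the
actions in the second.\<close>

lemma EV_ract_ract:
  assumes x: "x \<in> vertices ls" and s: "s < length ls" and t: "t < length ls" and w: "w \<in> carrier W"
    and a: "a \<in> carrier (path_algebra K (ls ! s))" and b: "b \<in> carrier (path_algebra K (ls ! t))"
  shows "EV x (ract W t (ract W s w a) b) =
    (\<Oplus>\<^bsub>V\<^esub>d\<in>{1..x ! t}. \<Oplus>\<^bsub>V\<^esub>c\<in>{1..x[t := d] ! s}. (a (c, x[t := d] ! s) \<otimes>\<^bsub>K\<^esub> b (d, x ! t)) \<odot>\<^bsub>V\<^esub>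
        tr (H (x[t := d, s := c])) (H x) (EV (x[t := d, s := c]) w))"
  unfolding EV_ract[OF x t ract_W[OF s w a] b]
proof (rule finsum_cong', simp, rule Pi_I, goal_cases)
  case (1 d)
  then have y: "x[t := d] \<in> vertices ls" using x t by (intro vertices_update) auto
  show ?case
  proof (rule finsum_closed, rule Pi_I, goal_cases)
    case (1 c)
    then have "x[t := d, s := c] \<in> vertices ls" using s by (intro vertices_update[OF y]) auto
    moreover have "H (x[t := d, s := c]) \<le> H x"
      using H_mono[OF y s, of c] H_mono[OF x t, of d] \<open>d \<in> _\<close> 1 by auto
    ultimately show ?case using H_range[OF x] H_range[of "x[t := d, s := c]"] w
      by (intro smult_closed tr_in EV_in) (auto intro!: coeff_in[OF a] coeff_in[OF b])
  qed
next
  case (2 d)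
  then have y: "x[t := d] \<in> vertices ls" using x t by (intro vertices_update) auto
  have Hd: "H (x[t := d]) \<le> H x" using H_mono[OF x t, of d] 2 by auto
  have "b (d, x ! t) \<odot>\<^bsub>V\<^esub> tr (H (x[t := d])) (H x) (EV (x[t := d]) (ract W s w a)) =
      b (d, x ! t) \<odot>\<^bsub>V\<^esub> (\<Oplus>\<^bsub>V\<^esub>c\<in>{1..x[t := d] ! s}. tr (H (x[t := d])) (H x)
         (a (c, x[t := d] ! s) \<odot>\<^bsub>V\<^esub> tr (H (x[t := d, s := c])) (H (x[t := d])) (EV (x[t := d, s := c]) w)))"
    unfolding EV_ract[OF y s w a]
    using x t 2 summand_in[OF y s w a]
    by (subst module_hom_finsum[OF module_axioms module_axioms tr_H_hom]) auto
  also have "\<dots> = (\<Oplus>\<^bsub>V\<^esub>c\<in>{1..x[t := d] ! s}. b (d, x ! t) \<odot>\<^bsub>V\<^esub> tr (H (x[t := d])) (H x)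
         (a (c, x[t := d] ! s) \<odot>\<^bsub>V\<^esub> tr (H (x[t := d, s := c])) (H (x[t := d])) (EV (x[t := d, s := c]) w)))"
    using x t 2 summand_in[OF y s w a] by (intro smult_finsum coeff_in[OF b] Pi_I tr_H_in) auto
  also have "\<dots> = (\<Oplus>\<^bsub>V\<^esub>c\<in>{1..x[t := d] ! s}. (a (c, x[t := d] ! s) \<otimes>\<^bsub>K\<^esub> b (d, x ! t)) \<odot>\<^bsub>V\<^esub>
        tr (H (x[t := d, s := c])) (H x) (EV (x[t := d, s := c]) w))"
  proof (rule finsum_cong', simp, rule Pi_I, goal_cases)
    case (1 c)
    then have "x[t := d, s := c] \<in> vertices ls" using s by (intro vertices_update[OF y]) auto
    moreover have "H (x[t := d, s := c]) \<le> H x"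
      using H_mono[OF y s, of c] Hd 1 by auto
    ultimately show ?case using H_range[OF x] H_range[of "x[t := d, s := c]"] w
      by (intro smult_closed tr_in EV_in) (auto intro!: coeff_in[OF a] coeff_in[OF b])
  next
    case (2 c)
    then have z: "x[t := d, s := c] \<in> vertices ls" using s by (intro vertices_update[OF y]) auto
    have Hc: "H (x[t := d, s := c]) \<le> H (x[t := d])" using H_mono[OF y s, of c] 2 by auto
    note rng = H_range[OF x] H_range[OF y] H_range[OF z]
    let ?e = "EV (x[t := d, s := c]) w"
    have e: "?e \<in> carrier V" using EV_in[OF z w] .
    have "tr (H (x[t := d])) (H x) (a (c, x[t := d] ! s) \<odot>\<^bsub>V\<^esub> tr (H (x[t := d, s := c])) (H (x[t := d])) ?e)
       = a (c, x[t := d] ! s) \<odot>\<^bsub>V\<^esub> tr (H (x[t := d])) (H x) (tr (H (x[t := d, s := c])) (H (x[t := d])) ?e)"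
      using rng Hc Hd e by (intro module_hom_smult[OF tr_hom] coeff_in[OF a] tr_in) auto
    also have "tr (H (x[t := d])) (H x) (tr (H (x[t := d, s := c])) (H (x[t := d])) ?e) =
        tr (H (x[t := d, s := c])) (H x) ?e"
      using rng Hc Hd e by (intro tr_tr) auto
    finally show ?case
      using rng Hc Hd e tr_in[of "H (x[t := d, s := c])" "H x" ?e]
      by (simp add: smult_assoc1[symmetric] coeff_in[OF a] coeff_in[OF b] R.m_comm)
  qed
  finally show ?case .
qed

lemma ract_right_action:
  assumes s: "s < length ls"
  shows "right_action K (path_algebra K (ls ! s)) W (ract W s)"
  unfolding right_action_def
proof (intro conjI ballI, goal_cases)
  case (1 v a) then show ?case using s by (rule_tac ract_W)
next
  case (2 v w a)
  have "EV x (ract W s (v \<oplus>\<^bsub>W\<^esub> w) a) = EV x (ract W s v a \<oplus>\<^bsub>W\<^esub> ract W s w a)" if x: "x \<in> vertices ls" for x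
  proof -
    have "EV x (ract W s (v \<oplus>\<^bsub>W\<^esub> w) a) =
       (\<Oplus>\<^bsub>V\<^esub>c\<in>{1..x ! s}. a (c, x ! s) \<odot>\<^bsub>V\<^esub> tr (H (x[s := c])) (H x) (EV (x[s := c]) v)
          \<oplus>\<^bsub>V\<^esub> a (c, x ! s) \<odot>\<^bsub>V\<^esub> tr (H (x[s := c])) (H x) (EV (x[s := c]) w))"
      unfolding EV_ract[OF x s W.a_closed[OF 2(1,2)] 2(3)]
    proof (rule finsum_cong', simp, rule Pi_I, goal_cases)
      case (2 c) then show ?case
        using x s \<open>v \<in> _\<close> \<open>w \<in> _\<close>
        by (simp add: EV_add vertices_update module_hom_add[OF tr_H_hom] EV_in smult_r_distr tr_H_in
              coeff_in[OF \<open>a \<in> _\<close>])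
    qed (use summand_in[OF x s 2(1,3)] summand_in[OF x s 2(2,3)] in auto)
    then show ?thesis using summand_in[OF x s 2(1,3)] summand_in[OF x s 2(2,3)]
      using 2 x s by (simp add: EV_add ract_W EV_ract)
  qed
  then show ?case using 2 s by (intro EV_inj) (auto simp: ract_W)
next
  case (3 v a b)
  have "add (path_algebra K (ls ! s)) a b = (\<lambda>z. a z \<oplus>\<^bsub>K\<^esub> b z)" by (simp add: path_algebra_def)
  moreover have ab: "(\<lambda>z. a z \<oplus>\<^bsub>K\<^esub> b z) \<in> carrier (path_algebra K (ls ! s))"
    using 3 by (auto simp: in_path_algebra)
  moreover have "EV x (ract W s v (\<lambda>z. a z \<oplus>\<^bsub>K\<^esub> b z)) = EV x (ract W s v a \<oplus>\<^bsub>W\<^esub> ract W s v b)" if x: "x \<in> vertices ls" for x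
  proof -
    have "EV x (ract W s v (\<lambda>z. a z \<oplus>\<^bsub>K\<^esub> b z)) =
       (\<Oplus>\<^bsub>V\<^esub>c\<in>{1..x ! s}. a (c, x ! s) \<odot>\<^bsub>V\<^esub> tr (H (x[s := c])) (H x) (EV (x[s := c]) v)
          \<oplus>\<^bsub>V\<^esub> b (c, x ! s) \<odot>\<^bsub>V\<^esub> tr (H (x[s := c])) (H x) (EV (x[s := c]) v))"
      unfolding EV_ract[OF x s 3(1) ab]
    proof (rule finsum_cong', simp, rule Pi_I, goal_cases)
      case (2 c) then show ?case
        using x s \<open>v \<in> _\<close>
        by (simp add: vertices_update EV_in smult_l_distr tr_H_in coeff_in[OF \<open>a \<in> _\<close>] coeff_in[OF \<open>b \<in> _\<close>])
    qed (use summand_in[OF x s 3(1,2)] summand_in[OF x s 3(1,3)] in auto)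
    then show ?thesis using summand_in[OF x s 3(1,2)] summand_in[OF x s 3(1,3)]
      using 3 x s by (simp add: EV_add ract_W EV_ract)
  qed
  ultimately show ?case using 3 s by (intro EV_inj) (auto simp: ract_W)
next
  case (4 c v a)
  have "EV x (ract W s (c \<odot>\<^bsub>W\<^esub> v) a) = EV x (c \<odot>\<^bsub>W\<^esub> ract W s v a)" if x: "x \<in> vertices ls" for x
  proof -
    have "EV x (ract W s (c \<odot>\<^bsub>W\<^esub> v) a) =
       (\<Oplus>\<^bsub>V\<^esub>e\<in>{1..x ! s}. c \<odot>\<^bsub>V\<^esub> (a (e, x ! s) \<odot>\<^bsub>V\<^esub> tr (H (x[s := e])) (H x) (EV (x[s := e]) v)))"
      unfolding EV_ract[OF x s W.smult_closed[OF 4(1,2)] 4(3)]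
    proof (rule finsum_cong', simp, rule Pi_I, goal_cases)
      case (2 e) then show ?case
        using x s \<open>v \<in> _\<close> \<open>c \<in> _\<close>
        by (simp add: EV_smult vertices_update module_hom_smult[OF tr_H_hom] EV_in tr_H_in
              coeff_in[OF \<open>a \<in> _\<close>] smult_assoc1[symmetric] R.m_comm)
    qed (use summand_in[OF x s 4(2,3)] 4(1) in auto)
    then show ?thesis using summand_in[OF x s 4(2,3)] 4 x s
      by (simp add: EV_smult ract_W EV_ract) (subst smult_finsum, auto)
  qed
  then show ?case using 4 s by (intro EV_inj) (auto simp: ract_W)
next
  case (5 c v a)
  have "smult (path_algebra K (ls ! s)) c a = (\<lambda>z. c \<otimes>\<^bsub>K\<^esub> a z)" by (simp add: path_algebra_def)
  moreover have ca: "(\<lambda>z. c \<otimes>\<^bsub>K\<^esub> a z) \<in> carrier (path_algebra K (ls ! s))"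
    using 5 by (auto simp: in_path_algebra)
  moreover have "EV x (ract W s v (\<lambda>z. c \<otimes>\<^bsub>K\<^esub> a z)) = EV x (c \<odot>\<^bsub>W\<^esub> ract W s v a)" if x: "x \<in> vertices ls" for x
  proof -
    have "EV x (ract W s v (\<lambda>z. c \<otimes>\<^bsub>K\<^esub> a z)) =
       (\<Oplus>\<^bsub>V\<^esub>e\<in>{1..x ! s}. c \<odot>\<^bsub>V\<^esub> (a (e, x ! s) \<odot>\<^bsub>V\<^esub> tr (H (x[s := e])) (H x) (EV (x[s := e]) v)))"
      unfolding EV_ract[OF x s 5(2) ca]
    proof (rule finsum_cong', simp, rule Pi_I, goal_cases)
      case (2 e) then show ?case
        using x s \<open>v \<in> _\<close> \<open>c \<in> _\<close>
        by (simp add: vertices_update EV_in tr_H_in coeff_in[OF \<open>a \<in> _\<close>] smult_assoc1)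
    qed (use summand_in[OF x s 5(2,3)] 5(1) in auto)
    then show ?thesis using summand_in[OF x s 5(2,3)] 5 x s
      by (simp add: EV_smult ract_W EV_ract) (subst smult_finsum, auto)
  qed
  ultimately show ?case using 5 s by (intro EV_inj) (auto simp: ract_W)
next
  case (6 v)
  let ?one = "\<lambda>(a, b). if a = b \<and> 1 \<le> a \<and> a \<le> ls ! s then \<one>\<^bsub>K\<^esub> else \<zero>\<^bsub>K\<^esub>"
  have one: "one (path_algebra K (ls ! s)) = ?one" by (simp add: path_algebra_def)
  have c1: "?one \<in> carrier (path_algebra K (ls ! s))" by (auto simp: in_path_algebra)
  have "EV x (ract W s v ?one) = EV x v" if x: "x \<in> vertices ls" for x
  proof -
    have xs: "1 \<le> x ! s" "x ! s \<le> ls ! s" using x s by (auto simp: vertices_def)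
    have "EV x (ract W s v ?one) = ?one (x ! s, x ! s) \<odot>\<^bsub>V\<^esub> tr (H (x[s := x ! s])) (H x) (EV (x[s := x ! s]) v)"
      unfolding EV_ract[OF x s 6 c1]
    proof (rule finsum_single)
      fix i assume i: "i \<in> {1..x ! s}" "i \<noteq> x ! s"
      show "?one (i, x ! s) \<odot>\<^bsub>V\<^esub> tr (H (x[s := i])) (H x) (EV (x[s := i]) v) = \<zero>\<^bsub>V\<^esub>"
        using i tr_H_in[OF x s _ _ EV_in[OF vertices_update[OF x _ _ s] 6], of i i] by simp
    qed (use xs summand_in[OF x s 6 c1, of "x ! s"] in auto)
    then show ?thesis using x xs 6 by (simp add: EV_comp EV_in)
  qed
  then show ?case unfolding one using 6 s c1 by (intro EV_inj) (auto simp: ract_W)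
next
  \<comment> \<open>Associativity. Since \<open>a (c, d)\<close> vanishes for \<open>c > d\<close>, both sides are sums over the whole square
    of pairs \<open>(c, d)\<close>, where the summations can be exchanged.\<close>
  case (7 v a b)
  let ?ab = "\<lambda>(c, d). \<Oplus>\<^bsub>K\<^esub>e\<in>{c..d}. a (c, e) \<otimes>\<^bsub>K\<^esub> b (e, d)"
  have ab: "mult (path_algebra K (ls ! s)) a b = ?ab" by (simp add: path_algebra_def)
  note ca = coeff_in[OF 7(2)] and cb = coeff_in[OF 7(3)]
  have zero: "a (c, d) = \<zero>\<^bsub>K\<^esub>" "b (c, d) = \<zero>\<^bsub>K\<^esub>" if "\<not> (1 \<le> c \<and> c \<le> d \<and> d \<le> ls ! s)" for c d
    using 7(2,3) that unfolding in_path_algebra by meson+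
  have "?ab (c, d) = \<zero>\<^bsub>K\<^esub>" if "\<not> (1 \<le> c \<and> c \<le> d \<and> d \<le> ls ! s)" for c d
  proof -
    have "(\<Oplus>\<^bsub>K\<^esub>e\<in>{c..d}. a (c, e) \<otimes>\<^bsub>K\<^esub> b (e, d)) = \<zero>\<^bsub>K\<^esub>"
    proof (rule R.add.finprod_one_eqI)
      fix e assume "e \<in> {c..d}"
      then have "a (c, e) = \<zero>\<^bsub>K\<^esub> \<or> b (e, d) = \<zero>\<^bsub>K\<^esub>"
        using that zero(1)[of c e] zero(2)[of e d] by auto
      then show "a (c, e) \<otimes>\<^bsub>K\<^esub> b (e, d) = \<zero>\<^bsub>K\<^esub>" using ca[of c e] cb[of e d] by auto
    qed
    then show ?thesis by simp
  qed
  then have abc: "?ab \<in> carrier (path_algebra K (ls ! s))"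
    unfolding in_path_algebra using ca cb by (auto intro!: R.finsum_closed)
  have "EV x (ract W s v ?ab) = EV x (ract W s (ract W s v a) b)" if x: "x \<in> vertices ls" for x
  proof -
    have len: "s < length x" using x s by (simp add: vertices_def)
    let ?X = "x ! s"
    let ?E = "\<lambda>c. tr (H (x[s := c])) (H x) (EV (x[s := c]) v)"
    have E: "?E c \<in> carrier V" if "c \<in> {1..?X}" for c
      using that x s 7(1) by (intro tr_H_in EV_in vertices_update) auto
    have "EV x (ract W s v ?ab) = (\<Oplus>\<^bsub>V\<^esub>c\<in>{1..?X}. \<Oplus>\<^bsub>V\<^esub>d\<in>{1..?X}. (a (c, d) \<otimes>\<^bsub>K\<^esub> b (d, ?X)) \<odot>\<^bsub>V\<^esub> ?E c)"
      unfolding EV_ract[OF x s 7(1) abc]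
    proof (rule finsum_cong', simp, rule Pi_I, goal_cases)
      case (1 c) then show ?case using E[of c] ca cb by (intro finsum_closed Pi_I) auto
    next
      case (2 c)
      have "(\<Oplus>\<^bsub>K\<^esub>d\<in>{c..?X}. a (c, d) \<otimes>\<^bsub>K\<^esub> b (d, ?X)) = (\<Oplus>\<^bsub>K\<^esub>d\<in>{1..?X}. a (c, d) \<otimes>\<^bsub>K\<^esub> b (d, ?X))"
        using 2 ca cb zero(1) by (intro R.finsum_sup) auto
      then show ?case using 2 E[of c] ca cb by (simp add: finsum_smult_left)
    qed
    also have "\<dots> = (\<Oplus>\<^bsub>V\<^esub>d\<in>{1..?X}. \<Oplus>\<^bsub>V\<^esub>c\<in>{1..?X}. (a (c, d) \<otimes>\<^bsub>K\<^esub> b (d, ?X)) \<odot>\<^bsub>V\<^esub> ?E c)"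
      using E ca cb by (intro finsum_swap2) auto
    also have "\<dots> = (\<Oplus>\<^bsub>V\<^esub>d\<in>{1..?X}. \<Oplus>\<^bsub>V\<^esub>c\<in>{1..d}. (a (c, d) \<otimes>\<^bsub>K\<^esub> b (d, ?X)) \<odot>\<^bsub>V\<^esub> ?E c)"
    proof (rule finsum_cong', simp, rule Pi_I, goal_cases)
      case (1 d) then show ?case using E ca cb by (intro finsum_closed Pi_I) auto
    next
      case (2 d) then show ?case using E ca cb zero(1)
        by (intro finsum_sup[symmetric]) auto
    qed
    also have "\<dots> = EV x (ract W s (ract W s v a) b)"
      unfolding EV_ract_ract[OF x s s 7] using len by simp
    finally show ?thesis .
  qed
  then show ?case unfolding ab using 7 s abc by (intro EV_inj) (auto simp: ract_W)
qed

lemma ract_commute: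
  assumes s: "s < length ls" and t: "t < length ls" and "s \<noteq> t" and w: "w \<in> carrier W"
    and a: "a \<in> carrier (path_algebra K (ls ! s))" and b: "b \<in> carrier (path_algebra K (ls ! t))"
  shows "ract W t (ract W s w a) b = ract W s (ract W t w b) a"
proof (rule EV_inj)
  fix x assume x: "x \<in> vertices ls"
  have len: "s < length x" "t < length x" using x s t by (simp_all add: vertices_def)
  let ?E = "\<lambda>c d. tr (H (x[s := c, t := d])) (H x) (EV (x[s := c, t := d]) w)"
  have E: "?E c d \<in> carrier V" if cd: "c \<in> {1..x ! s}" "d \<in> {1..x ! t}" for c d
  proof -
    have y: "x[s := c] \<in> vertices ls" using cd x s by (intro vertices_update) auto
    then have z: "x[s := c, t := d] \<in> vertices ls" using cd t \<open>s \<noteq> t\<close> by (intro vertices_update[OF y]) auto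
    have "H (x[s := c, t := d]) \<le> H x"
      using H_mono[OF x s, of c] H_mono[OF y t, of d] cd \<open>s \<noteq> t\<close> by auto
    then show ?thesis using H_range[OF x] H_range[OF z] EV_in[OF z w] by (intro tr_in) auto
  qed
  have "EV x (ract W t (ract W s w a) b) =
      (\<Oplus>\<^bsub>V\<^esub>d\<in>{1..x ! t}. \<Oplus>\<^bsub>V\<^esub>c\<in>{1..x ! s}. (a (c, x ! s) \<otimes>\<^bsub>K\<^esub> b (d, x ! t)) \<odot>\<^bsub>V\<^esub> ?E c d)"
    unfolding EV_ract_ract[OF x s t w a b] using \<open>s \<noteq> t\<close> by (simp add: list_update_swap)
  also have "\<dots> = (\<Oplus>\<^bsub>V\<^esub>c\<in>{1..x ! s}. \<Oplus>\<^bsub>V\<^esub>d\<in>{1..x ! t}. (a (c, x ! s) \<otimes>\<^bsub>K\<^esub> b (d, x ! t)) \<odot>\<^bsub>V\<^esub> ?E c d)"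
    using E coeff_in[OF a] coeff_in[OF b] by (intro finsum_swap2) auto
  also have "\<dots> = EV x (ract W s (ract W t w b) a)"
    unfolding EV_ract_ract[OF x t s w b a] using \<open>s \<noteq> t\<close>
    by (simp add: R.m_comm coeff_in[OF a] coeff_in[OF b])
  finally show "EV x (ract W t (ract W s w a) b) = EV x (ract W s (ract W t w b) a)" .
qed (use assms in \<open>auto simp: ract_W\<close>)

text \<open>A finite generating set of \<open>V\<close> is moved into \<open>W\<close> once for each vertex \<open>x\<close>, by the linear map that places a
vector at the coordinate \<open>x\<close> after projecting it to the space of \<open>V\<close> at \<open>H x\<close>.\<close>

lemma fin_dim_W:
  assumes "fin_dim"
  shows "W.fin_dim"
proof -
  obtain G where G: "finite G" "G \<subseteq> carrier V" "span G = carrier V"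
    using assms by (auto simp: fin_dim_def)
  have "\<exists>w \<in> carrier W. \<forall>y \<in> vertices ls. EV y w = (if y = x then tr (H x) (H x) v else \<zero>\<^bsub>V\<^esub>)"
    if "x \<in> vertices ls" "v \<in> carrier V" for x v
  proof (rule EV_surj)
    fix y assume "y \<in> vertices ls"
    with that H_range[of x] H_range[of y] show "(if y = x then tr (H x) (H x) v else \<zero>\<^bsub>V\<^esub>) \<in> carrier V \<and>
        tr (H y) (H y) (if y = x then tr (H x) (H x) v else \<zero>\<^bsub>V\<^esub>) =
        (if y = x then tr (H x) (H x) v else \<zero>\<^bsub>V\<^esub>)"
      by (auto simp: tr_in tr_tr module_hom_zero[OF module_axioms module_axioms tr_hom])
  qed
  then obtain ins where ins: "\<And>x v. x \<in> vertices ls \<Longrightarrow> v \<in> carrier V \<Longrightarrow> ins x v \<in> carrier W"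
    "\<And>x v y. x \<in> vertices ls \<Longrightarrow> v \<in> carrier V \<Longrightarrow> y \<in> vertices ls \<Longrightarrow>
       EV y (ins x v) = (if y = x then tr (H x) (H x) v else \<zero>\<^bsub>V\<^esub>)"
    by metis
  have ins_hom: "ins x \<in> module_hom K V W" if x: "x \<in> vertices ls" for x
    using x H_range[OF x]
    by (intro module_homI EV_inj)
      (auto simp: ins EV_add EV_smult module_hom_add[OF tr_hom] module_hom_smult[OF tr_hom])
  define S where "S = (\<Union>x \<in> vertices ls. ins x ` G)"
  have S: "finite S" "S \<subseteq> carrier W"
    using G finite_vertices ins(1) by (auto simp: S_def)
  have sub: "submodule K (W.span S) W" using W.span_is_submodule[OF S(2)] .
  have ins_span: "ins x v \<in> W.span S" if x: "x \<in> vertices ls" and v: "v \<in> carrier V" for x v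
  proof -
    obtain a A where A: "finite A" "A \<subseteq> G" "a \<in> A \<rightarrow> carrier K" "v = lincomb a A"
      using v unfolding G(3)[symmetric] span_def mem_Collect_eq by (elim exE conjE) 
    have "ins x v = (\<Oplus>\<^bsub>W\<^esub>g\<in>A. ins x (a g \<odot>\<^bsub>V\<^esub> g))"
      unfolding A(4) lincomb_def using A G(2)
      by (intro module_hom_finsum[OF module_axioms W.module_axioms ins_hom[OF x]]) auto
    also have "\<dots> \<in> W.span S"
    proof (rule submodule.finsum_in_submodule[OF sub])
      fix g assume g: "g \<in> A"
      then have "ins x (a g \<odot>\<^bsub>V\<^esub> g) = a g \<odot>\<^bsub>W\<^esub> ins x g"
        using A G(2) by (intro module_hom_smult[OF ins_hom[OF x]]) auto
      moreover have "ins x g \<in> W.span S"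
        using W.in_own_span[OF S(2)] g A(2) x by (auto simp: S_def)
      ultimately show "ins x (a g \<odot>\<^bsub>V\<^esub> g) \<in> W.span S"
        using g A(3) submodule.smult_closed[OF sub] by auto
    qed
    finally show ?thesis .
  qed
  have "w \<in> W.span S" if w: "w \<in> carrier W" for w
  proof -
    have "w = (\<Oplus>\<^bsub>W\<^esub>x\<in>vertices ls. ins x (EV x w))"
    proof (rule EV_inj)
      fix y assume y: "y \<in> vertices ls"
      have "EV y (\<Oplus>\<^bsub>W\<^esub>x\<in>vertices ls. ins x (EV x w)) = (\<Oplus>\<^bsub>V\<^esub>x\<in>vertices ls. EV y (ins x (EV x w)))"
        using y w ins(1) EV_in by (intro EV_finsum) auto
      also have "\<dots> = EV y (ins y (EV y w))"
        using y w finite_vertices by (intro finsum_single) (auto simp: ins EV_in EV_comp)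
      finally show "EV y w = EV y (\<Oplus>\<^bsub>W\<^esub>x\<in>vertices ls. ins x (EV x w))"
        using y w by (simp add: ins EV_in EV_comp)
    qed (use w ins EV_in in auto)
    moreover have "\<dots> \<in> W.span S"
      using w ins_span EV_in by (intro submodule.finsum_in_submodule[OF sub]) auto
    ultimately show ?thesis by simp
  qed
  then have "W.span S = carrier W" using W.span_is_subset2[OF S(2)] by auto
  then show ?thesis unfolding W.fin_dim_def using S by blast
qed

lemma fd_module_W: "fin_dim \<Longrightarrow> fd_module K ls W"
  unfolding fd_module_def
  using fin_dim_W W.vectorspace_axioms ract_right_action ract_commute by blast

end

section \<open>Functors with coordinates\<close>

lemma fd_module_path_rep:
  "fd_module K ms V \<Longrightarrow> s < length ms \<Longrightarrow> path_rep K V (ms ! s) (ract V s)"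
  unfolding fd_module_def path_rep_def path_rep_axioms_def by blast

lemma Obj_mod_cat [simp]: "V \<in> Obj (mod_cat K ms) \<longleftrightarrow> fd_module K ms V"
  by (simp add: mod_cat_def)

lemma Hom_mod_cat:
  "f \<in> Hom (mod_cat K ms) V W \<longleftrightarrow> f \<in> carrier V \<rightarrow>\<^sub>E carrier W \<and> f \<in> module_hom K V W \<and>
     (\<forall>t < length ms. \<forall>a \<in> carrier (path_algebra K (ms ! t)). \<forall>v \<in> carrier V.
        f (ract V t v a) = ract W t (f v) a)"
  by (simp add: mod_cat_def)

lemma Ident_mod_cat: "Ident (mod_cat K ms) V = (\<lambda>v \<in> carrier V. v)"
  by (simp add: mod_cat_def)

lemma Cmp_mod_cat: "Cmp (mod_cat K ms) U V W g f = compose (carrier U) g f"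
  by (simp add: mod_cat_def)

lemma Ident_in_Hom: 
  assumes "fd_module K ms V"
  shows "Ident (mod_cat K ms) V \<in> Hom (mod_cat K ms) V V"
proof -
  interpret vectorspace K V using assms by (simp add: fd_module_def)
  have "ract V t v a \<in> carrier V" if "t < length ms" "a \<in> carrier (path_algebra K (ms ! t))" "v \<in> carrier V" for t v a
    using path_rep.act_in[OF fd_module_path_rep[OF assms that(1)] that(3,2)] .
  then show ?thesis unfolding Hom_mod_cat Ident_mod_cat by (auto intro: module_homI)
qed

lemma Cmp_in_Hom:
  assumes "f \<in> Hom (mod_cat K ms) U V" "g \<in> Hom (mod_cat K ms) V W" "fd_module K ms U"
  shows "Cmp (mod_cat K ms) U V W g f \<in> Hom (mod_cat K ms) U W"
proof -
  interpret vectorspace K U using assms(3) by (simp add: fd_module_def)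
  have U: "ract U t v a \<in> carrier U" if "t < length ms" "a \<in> carrier (path_algebra K (ms ! t))" "v \<in> carrier U" for t v a
    using path_rep.act_in[OF fd_module_path_rep[OF assms(3) that(1)] that(3,2)] .
  have fm: "f \<in> module_hom K U V" and gm: "g \<in> module_hom K V W"
    using assms by (auto simp: Hom_mod_cat)
  have "compose (carrier U) g f \<in> module_hom K U W"
    by (rule module_homI)
      (auto simp: compose_def module_hom_in[OF fm] module_hom_in[OF gm] module_hom_add[OF fm] module_hom_add[OF gm]
        module_hom_smult[OF fm] module_hom_smult[OF gm])
  moreover have "compose (carrier U) g f (ract U t v a) = ract W t (compose (carrier U) g f v) a"
    if "t < length ms" "a \<in> carrier (path_algebra K (ms ! t))" "v \<in> carrier U" for t v a
    using that assms(1,2) U[OF that] module_hom_in[OF fm that(3)] by (simp add: Hom_mod_cat compose_def)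
  ultimately show ?thesis unfolding Hom_mod_cat Cmp_mod_cat
    using module_hom_in[OF fm] module_hom_in[OF gm] by (auto simp: compose_def)
qed

lemma Hom_tr:
  assumes "f \<in> Hom (mod_cat K [N]) V V'" "path_rep K V N (ract V 0)" "path_rep K V' N (ract V' 0)" "v \<in> carrier V"
    "1 \<le> c" "c \<le> d" "d \<le> N"
  shows "f (path_rep.tr K (ract V 0) c d v) = path_rep.tr K (ract V' 0) c d (f v)"
proof -
  interpret path_rep K V N "ract V 0" by fact
  show ?thesis using assms path_in[of c d] unfolding Hom_mod_cat tr_def path_rep.tr_def[OF assms(3)]
    by simp
qed

text \<open>The actions on a pullback are expressed by the maps of \<open>V\<close>, with which \<open>f\<close> commutes. So a map that is \<open>f\<close> in
each coordinate is a homomorphism for all the actions at once.\<close>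

lemma lift_hom:
  assumes W: "pullback_coords K V N (ract V 0) W ls H ev" and W': "pullback_coords K V' N (ract V' 0) W' ls H ev'"
    and f: "f \<in> Hom (mod_cat K [N]) V V'"
    and \<phi>: "\<phi> \<in> carrier W \<rightarrow>\<^sub>E carrier W'"
    and ev: "\<And>x w. x \<in> vertices ls \<Longrightarrow> w \<in> carrier W \<Longrightarrow> ev' x (\<phi> w) = f (ev x w)"
  shows "\<phi> \<in> Hom (mod_cat K ls) W W'"
proof -
  interpret W: pullback_coords K V N "ract V 0" W ls H ev by fact
  interpret W': pullback_coords K V' N "ract V' 0" W' ls H ev' by fact
  have fh: "f \<in> module_hom K V V'" using f by (simp add: Hom_mod_cat)
  have \<phi>_in: "\<phi> w \<in> carrier W'" if "w \<in> carrier W" for w using \<phi> that by auto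
  have "\<phi> \<in> module_hom K W W'"
    by (rule module_homI; (rule W'.EV_inj)?)
      (auto simp: \<phi>_in ev W.add_W W.smult_W W'.add_W W'.smult_W W.EV_add W'.EV_add W.EV_smult W'.EV_smult
        module_hom_add[OF fh] module_hom_smult[OF fh] W.EV_in)
  moreover have "\<phi> (ract W t w a) = ract W' t (\<phi> w) a"
    if t: "t < length ls" and a: "a \<in> carrier (path_algebra K (ls ! t))" and w: "w \<in> carrier W" for t a w
  proof (rule W'.EV_inj)
    fix x assume x: "x \<in> vertices ls"
    have "ev' x (\<phi> (ract W t w a)) = f (ev x (ract W t w a))"
      using x w a t by (simp add: ev W.ract_W)
    also have "\<dots> = (\<Oplus>\<^bsub>V'\<^esub>c\<in>{1..x ! t}. f (a (c, x ! t) \<odot>\<^bsub>V\<^esub> W.tr (H (x[t := c])) (H x) (ev (x[t := c]) w)))"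
      unfolding W.EV_ract[OF x t w a] using W.summand_in[OF x t w a]
      by (intro module_hom_finsum[OF W.module_axioms W'.module_axioms fh]) auto
    also have "\<dots> = (\<Oplus>\<^bsub>V'\<^esub>c\<in>{1..x ! t}. a (c, x ! t) \<odot>\<^bsub>V'\<^esub> W'.tr (H (x[t := c])) (H x) (ev' (x[t := c]) (\<phi> w)))"
    proof (rule W'.finsum_cong', simp, rule Pi_I, goal_cases)
      case (1 c) then show ?case using W'.summand_in[OF x t \<phi>_in[OF w] a] by auto
    next
      case (2 c)
      then have y: "x[t := c] \<in> vertices ls" using x t by (intro vertices_update) auto
      have "f (W.tr (H (x[t := c])) (H x) (ev (x[t := c]) w)) = W'.tr (H (x[t := c])) (H x) (f (ev (x[t := c]) w))"
        using W.H_range[OF x] W.H_range[OF y] W.H_mono[OF x t, of c] 2 W.EV_in[OF y w]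
        by (intro Hom_tr[OF f W.path_rep_axioms W'.path_rep_axioms]) auto
      then show ?case using 2 x t y w
        by (simp add: module_hom_smult[OF fh] W.coeff_in[OF a] W.tr_H_in W.EV_in ev)
    qed
    also have "\<dots> = ev' x (ract W' t (\<phi> w) a)"
      by (rule W'.EV_ract[OF x t \<phi>_in[OF w] a, symmetric])
    finally show "ev' x (\<phi> (ract W t w a)) = ev' x (ract W' t (\<phi> w) a)" .
  qed (use t a w \<phi>_in in \<open>auto intro: W.ract_W W'.ract_W\<close>)
  ultimately show ?thesis using \<phi> by (simp add: Hom_mod_cat)
qed

text \<open>\<open>F\<close> is the pullback along \<open>H\<close>, up to the natural coordinates \<open>ev\<close>. The condition on
morphisms, naturality of the coordinates, determines \<open>farr F V V' f\<close>; this gives functoriality.\<close>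

definition coord_functor ::
  "('k, 'r) ring_scheme \<Rightarrow> nat \<Rightarrow> nat list \<Rightarrow> (nat list \<Rightarrow> nat) \<Rightarrow>
   (('k, 'a) multimod, 'a \<Rightarrow> 'a, ('k, 'w) multimod, 'w \<Rightarrow> 'w) functor_data \<Rightarrow>
   (('k, 'a) multimod \<Rightarrow> nat list \<Rightarrow> 'w \<Rightarrow> 'a) \<Rightarrow> bool" where
  "coord_functor K N ls H F ev \<longleftrightarrow>
    (\<forall>V. fd_module K [N] V \<longrightarrow> pullback_coords K V N (ract V 0) (fobj F V) ls H (ev V)) \<and>
    (\<forall>V V' f. fd_module K [N] V \<longrightarrow> fd_module K [N] V' \<longrightarrow> f \<in> Hom (mod_cat K [N]) V V' \<longrightarrow>
       farr F V V' f \<in> carrier (fobj F V) \<rightarrow>\<^sub>E carrier (fobj F V') \<and>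
       (\<forall>x \<in> vertices ls. \<forall>w \<in> carrier (fobj F V). ev V' x (farr F V V' f w) = f (ev V x w)))"

lemma coord_functorD:
  assumes "coord_functor K N ls H F ev"
  shows "fd_module K [N] V \<Longrightarrow> pullback_coords K V N (ract V 0) (fobj F V) ls H (ev V)"
    and "fd_module K [N] V \<Longrightarrow> fd_module K [N] V' \<Longrightarrow> f \<in> Hom (mod_cat K [N]) V V' \<Longrightarrow>
       farr F V V' f \<in> carrier (fobj F V) \<rightarrow>\<^sub>E carrier (fobj F V')"
    and "fd_module K [N] V \<Longrightarrow> fd_module K [N] V' \<Longrightarrow> f \<in> Hom (mod_cat K [N]) V V' \<Longrightarrow>
       x \<in> vertices ls \<Longrightarrow> w \<in> carrier (fobj F V) \<Longrightarrow> ev V' x (farr F V V' f w) = f (ev V x w)"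
  using assms unfolding coord_functor_def by blast+

lemma coord_functor_obj:
  assumes F: "coord_functor K N ls H F ev" and V: "fd_module K [N] V"
  shows "fd_module K ls (fobj F V)"
proof -
  interpret pullback_coords K V N "ract V 0" "fobj F V" ls H "ev V" by (rule coord_functorD(1)[OF F V])
  show ?thesis using V by (intro fd_module_W) (auto simp: fd_module_def)
qed

lemma coord_functor_arr:
  assumes F: "coord_functor K N ls H F ev" and V: "fd_module K [N] V" "fd_module K [N] V'"
    and f: "f \<in> Hom (mod_cat K [N]) V V'"
  shows "farr F V V' f \<in> Hom (mod_cat K ls) (fobj F V) (fobj F V')"
  by (rule lift_hom[OF coord_functorD(1)[OF F V(1)] coord_functorD(1)[OF F V(2)] f
        coord_functorD(2)[OF F V f] coord_functorD(3)[OF F V f]])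

lemma coord_functor_is_functor:
  fixes F :: "(('k, 'a) multimod, 'a \<Rightarrow> 'a, ('k, 'w) multimod, 'w \<Rightarrow> 'w) functor_data"
  assumes F: "coord_functor K N ls H F ev"
  shows "is_functor (mod_cat K [N]) (mod_cat K ls) F"
  unfolding is_functor_def Obj_mod_cat
proof (intro conjI ballI)
  fix X :: "('k, 'a) multimod" assume "X \<in> Obj (mod_cat K [N])" then have X: "fd_module K [N] X" by simp
  interpret pullback_coords K X N "ract X 0" "fobj F X" ls H "ev X" by (rule coord_functorD(1)[OF F X])
  show "fd_module K ls (fobj F X)" by (rule coord_functor_obj[OF F X])
  note I = Ident_in_Hom[OF X]
  show "farr F X X (Ident (mod_cat K [N]) X) = Ident (mod_cat K ls) (fobj F X)"
  proof (rule PiE_ext)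
    show "farr F X X (Ident (mod_cat K [N]) X) \<in> carrier (fobj F X) \<rightarrow>\<^sub>E carrier (fobj F X)"
      by (rule coord_functorD(2)[OF F X X I])
    show "Ident (mod_cat K ls) (fobj F X) \<in> carrier (fobj F X) \<rightarrow>\<^sub>E carrier (fobj F X)"
      by (simp add: Ident_mod_cat)
    fix w assume w: "w \<in> carrier (fobj F X)"
    have "farr F X X (Ident (mod_cat K [N]) X) w = w"
      using coord_functorD(2)[OF F X X I] w
      by (intro EV_inj) (auto simp: coord_functorD(3)[OF F X X I, unfolded Ident_mod_cat] Ident_mod_cat EV_in)
    then show "farr F X X (Ident (mod_cat K [N]) X) w = Ident (mod_cat K ls) (fobj F X) w"
      using w by (simp add: Ident_mod_cat)
  qed
next
  fix X Y :: "('k, 'a) multimod" and f assume "X \<in> Obj (mod_cat K [N])" "Y \<in> Obj (mod_cat K [N])" "f \<in> Hom (mod_cat K [N]) X Y"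
  then show "farr F X Y f \<in> Hom (mod_cat K ls) (fobj F X) (fobj F Y)"
    by (intro coord_functor_arr[OF F]) auto
next
  fix X Y Z :: "('k, 'a) multimod" and f g
  assume "X \<in> Obj (mod_cat K [N])" "Y \<in> Obj (mod_cat K [N])" "Z \<in> Obj (mod_cat K [N])"
    and f: "f \<in> Hom (mod_cat K [N]) X Y" and g: "g \<in> Hom (mod_cat K [N]) Y Z"
  then have X: "fd_module K [N] X" and Y: "fd_module K [N] Y" and Z: "fd_module K [N] Z" by auto
  interpret X: pullback_coords K X N "ract X 0" "fobj F X" ls H "ev X" by (rule coord_functorD(1)[OF F X])
  interpret Z: pullback_coords K Z N "ract Z 0" "fobj F Z" ls H "ev Z" by (rule coord_functorD(1)[OF F Z])
  note gf = Cmp_in_Hom[OF f g X]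
  note arr = coord_functorD(2)[OF F X Y f] coord_functorD(2)[OF F Y Z g] coord_functorD(2)[OF F X Z gf]
  show "farr F X Z (Cmp (mod_cat K [N]) X Y Z g f) =
    Cmp (mod_cat K ls) (fobj F X) (fobj F Y) (fobj F Z) (farr F Y Z g) (farr F X Y f)"
  proof (rule PiE_ext[OF arr(3)])
    show "Cmp (mod_cat K ls) (fobj F X) (fobj F Y) (fobj F Z) (farr F Y Z g) (farr F X Y f)
       \<in> carrier (fobj F X) \<rightarrow>\<^sub>E carrier (fobj F Z)"
      using arr by (auto simp: Cmp_mod_cat compose_def)
    fix w assume w: "w \<in> carrier (fobj F X)"
    have fw: "farr F X Y f w \<in> carrier (fobj F Y)" using arr w by auto
    have "farr F X Z (Cmp (mod_cat K [N]) X Y Z g f) w = farr F Y Z g (farr F X Y f w)"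
    proof (rule Z.EV_inj)
      fix x assume x: "x \<in> vertices ls"
      show "ev Z x (farr F X Z (Cmp (mod_cat K [N]) X Y Z g f) w) = ev Z x (farr F Y Z g (farr F X Y f w))"
        using coord_functorD(3)[OF F X Z gf x w] coord_functorD(3)[OF F Y Z g x fw]
          coord_functorD(3)[OF F X Y f x w] X.EV_in[OF x w] by (simp add: Cmp_mod_cat compose_def)
    qed (use arr w fw in auto)
    then show "farr F X Z (Cmp (mod_cat K [N]) X Y Z g f) w =
       Cmp (mod_cat K ls) (fobj F X) (fobj F Y) (fobj F Z) (farr F Y Z g) (farr F X Y f) w"
      using w by (simp add: Cmp_mod_cat compose_def)
  qed
qed

lemma coords_transfer:
  assumes W: "pullback_coords K V N r W ls H ev" and W': "pullback_coords K V N r W' ls H ev'"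
  obtains \<phi> where "\<phi> \<in> carrier W \<rightarrow>\<^sub>E carrier W'" "\<And>x w. x \<in> vertices ls \<Longrightarrow> w \<in> carrier W \<Longrightarrow> ev' x (\<phi> w) = ev x w"
proof -
  interpret W: pullback_coords K V N r W ls H ev by fact
  interpret W': pullback_coords K V N r W' ls H ev' by fact
  have "\<exists>w' \<in> carrier W'. \<forall>x \<in> vertices ls. ev' x w' = ev x w" if "w \<in> carrier W" for w
    using that by (intro W'.EV_surj) (auto simp: W.EV_in W.EV_comp)
  then obtain \<phi> where "\<And>w. w \<in> carrier W \<Longrightarrow> \<phi> w \<in> carrier W' \<and> (\<forall>x \<in> vertices ls. ev' x (\<phi> w) = ev x w)" by metis
  then show ?thesis by (intro that[of "restrict \<phi> (carrier W)"]) auto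
qed

text \<open>Both functors have their coordinates in the same spaces of \<open>V\<close>, so matching coordinates gives a bijection. By
\<open>lift_hom\<close>, applied to the identity of \<open>V\<close>, it and its inverse are homomorphisms.\<close>

theorem coord_functors_isomorphic:
  fixes F :: "(('k, 'a) multimod, 'a \<Rightarrow> 'a, ('k, 'w) multimod, 'w \<Rightarrow> 'w) functor_data"
    and G :: "(('k, 'a) multimod, 'a \<Rightarrow> 'a, ('k, 'w) multimod, 'w \<Rightarrow> 'w) functor_data"
  assumes F: "coord_functor K N ls H F ev" and G: "coord_functor K N ls H G ev'"
  shows "naturally_isomorphic (mod_cat K [N]) (mod_cat K ls) F G"
  unfolding naturally_isomorphic_def
proof (intro conjI coord_functor_is_functor[OF F] coord_functor_is_functor[OF G])
  have "\<exists>\<phi>. \<phi> \<in> carrier (fobj F V) \<rightarrow>\<^sub>E carrier (fobj G V) \<and>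
      (\<forall>x \<in> vertices ls. \<forall>w \<in> carrier (fobj F V). ev' V x (\<phi> w) = ev V x w)" if V: "fd_module K [N] V" for V :: "('k, 'a) multimod"
    by (rule coords_transfer[OF coord_functorD(1)[OF F V] coord_functorD(1)[OF G V]]) blast
  then obtain \<eta> where \<eta>: "\<And>V. fd_module K [N] V \<Longrightarrow> \<eta> V \<in> carrier (fobj F V) \<rightarrow>\<^sub>E carrier (fobj G V)"
    "\<And>V x w. fd_module K [N] V \<Longrightarrow> x \<in> vertices ls \<Longrightarrow> w \<in> carrier (fobj F V) \<Longrightarrow> ev' V x (\<eta> V w) = ev V x w"
    by metis
  have lift: "\<phi> \<in> Hom (mod_cat K ls) W W'"
    if V: "fd_module K [N] V" and W: "pullback_coords K V N (ract V 0) W ls H e" and W': "pullback_coords K V N (ract V 0) W' ls H e'"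
      and "\<phi> \<in> carrier W \<rightarrow>\<^sub>E carrier W'" "\<And>x w. x \<in> vertices ls \<Longrightarrow> w \<in> carrier W \<Longrightarrow> e' x (\<phi> w) = e x w"
    for V :: "('k, 'a) multimod" and W :: "('k, 'w) multimod" and W' :: "('k, 'w) multimod" and e e' \<phi>
  proof -
    interpret W: pullback_coords K V N "ract V 0" W ls H e by fact
    show ?thesis using that(4,5) W.EV_in
      by (intro lift_hom[OF W W' Ident_in_Hom[OF V]]) (auto simp: Ident_mod_cat)
  qed
  show "\<exists>\<eta>. (\<forall>X\<in>Obj (mod_cat K [N]). is_iso (mod_cat K ls) (fobj F X) (fobj G X) (\<eta> X)) \<and>
        (\<forall>X\<in>Obj (mod_cat K [N]). \<forall>Y\<in>Obj (mod_cat K [N]). \<forall>f\<in>Hom (mod_cat K [N]) X Y.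
             Cmp (mod_cat K ls) (fobj F X) (fobj F Y) (fobj G Y) (\<eta> Y) (farr F X Y f) =
             Cmp (mod_cat K ls) (fobj F X) (fobj G X) (fobj G Y) (farr G X Y f) (\<eta> X))"
  proof (intro exI[of _ \<eta>] conjI ballI)
    fix X :: "('k, 'a) multimod" assume "X \<in> Obj (mod_cat K [N])" then have X: "fd_module K [N] X" by simp
    note cF = coord_functorD(1)[OF F X] and cG = coord_functorD(1)[OF G X]
    interpret F: pullback_coords K X N "ract X 0" "fobj F X" ls H "ev X" by (rule cF)
    interpret G: pullback_coords K X N "ract X 0" "fobj G X" ls H "ev' X" by (rule cG)
    obtain \<theta> where \<theta>: "\<theta> \<in> carrier (fobj G X) \<rightarrow>\<^sub>E carrier (fobj F X)"
      "\<And>x w. x \<in> vertices ls \<Longrightarrow> w \<in> carrier (fobj G X) \<Longrightarrow> ev X x (\<theta> w) = ev' X x w"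
      by (rule coords_transfer[OF cG cF]) blast
    have in_F: "\<theta> w \<in> carrier (fobj F X)" if "w \<in> carrier (fobj G X)" for w using \<theta>(1) that by auto
    have in_G: "\<eta> X w \<in> carrier (fobj G X)" if "w \<in> carrier (fobj F X)" for w using \<eta>(1)[OF X] that by auto
    have "\<theta> (\<eta> X w) = w" if w: "w \<in> carrier (fobj F X)" for w
      using w by (intro F.EV_inj) (auto simp: in_F in_G \<theta>(2) \<eta>(2)[OF X])
    moreover have "\<eta> X (\<theta> w) = w" if w: "w \<in> carrier (fobj G X)" for w
      using w by (intro G.EV_inj) (auto simp: in_F in_G \<theta>(2) \<eta>(2)[OF X])
    ultimately show "is_iso (mod_cat K ls) (fobj F X) (fobj G X) (\<eta> X)"
      unfolding is_iso_def Cmp_mod_cat Ident_mod_cat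
      by (intro conjI bexI[of _ \<theta>] lift[OF X cF cG] lift[OF X cG cF] \<eta>[OF X] \<theta>)
        (auto simp: compose_def restrict_def)
  next
    fix X Y :: "('k, 'a) multimod" and f assume "X \<in> Obj (mod_cat K [N])" "Y \<in> Obj (mod_cat K [N])" and f: "f \<in> Hom (mod_cat K [N]) X Y"
    then have X: "fd_module K [N] X" and Y: "fd_module K [N] Y" by auto
    interpret G: pullback_coords K Y N "ract Y 0" "fobj G Y" ls H "ev' Y" by (rule coord_functorD(1)[OF G Y])
    have "\<eta> Y (farr F X Y f w) = farr G X Y f (\<eta> X w)" if w: "w \<in> carrier (fobj F X)" for w
    proof (rule G.EV_inj)
      have 1: "farr F X Y f w \<in> carrier (fobj F Y)" and 2: "\<eta> X w \<in> carrier (fobj G X)"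
        using w coord_functorD(2)[OF F X Y f] \<eta>(1)[OF X] by auto
      show "\<eta> Y (farr F X Y f w) \<in> carrier (fobj G Y)" "farr G X Y f (\<eta> X w) \<in> carrier (fobj G Y)"
        using 1 2 coord_functorD(2)[OF G X Y f] \<eta>(1)[OF Y] by auto
      fix x assume x: "x \<in> vertices ls"
      show "ev' Y x (\<eta> Y (farr F X Y f w)) = ev' Y x (farr G X Y f (\<eta> X w))"
        using \<eta>(2)[OF Y x 1] \<eta>(2)[OF X x w] coord_functorD(3)[OF F X Y f x w] coord_functorD(3)[OF G X Y f x 2]
        by simp
    qed
    then show "Cmp (mod_cat K ls) (fobj F X) (fobj F Y) (fobj G Y) (\<eta> Y) (farr F X Y f) =
             Cmp (mod_cat K ls) (fobj F X) (fobj G X) (fobj G Y) (farr G X Y f) (\<eta> X)"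
      by (auto simp: Cmp_mod_cat compose_def)
  qed
qed

text \<open>The induction over composites of tensor functors starts from the identity, whose coordinates are the
components at the vertices.\<close>

definition id_functor :: "(('k, 'a) multimod, 'a \<Rightarrow> 'a, ('k, 'a) multimod, 'a \<Rightarrow> 'a) functor_data" where
  "id_functor = \<lparr>fobj = (\<lambda>V. V), farr = (\<lambda>V W f. f)\<rparr>"

lemma vertices_single: "x \<in> vertices [n] \<longleftrightarrow> (\<exists>d. x = [d] \<and> 1 \<le> d \<and> d \<le> n)"
  by (auto simp: vertices_def length_Suc_conv)

lemma id_coord_functor:
  fixes K :: "('k, 'r) ring_scheme"
  shows
  "coord_functor K N [N] (\<lambda>x. x ! 0) id_functor (\<lambda>(V :: ('k, 'a) multimod) x. path_rep.tr K (ract V 0) (x ! 0) (x ! 0))"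
  unfolding coord_functor_def
proof (intro conjI allI impI ballI)
  fix V :: "('k, 'a) multimod" assume V: "fd_module K [N] V"
  interpret path_rep K V N "ract V 0" using fd_module_path_rep[OF V, of 0] by simp
  show "pullback_coords K V N (ract V 0) (fobj id_functor V) [N] (\<lambda>x. x ! 0) (\<lambda>x. tr (x ! 0) (x ! 0))"
  \<comment> \<open>The numbered cases are the axioms of \<open>pullback_coords\<close>, in their order.\<close>
  proof (unfold_locales, unfold id_functor_def functor_data.simps, goal_cases)
    case (9 x w) then show ?case by (auto simp: vertices_single tr_tr)
  next
    case (10 x s w a)
    then obtain d where d: "x = [d]" "1 \<le> d" "d \<le> N" "s = 0" by (auto simp: vertices_single)
    have "(\<Oplus>\<^bsub>V\<^esub>c\<in>{1..d}. a (c, d) \<odot>\<^bsub>V\<^esub> tr c d w) = (\<Oplus>\<^bsub>V\<^esub>c\<in>{1..d}. a (c, d) \<odot>\<^bsub>V\<^esub> tr c d (tr c c w))"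
      using d 10 coeff_in[of a] by (intro finsum_cong') (auto simp: tr_tr tr_in)
    then show ?case using d 10 act_component[of w a d] by simp
  next
    case (11 w w')
    have "tr d d w = tr d d w'" if "d \<in> {1..N}" for d
      using 11(3)[of "[d]"] that by (simp add: vertices_single)
    then have "(\<Oplus>\<^bsub>V\<^esub>d\<in>{1..N}. tr d d w) = (\<Oplus>\<^bsub>V\<^esub>d\<in>{1..N}. tr d d w')"
      using 11 by (intro finsum_cong') (auto intro: tr_in)
    then show ?case using component_sum[OF 11(1)] component_sum[OF 11(2)] by simp
  next
    case (12 u)
    have u: "u [d] \<in> carrier V" "tr d d (u [d]) = u [d]" if "d \<in> {1..N}" for d
      using 12[of "[d]"] that by (auto simp: vertices_single)
    show ?case
    proof (intro bexI ballI)
      show "(\<Oplus>\<^bsub>V\<^esub>d\<in>{1..N}. u [d]) \<in> carrier V" using u by (intro finsum_closed) auto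
      fix x assume "x \<in> vertices [N]"
      then obtain d where d: "x = [d]" "d \<in> {1..N}" by (auto simp: vertices_single)
      have "tr d d (\<Oplus>\<^bsub>V\<^esub>d\<in>{1..N}. u [d]) = (\<Oplus>\<^bsub>V\<^esub>e\<in>{1..N}. tr d d (u [e]))"
        using d u by (intro module_hom_finsum[OF module_axioms module_axioms tr_hom]) auto
      also have "\<dots> = tr d d (u [d])"
      proof (rule finsum_single)
        fix e assume e: "e \<in> {1..N}" "e \<noteq> d"
        then show "tr d d (u [e]) = \<zero>\<^bsub>V\<^esub>"
          using tr_orth[of "u [e]" e e d d] u[of e] d by simp
      qed (use d u in \<open>auto simp: tr_in\<close>)
      finally show "tr (x ! 0) (x ! 0) (\<Oplus>\<^bsub>V\<^esub>d\<in>{1..N}. u [d]) = u x" using d u by simp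
    qed
  qed (auto simp: vertices_single act_in module_hom_zero[OF module_axioms module_axioms tr_hom] intro: tr_hom)
next
  fix V V' :: "('k, 'a) multimod" and f assume V: "fd_module K [N] V" and V': "fd_module K [N] V'" and f: "f \<in> Hom (mod_cat K [N]) V V'"
  show "farr id_functor V V' f \<in> carrier (fobj id_functor V) \<rightarrow>\<^sub>E carrier (fobj id_functor V')"
    using f by (simp add: id_functor_def Hom_mod_cat)
  fix x v assume "x \<in> vertices [N]" "v \<in> carrier (fobj id_functor V)"
  then show "path_rep.tr K (ract V' 0) (x ! 0) (x ! 0) (farr id_functor V V' f v) =
      f (path_rep.tr K (ract V 0) (x ! 0) (x ! 0) v)"
    using Hom_tr[OF f] fd_module_path_rep[OF V, of 0] fd_module_path_rep[OF V', of 0] by (auto simp: id_functor_def vertices_single)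
qed

section \<open>Free vector spaces\<close>

lemma finsum_pointwise:
  assumes M: "abelian_monoid M" and K: "abelian_monoid K"
    and add: "add M = (\<lambda>f g z. f z \<oplus>\<^bsub>K\<^esub> g z)" and zero: "zero M = (\<lambda>_. \<zero>\<^bsub>K\<^esub>)"
    and I: "finite I" "\<And>i. i \<in> I \<Longrightarrow> g i \<in> carrier M" and C: "\<And>f z. f \<in> carrier M \<Longrightarrow> f z \<in> carrier K"
  shows "(\<Oplus>\<^bsub>M\<^esub>i\<in>I. g i) z = (\<Oplus>\<^bsub>K\<^esub>i\<in>I. g i z)"
  using I
proof (induct I)
  case empty then show ?case
    by (simp add: abelian_monoid.finsum_empty[OF M] abelian_monoid.finsum_empty[OF K] zero)
next
  case (insert i I)
  then have "(\<Oplus>\<^bsub>M\<^esub>i\<in>insert i I. g i) = g i \<oplus>\<^bsub>M\<^esub> (\<Oplus>\<^bsub>M\<^esub>i\<in>I. g i)"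
    by (intro abelian_monoid.finsum_insert[OF M]) auto
  moreover have "(\<Oplus>\<^bsub>K\<^esub>i\<in>insert i I. g i z) = g i z \<oplus>\<^bsub>K\<^esub> (\<Oplus>\<^bsub>K\<^esub>i\<in>I. g i z)"
    using insert C by (intro abelian_monoid.finsum_insert[OF K]) auto
  ultimately show ?case using insert add by simp
qed

lemma module_hom_minus:
  assumes "module K M" "module K N" "f \<in> module_hom K M N" "v \<in> carrier M" "w \<in> carrier M"
  shows "f (v \<ominus>\<^bsub>M\<^esub> w) = f v \<ominus>\<^bsub>N\<^esub> f w"
  using assms mod_hom.f_minus[of K M N f v w] by (auto simp: mod_hom_def mod_hom_axioms_def)

context cring
begin

lemma free_space_simps:
  "carrier (free_space R B) = {f. (\<forall>x \<in> B. f x \<in> carrier R) \<and> (\<forall>x. x \<notin> B \<longrightarrow> f x = \<zero>) \<and> finite {x. f x \<noteq> \<zero>}}"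
  "add (free_space R B) = (\<lambda>f g x. f x \<oplus> g x)"
  "zero (free_space R B) = (\<lambda>_. \<zero>)"
  "smult (free_space R B) = (\<lambda>c f x. c \<otimes> f x)"
  by (simp_all add: free_space_def)

lemma free_space_val: "f \<in> carrier (free_space R B) \<Longrightarrow> f x \<in> carrier R"
  by (cases "x \<in> B") (auto simp: free_space_simps)

lemma module_free_space:
  fixes B :: "'i set"
  shows "module R (free_space R B)"
proof (rule module_criteria)
  have add: "finite {x. f x \<oplus> g x \<noteq> \<zero>}" if "finite {x. f x \<noteq> \<zero>}" "finite {x. g x \<noteq> \<zero>}" for f g :: "'i \<Rightarrow> 'a"
    by (rule finite_subset[OF _ finite_UnI[OF that]]) auto
  have smult: "finite {x. c \<otimes> f x \<noteq> \<zero>}" if "finite {x. f x \<noteq> \<zero>}" "c \<in> carrier R" for c and f :: "'i \<Rightarrow> 'a"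
    by (rule finite_subset[OF _ that(1)]) (use that in auto)
  show "\<forall>v w. v \<in> carrier (free_space R B) \<and> w \<in> carrier (free_space R B) \<longrightarrow>
      v \<oplus>\<^bsub>free_space R B\<^esub> w \<in> carrier (free_space R B)"
    using add by (simp add: free_space_simps)
  show "\<forall>c v. c \<in> carrier R \<and> v \<in> carrier (free_space R B) \<longrightarrow>
      c \<odot>\<^bsub>free_space R B\<^esub> v \<in> carrier (free_space R B)"
    using smult by (simp add: free_space_simps)
  show "\<forall>v\<in>carrier (free_space R B). \<exists>neg_v\<in>carrier (free_space R B). v \<oplus>\<^bsub>free_space R B\<^esub> neg_v = \<zero>\<^bsub>free_space R B\<^esub>"
  proof
    fix v assume v: "v \<in> carrier (free_space R B)"
    have "{x. \<ominus> v x \<noteq> \<zero>} \<subseteq> {x. v x \<noteq> \<zero>}" by auto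
    moreover have "finite {x. v x \<noteq> \<zero>}" using v by (simp add: free_space_simps)
    ultimately have "finite {x. \<ominus> v x \<noteq> \<zero>}" by (rule finite_subset)
    then have "(\<lambda>x. \<ominus> v x) \<in> carrier (free_space R B)" using v by (auto simp: free_space_simps)
    then show "\<exists>neg_v\<in>carrier (free_space R B). v \<oplus>\<^bsub>free_space R B\<^esub> neg_v = \<zero>\<^bsub>free_space R B\<^esub>"
      using free_space_val[OF v] by (intro bexI[of _ "\<lambda>x. \<ominus> v x"]) (simp_all add: free_space_simps(2,3) r_neg)
  qed
next
  show "\<zero>\<^bsub>free_space R B\<^esub> \<in> carrier (free_space R B)" by (simp add: free_space_simps)
qed (use free_space_val[where B = B] in \<open>simp_all add: free_space_simps(2-4) fun_eq_iff a_ac m_assoc l_distr r_distr is_cring\<close>)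

lemma free_gen_in: "x \<in> B \<Longrightarrow> free_gen R x \<in> carrier (free_space R B)"
  by (auto simp: free_space_simps free_gen_def)

lemma free_space_induct [consumes 1, case_names zero step]:
  assumes f: "f \<in> carrier (free_space R B)"
    and 0: "P \<zero>\<^bsub>free_space R B\<^esub>"
    and step: "\<And>f c x. f \<in> carrier (free_space R B) \<Longrightarrow> P f \<Longrightarrow> c \<in> carrier R \<Longrightarrow> x \<in> B \<Longrightarrow>
        P (c \<odot>\<^bsub>free_space R B\<^esub> free_gen R x \<oplus>\<^bsub>free_space R B\<^esub> f)"
  shows "P f"
proof -
  have "finite {x. f x \<noteq> \<zero>}" using f by (simp add: free_space_simps)
  then show ?thesis using f
  proof (induct "{x. f x \<noteq> \<zero>}" arbitrary: f rule: finite_induct)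
    case empty
    then have "f = \<zero>\<^bsub>free_space R B\<^esub>" by (auto simp: free_space_simps)
    then show ?case using 0 by simp
  next
    case (insert x S)
    let ?f = "f(x := \<zero>)"
    have S: "S = {z. ?f z \<noteq> \<zero>}" using insert(2,4) by auto
    have x: "x \<in> B" using insert(4,5) by (auto simp: free_space_simps)
    have f': "?f \<in> carrier (free_space R B)"
      using insert(1,5) S x by (auto simp: free_space_simps)
    have "f = f x \<odot>\<^bsub>free_space R B\<^esub> free_gen R x \<oplus>\<^bsub>free_space R B\<^esub> ?f"
      using free_space_val[OF insert(5)] by (auto simp: free_space_simps(2-4) free_gen_def)
    then show ?case using step[OF f' insert(3)[OF S f'] free_space_val[OF insert(5), of x] x] by simp
  qed
qed

lemma free_space_hom_eq:
  assumes "module R U" "\<phi> \<in> module_hom R (free_space R B) U" "\<psi> \<in> module_hom R (free_space R B) U"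
    and "\<And>x. x \<in> B \<Longrightarrow> \<phi> (free_gen R x) = \<psi> (free_gen R x)" "f \<in> carrier (free_space R B)"
  shows "\<phi> f = \<psi> f"
  using assms(5)
proof (induct rule: free_space_induct)
  case zero then show ?case
    using module_hom_zero[OF module_free_space assms(1)] assms(2,3) by metis
next
  case (step f c x)
  interpret F: module R "free_space R B" by (rule module_free_space)
  show ?case using step free_gen_in[OF step(4)] assms(4)[OF step(4)]
    by (simp add: module_hom_add[OF assms(2)] module_hom_add[OF assms(3)]
        module_hom_smult[OF assms(2)] module_hom_smult[OF assms(3)])
qed

definition free_ext :: "('a, 'u, 'z) module_scheme \<Rightarrow> ('i \<Rightarrow> 'u) \<Rightarrow> ('i \<Rightarrow> 'a) \<Rightarrow> 'u" where
  "free_ext U \<beta> f = (\<Oplus>\<^bsub>U\<^esub>z\<in>{z. f z \<noteq> \<zero>}. f z \<odot>\<^bsub>U\<^esub> \<beta> z)"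

lemma free_ext_eq:
  assumes "module R U" "\<And>z. z \<in> B \<Longrightarrow> \<beta> z \<in> carrier U" "f \<in> carrier (free_space R B)"
    "finite S" "{z. f z \<noteq> \<zero>} \<subseteq> S" "S \<subseteq> B"
  shows "free_ext U \<beta> f = (\<Oplus>\<^bsub>U\<^esub>z\<in>S. f z \<odot>\<^bsub>U\<^esub> \<beta> z)"
proof -
  interpret U: module R U by fact
  show ?thesis unfolding free_ext_def using assms free_space_val[OF assms(3)]
    by (intro U.finsum_sup) auto
qed

lemma free_ext_hom:
  assumes U: "module R U" and \<beta>: "\<And>z. z \<in> B \<Longrightarrow> \<beta> z \<in> carrier U"
  shows "free_ext U \<beta> \<in> module_hom R (free_space R B) U"
proof -
  interpret U: module R U by fact
  interpret F: module R "free_space R B" by (rule module_free_space)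
  have supp: "finite {z. f z \<noteq> \<zero>}" "{z. f z \<noteq> \<zero>} \<subseteq> B" if "f \<in> carrier (free_space R B)" for f
    using that by (auto simp: free_space_simps)
  show ?thesis
  proof (rule module_homI, goal_cases)
    case (1 f)
    then show ?case unfolding free_ext_def using \<beta> supp[OF 1] free_space_val[OF 1]
      by (intro U.finsum_closed) auto
  next
    case (2 f g)
    let ?S = "{z. f z \<noteq> \<zero>} \<union> {z. g z \<noteq> \<zero>}"
    have S: "finite ?S" "?S \<subseteq> B" using supp 2 by auto
    have "free_ext U \<beta> (f \<oplus>\<^bsub>free_space R B\<^esub> g) = (\<Oplus>\<^bsub>U\<^esub>z\<in>?S. (f z \<oplus> g z) \<odot>\<^bsub>U\<^esub> \<beta> z)"
    proof -
      have "{z. (f \<oplus>\<^bsub>free_space R B\<^esub> g) z \<noteq> \<zero>} \<subseteq> ?S" by (auto simp: free_space_simps(2))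
      from free_ext_eq[where \<beta> = \<beta>, OF U \<beta> F.a_closed[OF 2] S(1) this S(2)]
      show ?thesis by (simp add: free_space_simps(2))
    qed
    also have "\<dots> = (\<Oplus>\<^bsub>U\<^esub>z\<in>?S. f z \<odot>\<^bsub>U\<^esub> \<beta> z \<oplus>\<^bsub>U\<^esub> g z \<odot>\<^bsub>U\<^esub> \<beta> z)"
      using \<beta> S free_space_val[OF 2(1)] free_space_val[OF 2(2)]
      by (intro U.finsum_cong') (auto simp: U.smult_l_distr)
    also have "\<dots> = (\<Oplus>\<^bsub>U\<^esub>z\<in>?S. f z \<odot>\<^bsub>U\<^esub> \<beta> z) \<oplus>\<^bsub>U\<^esub> (\<Oplus>\<^bsub>U\<^esub>z\<in>?S. g z \<odot>\<^bsub>U\<^esub> \<beta> z)"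
      using \<beta> S free_space_val[OF 2(1)] free_space_val[OF 2(2)]
      by (intro U.finsum_addf) auto
    also have "\<dots> = free_ext U \<beta> f \<oplus>\<^bsub>U\<^esub> free_ext U \<beta> g"
      using free_ext_eq[where \<beta> = \<beta>, OF U \<beta> 2(1) S(1) _ S(2)] free_ext_eq[where \<beta> = \<beta>, OF U \<beta> 2(2) S(1) _ S(2)] by simp
    finally show ?case .
  next
    case (3 c f)
    note S = supp[OF 3(2)]
    have "free_ext U \<beta> (c \<odot>\<^bsub>free_space R B\<^esub> f) = (\<Oplus>\<^bsub>U\<^esub>z\<in>{z. f z \<noteq> \<zero>}. (c \<otimes> f z) \<odot>\<^bsub>U\<^esub> \<beta> z)"
    proof -
      have "{z. (c \<odot>\<^bsub>free_space R B\<^esub> f) z \<noteq> \<zero>} \<subseteq> {z. f z \<noteq> \<zero>}"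
        using 3(1) by (auto simp: free_space_simps(4))
      from free_ext_eq[where \<beta> = \<beta>, OF U \<beta> F.smult_closed[OF 3] S(1) this S(2)]
      show ?thesis by (simp add: free_space_simps(4))
    qed
    also have "\<dots> = (\<Oplus>\<^bsub>U\<^esub>z\<in>{z. f z \<noteq> \<zero>}. c \<odot>\<^bsub>U\<^esub> (f z \<odot>\<^bsub>U\<^esub> \<beta> z))"
      using \<beta> S free_space_val[OF 3(2)] 3(1)
      by (intro U.finsum_cong') (auto simp: U.smult_assoc1)
    also have "\<dots> = c \<odot>\<^bsub>U\<^esub> free_ext U \<beta> f"
      unfolding free_ext_def using \<beta> S free_space_val[OF 3(2)] 3(1)
      by (intro U.smult_finsum[symmetric]) auto
    finally show ?case .
  qed
qed

lemma free_ext_gen: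
  assumes U: "module R U" and \<beta>: "\<And>z. z \<in> B \<Longrightarrow> \<beta> z \<in> carrier U" and x: "x \<in> B"
  shows "free_ext U \<beta> (free_gen R x) = \<beta> x"
proof -
  interpret U: module R U by fact
  have "free_ext U \<beta> (free_gen R x) = (\<Oplus>\<^bsub>U\<^esub>z\<in>{x}. free_gen R x z \<odot>\<^bsub>U\<^esub> \<beta> z)"
    by (rule free_ext_eq[where \<beta> = \<beta>, OF U \<beta> free_gen_in[OF x]]) (use x in \<open>auto simp: free_gen_def\<close>)
  then show ?thesis using \<beta>[OF x] by (simp add: free_gen_def)
qed

lemma free_map_eq_ext:
  assumes g: "\<And>x. x \<in> B \<Longrightarrow> g x \<in> B'" and f: "f \<in> carrier (free_space R B)"
  shows "free_map R g f = free_ext (free_space R B') (\<lambda>x. free_gen R (g x)) f"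
proof
  fix z
  interpret F': module R "free_space R B'" by (rule module_free_space)
  have S: "finite {z. f z \<noteq> \<zero>}" "{z. f z \<noteq> \<zero>} \<subseteq> B" using f by (auto simp: free_space_simps)
  have "free_ext (free_space R B') (\<lambda>x. free_gen R (g x)) f z =
      (\<Oplus>y\<in>{y. f y \<noteq> \<zero>}. (f y \<odot>\<^bsub>free_space R B'\<^esub> free_gen R (g y)) z)"
    unfolding free_ext_def
  proof (rule finsum_pointwise)
    show "abelian_monoid R" "abelian_monoid (free_space R B')" by unfold_locales
    show "finite {y. f y \<noteq> \<zero>}" by (rule S)
    fix i assume "i \<in> {y. f y \<noteq> \<zero>}"
    then show "f i \<odot>\<^bsub>free_space R B'\<^esub> free_gen R (g i) \<in> carrier (free_space R B')"
      using S free_space_val[OF f, of i] free_gen_in[OF g, of i] by auto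
  qed (auto simp: free_space_simps(2-4) free_space_val)
  also have "\<dots> = (\<Oplus>y\<in>{y. f y \<noteq> \<zero>}. if g y = z then f y else \<zero>)"
    using free_space_val[OF f] by (intro finsum_cong') (auto simp: free_space_simps(4) free_gen_def)
  also have "\<dots> = (\<Oplus>y\<in>{y. f y \<noteq> \<zero> \<and> g y = z}. if g y = z then f y else \<zero>)"
    using S free_space_val[OF f] by (intro finsum_sup[symmetric]) auto
  also have "\<dots> = (\<Oplus>y\<in>{y. f y \<noteq> \<zero> \<and> g y = z}. f y)"
    using free_space_val[OF f] by (intro finsum_cong') auto
  finally show "free_map R g f z = free_ext (free_space R B') (\<lambda>x. free_gen R (g x)) f z"
    by (simp add: free_map_def)
qed

lemma free_map_hom:
  assumes g: "\<And>x. x \<in> B \<Longrightarrow> g x \<in> B'"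
  shows "free_map R g \<in> module_hom R (free_space R B) (free_space R B')"
proof -
  interpret F: module R "free_space R B" by (rule module_free_space)
  let ?E = "free_ext (free_space R B') (\<lambda>x. free_gen R (g x))"
  have E: "?E \<in> module_hom R (free_space R B) (free_space R B')"
    using g by (intro free_ext_hom module_free_space free_gen_in)
  have eq: "free_map R g f = ?E f" if "f \<in> carrier (free_space R B)" for f
    using free_map_eq_ext[OF g that] .
  show ?thesis
    by (rule module_homI)
      (simp_all add: eq module_hom_in[OF E] module_hom_add[OF E] module_hom_smult[OF E])
qed

lemma free_map_gen:
  assumes g: "\<And>x. x \<in> B \<Longrightarrow> g x \<in> B'" and x: "x \<in> B"
  shows "free_map R g (free_gen R x) = free_gen R (g x)"
  using free_ext_gen[where \<beta> = "\<lambda>x. free_gen R (g x)", OF module_free_space free_gen_in[OF g] x]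
  by (simp add: free_map_eq_ext[OF g free_gen_in[OF x]])

end

section \<open>Tensor products with the bimodule of a monotone map\<close>

text \<open>The region below the graph of \<open>h\<close>. The supports of the bimodules defining \<open>\<nabla>\<close> have this form, with \<open>h\<close> monotone.\<close>

definition subgraph :: "nat list \<Rightarrow> (nat list \<Rightarrow> nat) \<Rightarrow> (nat \<times> nat list) set" where
  "subgraph as h = {(\<gamma>, y). y \<in> vertices as \<and> 1 \<le> \<gamma> \<and> \<gamma> \<le> h y}"

definition pullback_bimod :: "('k, 'r) ring_scheme \<Rightarrow> nat list \<Rightarrow> (nat list \<Rightarrow> nat) \<Rightarrow> ('k, nat \<times> nat list \<Rightarrow> 'k) bimod" where
  "pullback_bimod K as h = standard_bimod K (subgraph as h)"

text \<open>The tensor product of a module \<open>W\<close>, with respect to its factor with index \<open>t\<close>, with the standard bimodule \<open>M\<close>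
below the graph of \<open>h\<close>. For a fixed vertex \<open>y\<close> the functions in \<open>M\<close> with second argument \<open>y\<close> form the left ideal
of the path algebra that is generated by the trivial path at \<open>h y\<close>; tensoring with it picks the space of \<open>W\<close> at
\<open>h y\<close>. The aim is to prove this for the concrete quotient of a free space, with explicit coordinates.\<close>

locale pullback_tensor = path_rep K W "ms ! t" "ract W t"
  for K :: "('k, 'r) ring_scheme" and W :: "('k, 'w) multimod" and ms :: "nat list" and t :: nat +
  fixes as :: "nat list" and h :: "nat list \<Rightarrow> nat"
  assumes fd: "fd_module K ms W" and t: "t < length ms" and len_as: "length as = 2"
    and h_range: "y \<in> vertices as \<Longrightarrow> 1 \<le> h y \<and> h y \<le> ms ! t"
    and h_mono: "y \<in> vertices as \<Longrightarrow> s < length as \<Longrightarrow> 1 \<le> c \<Longrightarrow> c \<le> y ! s \<Longrightarrow> h (y[s := c]) \<le> h y"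
begin

abbreviation "M \<equiv> pullback_bimod K as h"
abbreviation "B \<equiv> carrier W \<times> carrier M"
abbreviation "F \<equiv> free_space K B"
abbreviation "gen w x \<equiv> free_gen K (w, x)"

lemma M_simps:
  "carrier M = {f. (\<forall>z \<in> subgraph as h. f z \<in> carrier K) \<and> (\<forall>z. z \<notin> subgraph as h \<longrightarrow> f z = \<zero>\<^bsub>K\<^esub>)}"
  "add M = (\<lambda>f g z. f z \<oplus>\<^bsub>K\<^esub> g z)"
  "zero M = (\<lambda>_. \<zero>\<^bsub>K\<^esub>)"
  "smult M = (\<lambda>c f z. c \<otimes>\<^bsub>K\<^esub> f z)"
  by (simp_all add: pullback_bimod_def standard_bimod_def)

lemma M_val: "x \<in> carrier M \<Longrightarrow> x z \<in> carrier K"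
  by (cases z, cases "z \<in> subgraph as h") (auto simp: M_simps)

lemma module_M: "module K M"
proof (rule module_criteria)
  show "\<forall>v\<in>carrier M. \<exists>neg_v\<in>carrier M. v \<oplus>\<^bsub>M\<^esub> neg_v = \<zero>\<^bsub>M\<^esub>"
  proof
    fix v assume v: "v \<in> carrier M"
    then have "(\<lambda>z. \<ominus>\<^bsub>K\<^esub> v z) \<in> carrier M" by (simp add: M_simps)
    then show "\<exists>neg_v\<in>carrier M. v \<oplus>\<^bsub>M\<^esub> neg_v = \<zero>\<^bsub>M\<^esub>"
      using M_val[OF v] by (intro bexI[of _ "\<lambda>z. \<ominus>\<^bsub>K\<^esub> v z"]) (simp_all add: M_simps(2,3) R.r_neg)
  qed
  show "\<forall>v w. v \<in> carrier M \<and> w \<in> carrier M \<longrightarrow> v \<oplus>\<^bsub>M\<^esub> w \<in> carrier M"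
    "\<forall>c v. c \<in> carrier K \<and> v \<in> carrier M \<longrightarrow> c \<odot>\<^bsub>M\<^esub> v \<in> carrier M"
    "\<zero>\<^bsub>M\<^esub> \<in> carrier M"
    by (simp_all add: M_simps)
qed (use M_val in \<open>simp_all add: M_simps(2-4) fun_eq_iff R.a_ac R.m_assoc R.l_distr R.r_distr R.is_cring\<close>)

sublocale M: module K M by (rule module_M)
sublocale F: module K F by (rule R.module_free_space)

lemma gen_in: "w \<in> carrier W \<Longrightarrow> x \<in> carrier M \<Longrightarrow> gen w x \<in> carrier F"
  by (intro R.free_gen_in) auto

text \<open>The inclusion of the part of \<open>M\<close> at \<open>y\<close> into the path algebra as the left ideal spanned by the paths that end at \<open>h y\<close>.\<close>

definition coeffs :: "nat list \<Rightarrow> (nat \<times> nat list \<Rightarrow> 'k) \<Rightarrow> nat \<times> nat \<Rightarrow> 'k" where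
  "coeffs y x = (\<lambda>(\<gamma>, d). if d = h y \<and> 1 \<le> \<gamma> \<and> \<gamma> \<le> h y then x (\<gamma>, y) else \<zero>\<^bsub>K\<^esub>)"

text \<open>The coordinate at \<open>y\<close> of an element of the free space: it sends \<open>w \<otimes> x\<close> to \<open>w\<close> multiplied by the image
of \<open>x\<close> in the path algebra, which lies in the space of \<open>W\<close> at \<open>h y\<close>.\<close>

definition ev :: "nat list \<Rightarrow> ('w \<times> (nat \<times> nat list \<Rightarrow> 'k) \<Rightarrow> 'k) \<Rightarrow> 'w" where
  "ev y = R.free_ext W (\<lambda>(w, x). ract W t w (coeffs y x))"

text \<open>The element of \<open>M\<close> that corresponds to the trivial path at \<open>h y\<close>, hence a generator of the part of \<open>M\<close> at \<open>y\<close>.\<close>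

definition unit_at :: "nat list \<Rightarrow> nat \<times> nat list \<Rightarrow> 'k" where
  "unit_at y = free_gen K (h y, y)"

lemma coeffs_in: "y \<in> vertices as \<Longrightarrow> x \<in> carrier M \<Longrightarrow> coeffs y x \<in> A"
  using h_range[of y] M_val[of x] by (auto simp: in_path_algebra coeffs_def)

lemma coeffs_add: "coeffs y (x \<oplus>\<^bsub>M\<^esub> x') = (\<lambda>z. coeffs y x z \<oplus>\<^bsub>K\<^esub> coeffs y x' z)"
  by (auto simp: coeffs_def M_simps)

lemma coeffs_smult: "c \<in> carrier K \<Longrightarrow> coeffs y (c \<odot>\<^bsub>M\<^esub> x) = (\<lambda>z. c \<otimes>\<^bsub>K\<^esub> coeffs y x z)"
  by (auto simp: coeffs_def M_simps)

lemma lact_val: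
  assumes "a \<in> A" "x \<in> carrier M"
  shows "lact M a x (\<gamma>, y) =
    (if (\<gamma>, y) \<in> subgraph as h then \<Oplus>\<^bsub>K\<^esub>c\<in>{\<gamma>..h y}. a (\<gamma>, c) \<otimes>\<^bsub>K\<^esub> x (c, y) else \<zero>\<^bsub>K\<^esub>)"
proof -
  have "{c. \<gamma> \<le> c \<and> (\<forall>d \<in> {\<gamma>..c}. (d, y) \<in> subgraph as h)} =
     (if (\<gamma>, y) \<in> subgraph as h then {\<gamma>..h y} else {})"
    by (auto simp: subgraph_def)
  then show ?thesis by (simp add: pullback_bimod_def standard_bimod_def)
qed

lemma lact_in:
  assumes a: "a \<in> A" and x: "x \<in> carrier M"
  shows "lact M a x \<in> carrier M"
proof -
  have "lact M a x (\<gamma>, y) \<in> carrier K" for \<gamma> y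
    using coeff_in[OF a] M_val[OF x] by (simp add: lact_val[OF a x] R.finsum_closed)
  moreover have "lact M a x (\<gamma>, y) = \<zero>\<^bsub>K\<^esub>" if "(\<gamma>, y) \<notin> subgraph as h" for \<gamma> y
    using that by (simp add: lact_val[OF a x])
  ultimately show ?thesis unfolding M_simps(1) by auto
qed

text \<open>\<open>coeffs\<close> is left linear over the path algebra. This is what makes the coordinates compatible with the balancing
relations of the tensor product.\<close>

lemma coeffs_lact:
  assumes y: "y \<in> vertices as" and a: "a \<in> A" and x: "x \<in> carrier M"
  shows "coeffs y (lact M a x) = (\<lambda>(c, d). \<Oplus>\<^bsub>K\<^esub>e\<in>{c..d}. a (c, e) \<otimes>\<^bsub>K\<^esub> coeffs y x (e, d))"
proof (intro ext, clarify)
  fix c d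
  show "coeffs y (lact M a x) (c, d) = (\<Oplus>\<^bsub>K\<^esub>e\<in>{c..d}. a (c, e) \<otimes>\<^bsub>K\<^esub> coeffs y x (e, d))"
  proof (cases "d = h y \<and> 1 \<le> c \<and> c \<le> h y")
    case True
    then have "coeffs y (lact M a x) (c, d) = (\<Oplus>\<^bsub>K\<^esub>e\<in>{c..h y}. a (c, e) \<otimes>\<^bsub>K\<^esub> x (e, y))"
      using y by (simp add: coeffs_def lact_val[OF a x] subgraph_def)
    also have "\<dots> = (\<Oplus>\<^bsub>K\<^esub>e\<in>{c..d}. a (c, e) \<otimes>\<^bsub>K\<^esub> coeffs y x (e, d))"
      using True M_val[OF x] coeff_in[OF a] by (intro R.finsum_cong') (auto simp: coeffs_def)
    finally show ?thesis .
  next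
    case False
    have "(\<Oplus>\<^bsub>K\<^esub>e\<in>{c..d}. a (c, e) \<otimes>\<^bsub>K\<^esub> coeffs y x (e, d)) = \<zero>\<^bsub>K\<^esub>"
    proof (rule R.add.finprod_one_eqI)
      fix e assume e: "e \<in> {c..d}"
      have "a (c, e) = \<zero>\<^bsub>K\<^esub> \<or> coeffs y x (e, d) = \<zero>\<^bsub>K\<^esub>"
        using e False coeff_zero[OF a, of c e] by (auto simp: coeffs_def)
      then show "a (c, e) \<otimes>\<^bsub>K\<^esub> coeffs y x (e, d) = \<zero>\<^bsub>K\<^esub>"
        using coeff_in[OF a, of c e] coeffs_in[OF y x] coeff_in[OF coeffs_in[OF y x], of e d] by auto
    qed
    then show ?thesis using False by (auto simp: coeffs_def)
  qed
qed

lemma beta_in: "y \<in> vertices as \<Longrightarrow> z \<in> B \<Longrightarrow> (case z of (w, x) \<Rightarrow> ract W t w (coeffs y x)) \<in> carrier W"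
  by (auto intro: act_in coeffs_in)

lemma ev_hom: "y \<in> vertices as \<Longrightarrow> ev y \<in> module_hom K F W"
  unfolding ev_def by (intro R.free_ext_hom module_axioms beta_in)

lemma ev_gen: "y \<in> vertices as \<Longrightarrow> w \<in> carrier W \<Longrightarrow> x \<in> carrier M \<Longrightarrow> ev y (gen w x) = ract W t w (coeffs y x)"
  unfolding ev_def by (subst R.free_ext_gen[OF module_axioms beta_in]) auto

lemma ev_in: "y \<in> vertices as \<Longrightarrow> f \<in> carrier F \<Longrightarrow> ev y f \<in> carrier W"
  using ev_hom by (rule module_hom_in)

lemma ev_zero: "y \<in> vertices as \<Longrightarrow> ev y \<zero>\<^bsub>F\<^esub> = \<zero>\<^bsub>W\<^esub>"
  by (rule module_hom_zero[OF F.module_axioms module_axioms ev_hom])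

lemma ev_minus: "y \<in> vertices as \<Longrightarrow> f \<in> carrier F \<Longrightarrow> g \<in> carrier F \<Longrightarrow> ev y (f \<ominus>\<^bsub>F\<^esub> g) = ev y f \<ominus>\<^bsub>W\<^esub> ev y g"
  by (rule module_hom_minus[OF F.module_axioms module_axioms ev_hom])

lemma act_coeffs_lact:
  "y \<in> vertices as \<Longrightarrow> a \<in> A \<Longrightarrow> x \<in> carrier M \<Longrightarrow> w \<in> carrier W \<Longrightarrow>
     ract W t w (coeffs y (lact M a x)) = ract W t (ract W t w a) (coeffs y x)"
  by (subst act_mult) (simp_all add: coeffs_lact coeffs_in)

abbreviation "Rels \<equiv> tensor_rels K (path_algebra K (ms ! t)) W (ract W t) M (lact M)"
abbreviation "Nker \<equiv> tensor_factor_ker K (ms ! t) t W M"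

lemma tensor_rels_cases:
  assumes "f \<in> Rels"
  obtains
    v w x where "v \<in> carrier W" "w \<in> carrier W" "x \<in> carrier M" "f = gen (v \<oplus>\<^bsub>W\<^esub> w) x \<ominus>\<^bsub>F\<^esub> (gen v x \<oplus>\<^bsub>F\<^esub> gen w x)"
  | v x y where "v \<in> carrier W" "x \<in> carrier M" "y \<in> carrier M" "f = gen v (x \<oplus>\<^bsub>M\<^esub> y) \<ominus>\<^bsub>F\<^esub> (gen v x \<oplus>\<^bsub>F\<^esub> gen v y)"
  | c v x where "c \<in> carrier K" "v \<in> carrier W" "x \<in> carrier M" "f = gen (c \<odot>\<^bsub>W\<^esub> v) x \<ominus>\<^bsub>F\<^esub> (c \<odot>\<^bsub>F\<^esub> gen v x)"
  | c v x where "c \<in> carrier K" "v \<in> carrier W" "x \<in> carrier M" "f = gen v (c \<odot>\<^bsub>M\<^esub> x) \<ominus>\<^bsub>F\<^esub> (c \<odot>\<^bsub>F\<^esub> gen v x)"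
  | v a x where "v \<in> carrier W" "a \<in> A" "x \<in> carrier M" "f = gen (ract W t v a) x \<ominus>\<^bsub>F\<^esub> gen v (lact M a x)"
  using assms unfolding tensor_rels_def Let_def Un_iff mem_Collect_eq by (elim disjE exE conjE) 

lemma tensor_relsI:
  "v \<in> carrier W \<Longrightarrow> w \<in> carrier W \<Longrightarrow> x \<in> carrier M \<Longrightarrow> gen (v \<oplus>\<^bsub>W\<^esub> w) x \<ominus>\<^bsub>F\<^esub> (gen v x \<oplus>\<^bsub>F\<^esub> gen w x) \<in> Rels"
  "v \<in> carrier W \<Longrightarrow> x \<in> carrier M \<Longrightarrow> y \<in> carrier M \<Longrightarrow> gen v (x \<oplus>\<^bsub>M\<^esub> y) \<ominus>\<^bsub>F\<^esub> (gen v x \<oplus>\<^bsub>F\<^esub> gen v y) \<in> Rels"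
  "c \<in> carrier K \<Longrightarrow> v \<in> carrier W \<Longrightarrow> x \<in> carrier M \<Longrightarrow> gen (c \<odot>\<^bsub>W\<^esub> v) x \<ominus>\<^bsub>F\<^esub> (c \<odot>\<^bsub>F\<^esub> gen v x) \<in> Rels"
  "c \<in> carrier K \<Longrightarrow> v \<in> carrier W \<Longrightarrow> x \<in> carrier M \<Longrightarrow> gen v (c \<odot>\<^bsub>M\<^esub> x) \<ominus>\<^bsub>F\<^esub> (c \<odot>\<^bsub>F\<^esub> gen v x) \<in> Rels"
  "v \<in> carrier W \<Longrightarrow> a \<in> A \<Longrightarrow> x \<in> carrier M \<Longrightarrow> gen (ract W t v a) x \<ominus>\<^bsub>F\<^esub> gen v (lact M a x) \<in> Rels"
  unfolding tensor_rels_def Let_def by blast+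

lemma Rels_in: "Rels \<subseteq> carrier F"
proof
  fix f assume "f \<in> Rels"
  then show "f \<in> carrier F"
    by (cases rule: tensor_rels_cases) (auto intro!: F.minus_closed F.a_closed F.smult_closed gen_in act_in lact_in)
qed

lemma Nker_span: "Nker = F.span Rels"
  by (simp add: tensor_factor_ker_def tensor_ker_def)

lemma submodule_Nker: "submodule K Nker F"
  unfolding Nker_span by (rule F.span_is_submodule[OF Rels_in])

lemma Rels_Nker: "f \<in> Rels \<Longrightarrow> f \<in> Nker"
  unfolding Nker_span using F.in_own_span[OF Rels_in] by blast

lemma ev_Rels:
  assumes y: "y \<in> vertices as" and f: "f \<in> Rels"
  shows "ev y f = \<zero>\<^bsub>W\<^esub>"
  using f
proof (cases rule: tensor_rels_cases)
  case (1 v w x)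
  then show ?thesis using y
    by (simp add: ev_minus gen_in module_hom_add[OF ev_hom] ev_gen module_hom_add[OF act_hom] coeffs_in
        act_in minus_eq r_neg)
next
  case (2 v x x')
  then show ?thesis using y
    by (simp add: ev_minus gen_in module_hom_add[OF ev_hom] ev_gen coeffs_add act_add coeffs_in
        act_in minus_eq r_neg)
next
  case (3 c v x)
  then show ?thesis using y
    by (simp add: ev_minus gen_in module_hom_smult[OF ev_hom] ev_gen module_hom_smult[OF act_hom] coeffs_in
        act_in minus_eq r_neg)
next
  case (4 c v x)
  then show ?thesis using y
    by (simp add: ev_minus gen_in module_hom_smult[OF ev_hom] ev_gen coeffs_smult act_smult coeffs_in
        act_in minus_eq r_neg)
next
  case (5 v a x)
  then show ?thesis using y
    by (simp add: ev_minus gen_in ev_gen coeffs_in act_in lact_in act_coeffs_lact minus_eq r_neg)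
qed

lemma ev_Nker:
  assumes "f \<in> Nker" "y \<in> vertices as"
  shows "f \<in> carrier F \<and> ev y f = \<zero>\<^bsub>W\<^esub>"
proof -
  have "submodule K {f \<in> carrier F. ev y f = \<zero>\<^bsub>W\<^esub>} F"
    by (rule submodule.intro)
      (use assms(2) in \<open>auto simp: F.module_axioms module_hom_add[OF ev_hom] module_hom_smult[OF ev_hom] ev_zero\<close>)
  moreover have "Rels \<subseteq> {f \<in> carrier F. ev y f = \<zero>\<^bsub>W\<^esub>}"
    using Rels_in ev_Rels[OF assms(2)] by auto
  ultimately show ?thesis using F.span_is_subset assms(1) unfolding Nker_span by blast
qed

text \<open>Congruence modulo the relations of the tensor product. Writing it with a summand from the submodule instead
of a difference keeps the calculations free of additive inverses.\<close>

definition eqv (infix \<open>\<approx>\<close> 50) where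
  "f \<approx> g \<longleftrightarrow> f \<in> carrier F \<and> g \<in> carrier F \<and> (\<exists>n \<in> Nker. f = n \<oplus>\<^bsub>F\<^esub> g)"

lemma Nker_in: "n \<in> Nker \<Longrightarrow> n \<in> carrier F"
  using submodule.subset[OF submodule_Nker] by blast

lemma eqv_refl: "f \<in> carrier F \<Longrightarrow> f \<approx> f"
  unfolding eqv_def using submodule.zero_closed[OF submodule_Nker] by (auto intro!: bexI[of _ "\<zero>\<^bsub>F\<^esub>"])

lemma eqv_trans [trans]: "f \<approx> g \<Longrightarrow> g \<approx> k \<Longrightarrow> f \<approx> k"
  unfolding eqv_def using submodule.m_closed[OF submodule_Nker] Nker_in
  by (metis F.add.m_assoc)

lemma eqv_sym: "f \<approx> g \<Longrightarrow> g \<approx> f"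
proof -
  assume "f \<approx> g"
  then obtain n where n: "n \<in> Nker" "f = n \<oplus>\<^bsub>F\<^esub> g" "f \<in> carrier F" "g \<in> carrier F" by (auto simp: eqv_def)
  have "\<ominus>\<^bsub>F\<^esub> n \<in> Nker"
    using submodule.smult_closed[OF submodule_Nker, of "\<ominus>\<^bsub>K\<^esub> \<one>\<^bsub>K\<^esub>" n] n(1) Nker_in[OF n(1)]
    by (simp add: F.smult_minus_1)
  moreover have "g = \<ominus>\<^bsub>F\<^esub> n \<oplus>\<^bsub>F\<^esub> f"
    using n Nker_in[OF n(1)] by (simp add: F.r_neg1)
  ultimately show ?thesis using n by (auto simp: eqv_def)
qed

lemma eqv_add: "f \<approx> g \<Longrightarrow> f' \<approx> g' \<Longrightarrow> f \<oplus>\<^bsub>F\<^esub> f' \<approx> g \<oplus>\<^bsub>F\<^esub> g'"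
proof -
  assume "f \<approx> g" "f' \<approx> g'"
  then obtain n n' where n: "n \<in> Nker" "f = n \<oplus>\<^bsub>F\<^esub> g" "f \<in> carrier F" "g \<in> carrier F"
    "n' \<in> Nker" "f' = n' \<oplus>\<^bsub>F\<^esub> g'" "f' \<in> carrier F" "g' \<in> carrier F" by (auto simp: eqv_def)
  then have "f \<oplus>\<^bsub>F\<^esub> f' = (n \<oplus>\<^bsub>F\<^esub> n') \<oplus>\<^bsub>F\<^esub> (g \<oplus>\<^bsub>F\<^esub> g')"
    using Nker_in[OF n(1)] Nker_in[OF n(5)] by (simp add: F.a_ac)
  moreover have "f \<oplus>\<^bsub>F\<^esub> f' \<in> carrier F" "g \<oplus>\<^bsub>F\<^esub> g' \<in> carrier F"
    using n(3,4,7,8) by (simp_all only: F.a_closed)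
  ultimately show ?thesis
    using submodule.m_closed[OF submodule_Nker n(1,5)] unfolding eqv_def by blast
qed

lemma eqv_smult: "f \<approx> g \<Longrightarrow> c \<in> carrier K \<Longrightarrow> c \<odot>\<^bsub>F\<^esub> f \<approx> c \<odot>\<^bsub>F\<^esub> g"
proof -
  assume "f \<approx> g" and c: "c \<in> carrier K"
  then obtain n where n: "n \<in> Nker" "f = n \<oplus>\<^bsub>F\<^esub> g" "f \<in> carrier F" "g \<in> carrier F" by (auto simp: eqv_def)
  then have "c \<odot>\<^bsub>F\<^esub> f = c \<odot>\<^bsub>F\<^esub> n \<oplus>\<^bsub>F\<^esub> c \<odot>\<^bsub>F\<^esub> g"
    using c Nker_in[OF n(1)] by (simp add: F.smult_r_distr)
  moreover have "c \<odot>\<^bsub>F\<^esub> f \<in> carrier F" "c \<odot>\<^bsub>F\<^esub> g \<in> carrier F"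
    using n(3,4) c by (simp_all only: F.smult_closed)
  ultimately show ?thesis
    using submodule.smult_closed[OF submodule_Nker c n(1)] unfolding eqv_def by blast
qed

lemma eqv_sum:
  assumes "finite I" "\<And>i. i \<in> I \<Longrightarrow> f i \<approx> g i"
  shows "(\<Oplus>\<^bsub>F\<^esub>i\<in>I. f i) \<approx> (\<Oplus>\<^bsub>F\<^esub>i\<in>I. g i)"
  using assms
proof (induct I)
  case (insert i I)
  then have "f j \<in> carrier F" "g j \<in> carrier F" if "j \<in> insert i I" for j
    using that insert(4) by (auto simp: eqv_def)
  then have "(\<Oplus>\<^bsub>F\<^esub>i\<in>insert i I. f i) = f i \<oplus>\<^bsub>F\<^esub> (\<Oplus>\<^bsub>F\<^esub>i\<in>I. f i)"
    "(\<Oplus>\<^bsub>F\<^esub>i\<in>insert i I. g i) = g i \<oplus>\<^bsub>F\<^esub> (\<Oplus>\<^bsub>F\<^esub>i\<in>I. g i)"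
    using insert(1,2) by (auto intro!: F.finsum_insert)
  then show ?case using insert by (simp add: eqv_add)
qed (simp add: eqv_refl)

lemma eqv_Rel:
  assumes "f \<ominus>\<^bsub>F\<^esub> g \<in> Rels" "f \<in> carrier F" "g \<in> carrier F"
  shows "f \<approx> g"
proof -
  have "f = (f \<ominus>\<^bsub>F\<^esub> g) \<oplus>\<^bsub>F\<^esub> g" using assms by (simp add: F.minus_eq F.a_assoc F.l_neg)
  then show ?thesis using assms Rels_Nker unfolding eqv_def by blast
qed

lemma eqv_add_left:
  "v \<in> carrier W \<Longrightarrow> w \<in> carrier W \<Longrightarrow> x \<in> carrier M \<Longrightarrow> gen (v \<oplus>\<^bsub>W\<^esub> w) x \<approx> gen v x \<oplus>\<^bsub>F\<^esub> gen w x"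
  by (intro eqv_Rel tensor_relsI gen_in F.a_closed a_closed)

lemma eqv_add_right:
  "v \<in> carrier W \<Longrightarrow> x \<in> carrier M \<Longrightarrow> y \<in> carrier M \<Longrightarrow> gen v (x \<oplus>\<^bsub>M\<^esub> y) \<approx> gen v x \<oplus>\<^bsub>F\<^esub> gen v y"
  by (intro eqv_Rel tensor_relsI gen_in F.a_closed M.a_closed)

lemma eqv_smult_left:
  "c \<in> carrier K \<Longrightarrow> v \<in> carrier W \<Longrightarrow> x \<in> carrier M \<Longrightarrow> gen (c \<odot>\<^bsub>W\<^esub> v) x \<approx> c \<odot>\<^bsub>F\<^esub> gen v x"
  by (intro eqv_Rel tensor_relsI gen_in F.smult_closed smult_closed)

lemma eqv_smult_right:
  "c \<in> carrier K \<Longrightarrow> v \<in> carrier W \<Longrightarrow> x \<in> carrier M \<Longrightarrow> gen v (c \<odot>\<^bsub>M\<^esub> x) \<approx> c \<odot>\<^bsub>F\<^esub> gen v x"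
  by (intro eqv_Rel tensor_relsI gen_in F.smult_closed M.smult_closed)

lemma eqv_balanced:
  "v \<in> carrier W \<Longrightarrow> a \<in> A \<Longrightarrow> x \<in> carrier M \<Longrightarrow> gen (ract W t v a) x \<approx> gen v (lact M a x)"
  by (intro eqv_Rel tensor_relsI gen_in act_in lact_in)

lemma eqv_zero_left: "x \<in> carrier M \<Longrightarrow> gen \<zero>\<^bsub>W\<^esub> x \<approx> \<zero>\<^bsub>F\<^esub>"
  using eqv_smult_left[of "\<zero>\<^bsub>K\<^esub>" "\<zero>\<^bsub>W\<^esub>" x] gen_in[of "\<zero>\<^bsub>W\<^esub>" x] by simp

lemma eqv_zero_right: "v \<in> carrier W \<Longrightarrow> gen v \<zero>\<^bsub>M\<^esub> \<approx> \<zero>\<^bsub>F\<^esub>"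
  using eqv_smult_right[of "\<zero>\<^bsub>K\<^esub>" v "\<zero>\<^bsub>M\<^esub>"] gen_in[of v "\<zero>\<^bsub>M\<^esub>"] by simp

lemma eqv_sum_right:
  assumes "finite I" "v \<in> carrier W" "\<And>i. i \<in> I \<Longrightarrow> x i \<in> carrier M"
  shows "gen v (\<Oplus>\<^bsub>M\<^esub>i\<in>I. x i) \<approx> (\<Oplus>\<^bsub>F\<^esub>i\<in>I. gen v (x i))"
  using assms(1,3)
proof (induct I)
  case empty then show ?case using eqv_zero_right[OF assms(2)] by simp
next
  case (insert i I)
  have xs: "(\<Oplus>\<^bsub>M\<^esub>i\<in>I. x i) \<in> carrier M" using insert by (intro M.finsum_closed) auto
  have eq: "(\<Oplus>\<^bsub>M\<^esub>i\<in>insert i I. x i) = x i \<oplus>\<^bsub>M\<^esub> (\<Oplus>\<^bsub>M\<^esub>i\<in>I. x i)"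
    "(\<Oplus>\<^bsub>F\<^esub>i\<in>insert i I. gen v (x i)) = gen v (x i) \<oplus>\<^bsub>F\<^esub> (\<Oplus>\<^bsub>F\<^esub>i\<in>I. gen v (x i))"
    using insert assms(2) by (auto intro!: M.finsum_insert F.finsum_insert gen_in)
  have "gen v (x i \<oplus>\<^bsub>M\<^esub> (\<Oplus>\<^bsub>M\<^esub>i\<in>I. x i)) \<approx> gen v (x i) \<oplus>\<^bsub>F\<^esub> gen v (\<Oplus>\<^bsub>M\<^esub>i\<in>I. x i)"
    using insert assms(2) xs by (intro eqv_add_right) auto
  also have "\<dots> \<approx> gen v (x i) \<oplus>\<^bsub>F\<^esub> (\<Oplus>\<^bsub>F\<^esub>i\<in>I. gen v (x i))"
    using insert assms(2) by (intro eqv_add eqv_refl gen_in) auto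
  finally show ?case unfolding eq .
qed

lemma unit_in: "y \<in> vertices as \<Longrightarrow> unit_at y \<in> carrier M"
  using h_range[of y] by (auto simp: M_simps unit_at_def free_gen_def subgraph_def)

lemma coeffs_unit: "y \<in> vertices as \<Longrightarrow> coeffs y (unit_at y) = path K (h y) (h y)"
  using h_range[of y] by (auto simp: fun_eq_iff coeffs_def unit_at_def path_def free_gen_def)

lemma coeffs_unit_other: "y \<noteq> y' \<Longrightarrow> coeffs y (unit_at y') = (\<lambda>_. \<zero>\<^bsub>K\<^esub>)"
  by (auto simp: fun_eq_iff coeffs_def unit_at_def path_def free_gen_def)

lemma lact_unit:
  assumes y: "y \<in> vertices as" and x: "x \<in> carrier M"
  shows "lact M (coeffs y x) (unit_at y) (\<gamma>, y') = (if y' = y then x (\<gamma>, y) else \<zero>\<^bsub>K\<^esub>)"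
proof -
  note q = coeffs_in[OF y x] and u = unit_in[OF y]
  show ?thesis
  proof (cases "y' = y \<and> 1 \<le> \<gamma> \<and> \<gamma> \<le> h y")
    case True
    then have "lact M (coeffs y x) (unit_at y) (\<gamma>, y') = (\<Oplus>\<^bsub>K\<^esub>c\<in>{\<gamma>..h y}. coeffs y x (\<gamma>, c) \<otimes>\<^bsub>K\<^esub> unit_at y (c, y))"
      using y by (simp add: lact_val[OF q u] subgraph_def)
    also have "\<dots> = coeffs y x (\<gamma>, h y) \<otimes>\<^bsub>K\<^esub> unit_at y (h y, y)"
      using True coeff_in[OF q] by (intro R.finsum_single) (auto simp: unit_at_def free_gen_def)
    finally show ?thesis using True M_val[OF x] by (simp add: unit_at_def free_gen_def coeffs_def)
  next
    case False
    have "lact M (coeffs y x) (unit_at y) (\<gamma>, y') = \<zero>\<^bsub>K\<^esub>"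
    proof (cases "(\<gamma>, y') \<in> subgraph as h")
      case True
      then have "y' \<noteq> y" using False by (auto simp: subgraph_def)
      have "(\<Oplus>\<^bsub>K\<^esub>c\<in>{\<gamma>..h y'}. coeffs y x (\<gamma>, c) \<otimes>\<^bsub>K\<^esub> unit_at y (c, y')) = \<zero>\<^bsub>K\<^esub>"
        using \<open>y' \<noteq> y\<close> coeff_in[OF q] by (intro R.add.finprod_one_eqI) (auto simp: unit_at_def free_gen_def)
      then show ?thesis by (simp add: lact_val[OF q u])
    qed (simp add: lact_val[OF q u])
    moreover have "(if y' = y then x (\<gamma>, y) else \<zero>\<^bsub>K\<^esub>) = \<zero>\<^bsub>K\<^esub>"
      using False x by (auto simp: M_simps subgraph_def)
    ultimately show ?thesis by simp
  qed
qed

text \<open>\<open>M\<close> is the direct sum of its parts at the vertices \<open>y\<close>, each generated by the element \<open>unit_at y\<close>.\<close>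

lemma unit_decomposition:
  assumes x: "x \<in> carrier M"
  shows "(\<Oplus>\<^bsub>M\<^esub>y\<in>vertices as. lact M (coeffs y x) (unit_at y)) = x"
proof (intro ext, clarify)
  fix \<gamma> y'
  have "(\<Oplus>\<^bsub>M\<^esub>y\<in>vertices as. lact M (coeffs y x) (unit_at y)) (\<gamma>, y') =
      (\<Oplus>\<^bsub>K\<^esub>y\<in>vertices as. lact M (coeffs y x) (unit_at y) (\<gamma>, y'))"
    by (rule finsum_pointwise)
      (auto simp: M_simps(2,3) finite_vertices M_val lact_in coeffs_in unit_in x M.abelian_monoid_axioms R.abelian_monoid_axioms)
  also have "\<dots> = (\<Oplus>\<^bsub>K\<^esub>y\<in>vertices as. if y' = y then x (\<gamma>, y) else \<zero>\<^bsub>K\<^esub>)"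
    using M_val[OF x] by (intro R.finsum_cong') (auto simp: lact_unit x)
  also have "\<dots> = x (\<gamma>, y')"
  proof (cases "y' \<in> vertices as")
    case True
    then show ?thesis using M_val[OF x] finite_vertices
      by (subst R.finsum_single[where k = y']) auto
  next
    case False
    then have "(\<Oplus>\<^bsub>K\<^esub>y\<in>vertices as. if y' = y then x (\<gamma>, y) else \<zero>\<^bsub>K\<^esub>) = \<zero>\<^bsub>K\<^esub>"
      by (intro R.add.finprod_one_eqI) auto
    then show ?thesis using False x by (auto simp: M_simps subgraph_def)
  qed
  finally show "(\<Oplus>\<^bsub>M\<^esub>y\<in>vertices as. lact M (coeffs y x) (unit_at y)) (\<gamma>, y') = x (\<gamma>, y')" .
qed

text \<open>The coefficients on the generators of \<open>M\<close> can be moved across the tensor sign. Hence the coordinates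
determine an element of the tensor product.\<close>

lemma gen_normal_form:
  assumes w: "w \<in> carrier W" and x: "x \<in> carrier M"
  shows "(\<Oplus>\<^bsub>F\<^esub>y\<in>vertices as. gen (ev y (gen w x)) (unit_at y)) \<approx> gen w x"
proof -
  have "(\<Oplus>\<^bsub>F\<^esub>y\<in>vertices as. gen (ev y (gen w x)) (unit_at y)) \<approx> (\<Oplus>\<^bsub>F\<^esub>y\<in>vertices as. gen w (lact M (coeffs y x) (unit_at y)))"
    using w x by (intro eqv_sum finite_vertices) (simp add: ev_gen eqv_balanced coeffs_in unit_in)
  also have "\<dots> \<approx> gen w (\<Oplus>\<^bsub>M\<^esub>y\<in>vertices as. lact M (coeffs y x) (unit_at y))"
    using w x by (intro eqv_sym[OF eqv_sum_right] finite_vertices lact_in coeffs_in unit_in)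
  finally show ?thesis by (simp add: unit_decomposition[OF x])
qed

lemma normal_form:
  assumes "f \<in> carrier F"
  shows "(\<Oplus>\<^bsub>F\<^esub>y\<in>vertices as. gen (ev y f) (unit_at y)) \<approx> f"
  using assms
proof (induct rule: R.free_space_induct)
  case zero
  have "(\<Oplus>\<^bsub>F\<^esub>y\<in>vertices as. gen (ev y \<zero>\<^bsub>F\<^esub>) (unit_at y)) \<approx> (\<Oplus>\<^bsub>F\<^esub>y\<in>vertices as. \<zero>\<^bsub>F\<^esub>)"
    by (intro eqv_sum finite_vertices) (simp add: ev_zero eqv_zero_left unit_in)
  then show ?case by simp
next
  case (step f c z)
  obtain w x where z: "z = (w, x)" "w \<in> carrier W" "x \<in> carrier M" using step(4) by auto
  let ?g = "gen w x"
  note g = gen_in[OF z(2,3)]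
  have "(\<Oplus>\<^bsub>F\<^esub>y\<in>vertices as. gen (ev y (c \<odot>\<^bsub>F\<^esub> ?g \<oplus>\<^bsub>F\<^esub> f)) (unit_at y)) \<approx>
     (\<Oplus>\<^bsub>F\<^esub>y\<in>vertices as. c \<odot>\<^bsub>F\<^esub> gen (ev y ?g) (unit_at y) \<oplus>\<^bsub>F\<^esub> gen (ev y f) (unit_at y))"
  proof (intro eqv_sum finite_vertices)
    fix y assume y: "y \<in> vertices as"
    have eq: "ev y (c \<odot>\<^bsub>F\<^esub> ?g \<oplus>\<^bsub>F\<^esub> f) = c \<odot>\<^bsub>W\<^esub> ev y ?g \<oplus>\<^bsub>W\<^esub> ev y f"
      using y step(1,3) g by (simp add: module_hom_add[OF ev_hom] module_hom_smult[OF ev_hom])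
    have "gen (c \<odot>\<^bsub>W\<^esub> ev y ?g \<oplus>\<^bsub>W\<^esub> ev y f) (unit_at y) \<approx>
        gen (c \<odot>\<^bsub>W\<^esub> ev y ?g) (unit_at y) \<oplus>\<^bsub>F\<^esub> gen (ev y f) (unit_at y)"
      using y step(1,3) g by (intro eqv_add_left smult_closed ev_in unit_in)
    also have "\<dots> \<approx> c \<odot>\<^bsub>F\<^esub> gen (ev y ?g) (unit_at y) \<oplus>\<^bsub>F\<^esub> gen (ev y f) (unit_at y)"
      using y step(1,3) g z(2,3) by (intro eqv_add eqv_smult_left eqv_refl gen_in ev_in unit_in)
    finally show "gen (ev y (c \<odot>\<^bsub>F\<^esub> ?g \<oplus>\<^bsub>F\<^esub> f)) (unit_at y) \<approx>
        c \<odot>\<^bsub>F\<^esub> gen (ev y ?g) (unit_at y) \<oplus>\<^bsub>F\<^esub> gen (ev y f) (unit_at y)"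
      unfolding eq .
  qed
  also have "(\<Oplus>\<^bsub>F\<^esub>y\<in>vertices as. c \<odot>\<^bsub>F\<^esub> gen (ev y ?g) (unit_at y) \<oplus>\<^bsub>F\<^esub> gen (ev y f) (unit_at y)) =
     c \<odot>\<^bsub>F\<^esub> (\<Oplus>\<^bsub>F\<^esub>y\<in>vertices as. gen (ev y ?g) (unit_at y)) \<oplus>\<^bsub>F\<^esub> (\<Oplus>\<^bsub>F\<^esub>y\<in>vertices as. gen (ev y f) (unit_at y))"
    using step(1,3) g by (simp add: F.smult_finsum gen_in ev_in unit_in F.finsum_addf Pi_iff)
  also have "\<dots> \<approx> c \<odot>\<^bsub>F\<^esub> ?g \<oplus>\<^bsub>F\<^esub> f"
    using step(2,3) z by (intro eqv_add eqv_smult gen_normal_form)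
  finally show ?case by (simp add: z)
qed

text \<open>The normal form describes the submodule of relations as the common kernel of the coordinates. From here on a map
between free spaces descends to the tensor products as soon as its coordinates depend only on the
coordinates of the argument, and this dependence can be established on generators.\<close>

lemma Nker_iff:
  assumes "f \<in> carrier F"
  shows "f \<in> Nker \<longleftrightarrow> (\<forall>y \<in> vertices as. ev y f = \<zero>\<^bsub>W\<^esub>)"
proof
  assume f0: "\<forall>y \<in> vertices as. ev y f = \<zero>\<^bsub>W\<^esub>"
  have "(\<Oplus>\<^bsub>F\<^esub>y\<in>vertices as. gen (ev y f) (unit_at y)) \<approx> (\<Oplus>\<^bsub>F\<^esub>y\<in>vertices as. \<zero>\<^bsub>F\<^esub>)"
    using f0 by (intro eqv_sum finite_vertices) (simp add: eqv_zero_left unit_in)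
  then have "f \<approx> \<zero>\<^bsub>F\<^esub>" using eqv_trans[OF eqv_sym[OF normal_form[OF assms]]] by simp
  then show "f \<in> Nker" using Nker_in by (auto simp: eqv_def)
qed (use ev_Nker in blast)

end

section \<open>Operations on the tensor product in coordinates\<close>

lemma coset_map_const:
  "C \<noteq> {} \<Longrightarrow> (\<And>x. x \<in> C \<Longrightarrow> N' +>\<^bsub>V'\<^esub> g x = D) \<Longrightarrow> coset_map V' N' g C = D"
  unfolding coset_map_def by auto

lemma (in abelian_group) add_minus_cancel:
  assumes "x \<in> carrier G" "y \<in> carrier G"
  shows "x \<oplus> y \<ominus> x = y" "x \<oplus> (y \<ominus> x) = y"
  using assms r_neg2[OF assms] by (simp_all add: minus_eq a_assoc a_comm[of y "\<ominus> x"])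

context pullback_tensor
begin

text \<open>The class of an element of the free space in the tensor product.\<close>

definition cls :: "('w \<times> (nat \<times> nat list \<Rightarrow> 'k) \<Rightarrow> 'k) \<Rightarrow> ('w \<times> (nat \<times> nat list \<Rightarrow> 'k) \<Rightarrow> 'k) set" where
  "cls f = Nker +>\<^bsub>F\<^esub> f"

lemma cls_eq:
  assumes f: "f \<in> carrier F"
  shows "cls f = {g \<in> carrier F. \<forall>y \<in> vertices as. ev y g = ev y f}"
proof (intro Set.set_eqI iffI CollectI conjI ballI)
  fix g assume "g \<in> cls f"
  then obtain n where n: "n \<in> Nker" "g = n \<oplus>\<^bsub>F\<^esub> f" by (auto simp: cls_def a_r_coset_def')
  show "g \<in> carrier F" using n f Nker_in by auto
  fix y assume "y \<in> vertices as"
  then show "ev y g = ev y f" using n f ev_Nker[OF n(1)] by (simp add: module_hom_add[OF ev_hom] ev_in)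
next
  fix g assume g: "g \<in> {g \<in> carrier F. \<forall>y \<in> vertices as. ev y g = ev y f}"
  have "g \<ominus>\<^bsub>F\<^esub> f \<in> Nker"
    using g f by (subst Nker_iff) (auto simp: ev_minus ev_in minus_eq r_neg F.minus_closed)
  moreover have "g = (g \<ominus>\<^bsub>F\<^esub> f) \<oplus>\<^bsub>F\<^esub> f" using g f by (simp add: F.minus_eq F.a_assoc F.l_neg)
  ultimately show "g \<in> cls f" unfolding cls_def a_r_coset_def' by blast
qed

lemma cls_iff: "f \<in> carrier F \<Longrightarrow> g \<in> carrier F \<Longrightarrow> cls f = cls g \<longleftrightarrow> (\<forall>y \<in> vertices as. ev y f = ev y g)"
  by (auto simp: cls_eq)

lemma cls_self: "f \<in> carrier F \<Longrightarrow> f \<in> cls f"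
  by (simp add: cls_eq)

abbreviation "T \<equiv> tensor_factor K (ms ! t) t W M"

text \<open>The action of \<open>b\<close> on a generator with respect to the factor with index \<open>s\<close> of the tensor product. The indices
\<open>t\<close> and \<open>t + 1\<close> belong to \<open>M\<close>, and those from \<open>t + 2\<close> on belong to the factors of \<open>W\<close> after \<open>t\<close>.\<close>

definition factor_map :: "nat \<Rightarrow> (nat \<times> nat \<Rightarrow> 'k) \<Rightarrow> 'w \<times> (nat \<times> nat list \<Rightarrow> 'k) \<Rightarrow> 'w \<times> (nat \<times> nat list \<Rightarrow> 'k)" where
  "factor_map s b = (\<lambda>(v, x). if s < t then (ract W s v b, x)
                              else if s < t + 2 then (v, ract M (s - t) x b)
                              else (ract W (s - 1) v b, x))"

lemma T_simps:
  "carrier T = cls ` carrier F"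
  "zero T = Nker"
  "add T = set_add F"
  "smult T = (\<lambda>c. coset_map F Nker (\<lambda>v. c \<odot>\<^bsub>F\<^esub> v))"
  "ract T = (\<lambda>s C b. coset_map F Nker (free_map K (factor_map s b)) C)"
  by (auto simp: tensor_factor_def tensor_def quotient_space_def module.defs multimod.defs A_RCOSETS_def' cls_def
      tensor_factor_ker_def factor_map_def)

lemma T_cases:
  assumes "C \<in> carrier T"
  obtains f where "f \<in> carrier F" "C = cls f"
  using assms by (auto simp: T_simps)

lemma cls_in: "f \<in> carrier F \<Longrightarrow> cls f \<in> carrier T"
  by (simp add: T_simps)

lemma T_zero: "\<zero>\<^bsub>T\<^esub> = cls \<zero>\<^bsub>F\<^esub>"
  using Nker_in Nker_iff by (auto simp: T_simps cls_eq ev_zero)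

lemma T_add:
  assumes f: "f \<in> carrier F" and g: "g \<in> carrier F"
  shows "cls f \<oplus>\<^bsub>T\<^esub> cls g = cls (f \<oplus>\<^bsub>F\<^esub> g)"
proof (intro Set.set_eqI iffI)
  fix u assume "u \<in> cls f \<oplus>\<^bsub>T\<^esub> cls g"
  then obtain f' g' where "f' \<in> cls f" "g' \<in> cls g" "u = f' \<oplus>\<^bsub>F\<^esub> g'" by (auto simp: T_simps set_add_def')
  then show "u \<in> cls (f \<oplus>\<^bsub>F\<^esub> g)" using f g by (simp add: cls_eq module_hom_add[OF ev_hom])
next
  fix u assume u: "u \<in> cls (f \<oplus>\<^bsub>F\<^esub> g)"
  then have uF: "u \<in> carrier F" using f g by (simp add: cls_eq)
  have "u \<ominus>\<^bsub>F\<^esub> f \<in> cls g" using u f g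
    by (auto simp: cls_eq ev_minus module_hom_add[OF ev_hom] F.minus_closed ev_in add_minus_cancel(1))
  moreover have "u = f \<oplus>\<^bsub>F\<^esub> (u \<ominus>\<^bsub>F\<^esub> f)" using uF f by (simp add: F.add_minus_cancel(2))
  ultimately show "u \<in> cls f \<oplus>\<^bsub>T\<^esub> cls g" using cls_self[OF f] by (auto simp: T_simps set_add_def')
qed

lemma T_smult:
  assumes c: "c \<in> carrier K" and f: "f \<in> carrier F"
  shows "c \<odot>\<^bsub>T\<^esub> cls f = cls (c \<odot>\<^bsub>F\<^esub> f)"
  unfolding T_simps
proof (rule coset_map_const)
  show "cls f \<noteq> {}" using cls_self[OF f] by auto
  fix x assume "x \<in> cls f"
  then show "Nker +>\<^bsub>F\<^esub> (c \<odot>\<^bsub>F\<^esub> x) = cls (c \<odot>\<^bsub>F\<^esub> f)"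
    unfolding cls_def[symmetric] using c f by (auto simp: cls_iff module_hom_smult[OF ev_hom] cls_eq[OF f])
qed

text \<open>The coordinates on the tensor product; they do not depend on the representative by \<open>cls_eq\<close>.\<close>

definition evq where
  "evq y C = ev y (SOME f. f \<in> C)"

lemma evq_cls: "f \<in> carrier F \<Longrightarrow> y \<in> vertices as \<Longrightarrow> evq y (cls f) = ev y f"
  unfolding evq_def using someI[of "\<lambda>g. g \<in> cls f", OF cls_self] by (simp add: cls_eq)

lemma evq_zero: "y \<in> vertices as \<Longrightarrow> evq y \<zero>\<^bsub>T\<^esub> = \<zero>\<^bsub>W\<^esub>"
  by (simp add: T_zero evq_cls ev_zero)

lemma T_zero_in: "\<zero>\<^bsub>T\<^esub> \<in> carrier T"
  by (simp add: T_zero cls_in)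

lemma T_add_in: "C \<in> carrier T \<Longrightarrow> D \<in> carrier T \<Longrightarrow> C \<oplus>\<^bsub>T\<^esub> D \<in> carrier T"
  by (elim T_cases) (simp add: T_add cls_in)

lemma T_smult_in: "c \<in> carrier K \<Longrightarrow> C \<in> carrier T \<Longrightarrow> c \<odot>\<^bsub>T\<^esub> C \<in> carrier T"
  by (elim T_cases) (simp add: T_smult cls_in)

lemma evq_hom:
  assumes y: "y \<in> vertices as"
  shows "evq y \<in> module_hom K T W"
proof (rule module_homI)
  fix C assume "C \<in> carrier T" then show "evq y C \<in> carrier W"
    using y by (elim T_cases) (simp add: evq_cls ev_in)
next
  fix C D assume "C \<in> carrier T" "D \<in> carrier T"
  then show "evq y (C \<oplus>\<^bsub>T\<^esub> D) = evq y C \<oplus>\<^bsub>W\<^esub> evq y D"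
    using y by (elim T_cases) (simp add: T_add evq_cls module_hom_add[OF ev_hom])
next
  fix c C assume "c \<in> carrier K" "C \<in> carrier T"
  then show "evq y (c \<odot>\<^bsub>T\<^esub> C) = c \<odot>\<^bsub>W\<^esub> evq y C"
    using y by (elim T_cases) (simp add: T_smult evq_cls module_hom_smult[OF ev_hom])
qed

lemma evq_inj:
  assumes "C \<in> carrier T" "D \<in> carrier T" "\<And>y. y \<in> vertices as \<Longrightarrow> evq y C = evq y D"
  shows "C = D"
proof -
  obtain f g where "f \<in> carrier F" "C = cls f" "g \<in> carrier F" "D = cls g"
    using assms(1,2) by (elim T_cases)
  then show ?thesis using assms(3) by (auto simp: cls_iff evq_cls)
qed

lemma tr_h_hom: "y \<in> vertices as \<Longrightarrow> tr (h y) (h y) \<in> module_hom K W W"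
  using h_range by (intro tr_hom) auto

lemma evq_comp:
  assumes y: "y \<in> vertices as" and C: "C \<in> carrier T"
  shows "tr (h y) (h y) (evq y C) = evq y C"
proof -
  obtain f where f: "f \<in> carrier F" "C = cls f" using C by (elim T_cases)
  have "tr (h y) (h y) (ev y f) = ev y f"
  proof (rule R.free_space_hom_eq[OF module_axioms module_hom_comp[OF ev_hom[OF y] tr_h_hom[OF y]] ev_hom[OF y] _ f(1)])
    fix z assume "z \<in> B"
    then obtain w x where z: "z = (w, x)" "w \<in> carrier W" "x \<in> carrier M" by auto
    have "(\<lambda>(c', d'). if d' = h y then coeffs y x (c', h y) else \<zero>\<^bsub>K\<^esub>) = coeffs y x"
      by (auto simp: fun_eq_iff coeffs_def)
    then show "tr (h y) (h y) (ev y (free_gen K z)) = ev y (free_gen K z)"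
      using tr_act[OF z(2) coeffs_in[OF y z(3)], of "h y" "h y"] h_range[OF y] z y by (simp add: ev_gen)
  qed
  then show ?thesis using f y by (simp add: evq_cls)
qed

lemma evq_surj:
  assumes u: "\<And>y. y \<in> vertices as \<Longrightarrow> u y \<in> carrier W \<and> tr (h y) (h y) (u y) = u y"
  shows "\<exists>C \<in> carrier T. \<forall>y \<in> vertices as. evq y C = u y"
proof (intro bexI ballI)
  let ?f = "\<Oplus>\<^bsub>F\<^esub>y\<in>vertices as. gen (u y) (unit_at y)"
  have f: "?f \<in> carrier F" using u by (intro F.finsum_closed) (auto intro: gen_in unit_in)
  then show "cls ?f \<in> carrier T" by (rule cls_in)
  fix y assume y: "y \<in> vertices as"
  have "ev y ?f = (\<Oplus>\<^bsub>W\<^esub>z\<in>vertices as. ev y (gen (u z) (unit_at z)))"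
    using u by (intro module_hom_finsum[OF F.module_axioms module_axioms ev_hom[OF y]]) (auto intro: gen_in unit_in)
  also have "\<dots> = ev y (gen (u y) (unit_at y))"
    using u y by (intro finsum_single finite_vertices) (auto simp: ev_gen unit_in coeffs_unit_other act_zero intro!: act_in coeffs_in)
  also have "\<dots> = u y" using u[OF y] y by (simp add: ev_gen unit_in coeffs_unit tr_def)
  finally show "evq y (cls ?f) = u y" using f y by (simp add: evq_cls)
qed

text \<open>As \<open>h\<close> is monotone, a path of the product quiver that starts inside the support stays inside. So the action
of \<open>M\<close> has no restriction left on the summation index: the terms with a start outside the support vanish.\<close>

lemma ract_M_val:
  assumes s: "s < length as" and x: "x \<in> carrier M" and b: "b \<in> carrier (path_algebra K (as ! s))"
  shows "ract M s x b (\<gamma>, y) =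
    (if (\<gamma>, y) \<in> subgraph as h then \<Oplus>\<^bsub>K\<^esub>c\<in>{1..y ! s}. x (\<gamma>, y[s := c]) \<otimes>\<^bsub>K\<^esub> b (c, y ! s) else \<zero>\<^bsub>K\<^esub>)"
proof -
  let ?I = "{c. c \<le> y ! s \<and> (\<forall>d \<in> {c..y ! s}. (\<gamma>, y[s := d]) \<in> subgraph as h)}"
  have "ract M s x b (\<gamma>, y) = (\<Oplus>\<^bsub>K\<^esub>c\<in>?I. x (\<gamma>, y[s := c]) \<otimes>\<^bsub>K\<^esub> b (c, y ! s))"
    by (simp add: pullback_bimod_def standard_bimod_def)
  moreover have "(\<Oplus>\<^bsub>K\<^esub>c\<in>?I. x (\<gamma>, y[s := c]) \<otimes>\<^bsub>K\<^esub> b (c, y ! s)) = \<zero>\<^bsub>K\<^esub>" if "(\<gamma>, y) \<notin> subgraph as h"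
  proof -
    have "?I = {}" using that by (auto intro!: bexI[of _ "y ! s"])
    then show ?thesis by (simp only: R.finsum_empty)
  qed
  moreover have "(\<Oplus>\<^bsub>K\<^esub>c\<in>?I. x (\<gamma>, y[s := c]) \<otimes>\<^bsub>K\<^esub> b (c, y ! s)) =
      (\<Oplus>\<^bsub>K\<^esub>c\<in>{1..y ! s}. x (\<gamma>, y[s := c]) \<otimes>\<^bsub>K\<^esub> b (c, y ! s))" if S: "(\<gamma>, y) \<in> subgraph as h"
  proof (rule R.finsum_sup)
    have y: "y \<in> vertices as" "1 \<le> \<gamma>" using S by (auto simp: subgraph_def)
    have len: "s < length y" using y s by (simp add: vertices_def)
    show "?I \<subseteq> {1..y ! s}"
    proof
      fix c assume c: "c \<in> ?I"
      then have "y[s := c] \<in> vertices as" by (auto simp: subgraph_def)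
      then have "1 \<le> y[s := c] ! s" using s unfolding vertices_def by blast
      then show "c \<in> {1..y ! s}" using c len by auto
    qed
    fix c assume c: "c \<in> {1..y ! s} - ?I"
    then obtain d where d: "c \<le> d" "d \<le> y ! s" "(\<gamma>, y[s := d]) \<notin> subgraph as h" by auto
    have yd: "y[s := d] \<in> vertices as" using y s c d by (intro vertices_update) auto
    have "h (y[s := c]) \<le> h (y[s := d])"
      using h_mono[OF yd s, of c] c d len by simp
    then have "(\<gamma>, y[s := c]) \<notin> subgraph as h" using d(3) yd y by (auto simp: subgraph_def)
    then show "x (\<gamma>, y[s := c]) \<otimes>\<^bsub>K\<^esub> b (c, y ! s) = \<zero>\<^bsub>K\<^esub>"
      using x coeff_in[OF b] by (simp add: M_simps)
  qed (use M_val[OF x] coeff_in[OF b] in auto)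
  ultimately show ?thesis by simp
qed

lemma ract_M_in:
  assumes s: "s < length as" and x: "x \<in> carrier M" and b: "b \<in> carrier (path_algebra K (as ! s))"
  shows "ract M s x b \<in> carrier M"
proof -
  have "ract M s x b (\<gamma>, y) \<in> carrier K" for \<gamma> y
    using coeff_in[OF b] M_val[OF x] by (simp add: ract_M_val[OF assms] R.finsum_closed)
  moreover have "ract M s x b (\<gamma>, y) = \<zero>\<^bsub>K\<^esub>" if "(\<gamma>, y) \<notin> subgraph as h" for \<gamma> y
    using that by (simp add: ract_M_val[OF assms])
  ultimately show ?thesis unfolding M_simps(1) by auto
qed

text \<open>Under \<open>coeffs\<close> an arrow of the product quiver from \<open>y[s := c]\<close> to \<open>y\<close> becomes right multiplication with the path
from \<open>h (y[s := c])\<close> to \<open>h y\<close>, which acts on \<open>W\<close> by the corresponding map of the representation.\<close>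

lemma act_coeffs_ract:
  assumes s: "s < length as" and y: "y \<in> vertices as" and x: "x \<in> carrier M"
    and b: "b \<in> carrier (path_algebra K (as ! s))" and w: "w \<in> carrier W"
  shows "ract W t w (coeffs y (ract M s x b)) =
    (\<Oplus>\<^bsub>W\<^esub>c\<in>{1..y ! s}. b (c, y ! s) \<odot>\<^bsub>W\<^esub> tr (h (y[s := c])) (h y) (ract W t w (coeffs (y[s := c]) x)))"
proof -
  let ?q = "\<lambda>c (\<gamma>, d). if d = h y then coeffs (y[s := c]) x (\<gamma>, h (y[s := c])) else \<zero>\<^bsub>K\<^esub>"
  note bK = coeff_in[OF b]
  have y': "y[s := c] \<in> vertices as" if "c \<in> {1..y ! s}" for c
    using that y s by (intro vertices_update) auto
  have hm: "h (y[s := c]) \<le> h y" if "c \<in> {1..y ! s}" for c using h_mono[OF y s] that by auto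
  have q: "?q c \<in> A" if c: "c \<in> {1..y ! s}" for c
    using h_range[OF y] hm[OF c] M_val[OF x] by (auto simp: in_path_algebra coeffs_def)
  have "coeffs y (ract M s x b) z = (\<Oplus>\<^bsub>K\<^esub>c\<in>{1..y ! s}. b (c, y ! s) \<otimes>\<^bsub>K\<^esub> ?q c z)" for z
  proof -
    obtain \<gamma> d where z: "z = (\<gamma>, d)" by (cases z)
    show ?thesis
    proof (cases "d = h y \<and> 1 \<le> \<gamma> \<and> \<gamma> \<le> h y")
      case True
      then have "coeffs y (ract M s x b) z = (\<Oplus>\<^bsub>K\<^esub>c\<in>{1..y ! s}. x (\<gamma>, y[s := c]) \<otimes>\<^bsub>K\<^esub> b (c, y ! s))"
        using y by (simp add: z coeffs_def ract_M_val[OF s x b] subgraph_def)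
      also have "\<dots> = (\<Oplus>\<^bsub>K\<^esub>c\<in>{1..y ! s}. b (c, y ! s) \<otimes>\<^bsub>K\<^esub> ?q c z)"
      proof (rule R.finsum_cong', simp, rule Pi_I, goal_cases)
        case (1 c) then show ?case using bK M_val[OF x] by (simp add: z coeffs_def)
      next
        case (2 c)
        have "x (\<gamma>, y[s := c]) = \<zero>\<^bsub>K\<^esub>" if "\<not> \<gamma> \<le> h (y[s := c])"
          using that x by (auto simp: M_simps subgraph_def)
        then show ?case using True bK M_val[OF x] by (auto simp: z coeffs_def R.m_comm)
      qed
      finally show ?thesis .
    next
      case False
      have "(\<Oplus>\<^bsub>K\<^esub>c\<in>{1..y ! s}. b (c, y ! s) \<otimes>\<^bsub>K\<^esub> ?q c z) = \<zero>\<^bsub>K\<^esub>"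
      proof (rule R.add.finprod_one_eqI)
        fix c assume c: "c \<in> {1..y ! s}"
        then show "b (c, y ! s) \<otimes>\<^bsub>K\<^esub> ?q c z = \<zero>\<^bsub>K\<^esub>" using False hm[OF c] bK by (auto simp: z coeffs_def)
      qed
      then show ?thesis using False by (auto simp: z coeffs_def)
    qed
  qed
  then have "coeffs y (ract M s x b) = (\<lambda>z. \<Oplus>\<^bsub>K\<^esub>c\<in>{1..y ! s}. b (c, y ! s) \<otimes>\<^bsub>K\<^esub> ?q c z)" by blast
  then have "ract W t w (coeffs y (ract M s x b)) =
      (\<Oplus>\<^bsub>W\<^esub>c\<in>{1..y ! s}. ract W t w (\<lambda>z. b (c, y ! s) \<otimes>\<^bsub>K\<^esub> ?q c z))"
    using act_sum[OF w, of "{1..y ! s}" "\<lambda>c z. b (c, y ! s) \<otimes>\<^bsub>K\<^esub> ?q c z"] q bK by (simp add: smult_in)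
  also have "\<dots> = (\<Oplus>\<^bsub>W\<^esub>c\<in>{1..y ! s}. b (c, y ! s) \<odot>\<^bsub>W\<^esub> tr (h (y[s := c])) (h y) (ract W t w (coeffs (y[s := c]) x)))"
  proof (rule finsum_cong', simp, rule Pi_I, goal_cases)
    case (1 c)
    then show ?case using h_range[OF y] h_range[OF y'[OF 1]] hm[OF 1] bK w x y'[OF 1]
      by (intro smult_closed tr_in act_in coeffs_in) auto
  next
    case (2 c)
    have "tr (h (y[s := c])) (h y) (ract W t w (coeffs (y[s := c]) x)) = ract W t w (?q c)"
      using h_range[OF y] h_range[OF y'[OF 2]] hm[OF 2]
      by (intro tr_act w coeffs_in y'[OF 2] x) auto
    then show ?case using act_smult[OF w q[OF 2] bK] by simp
  qed
  finally show ?thesis .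
qed

text \<open>The lengths of the chains that act on the tensor product: the factor with index \<open>t\<close> is replaced by the two of \<open>M\<close>.\<close>

definition ls where "ls = take t ms @ as @ drop (t + 1) ms"

lemma length_ls: "length ls = length ms + 1"
  using t len_as by (simp add: ls_def)

lemma nth_ls:
  "s < t \<Longrightarrow> ls ! s = ms ! s"
  "t \<le> s \<Longrightarrow> s < t + 2 \<Longrightarrow> ls ! s = as ! (s - t)"
  "t + 2 \<le> s \<Longrightarrow> s < length ms + 1 \<Longrightarrow> ls ! s = ms ! (s - 1)"
proof -
  show "ls ! s = ms ! s" if "s < t" using that t by (simp add: ls_def nth_append)
  show "ls ! s = as ! (s - t)" if "t \<le> s" "s < t + 2"
  proof -
    have "s - t < 2" using that by linarith
    then show ?thesis using that t len_as by (simp add: ls_def nth_append)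
  qed
  show "ls ! s = ms ! (s - 1)" if s: "t + 2 \<le> s" "s < length ms + 1"
  proof -
    obtain k where k: "s = t + 2 + k" using s(1) le_Suc_ex by blast
    show ?thesis using t len_as s unfolding k by (simp add: ls_def nth_append)
  qed
qed

lemma other_hom:
  "s < length ms \<Longrightarrow> b \<in> carrier (path_algebra K (ms ! s)) \<Longrightarrow> (\<lambda>w. ract W s w b) \<in> module_hom K W W"
  using path_rep.act_hom[OF fd_module_path_rep[OF fd]] .

lemma other_commute:
  "s < length ms \<Longrightarrow> s \<noteq> t \<Longrightarrow> b \<in> carrier (path_algebra K (ms ! s)) \<Longrightarrow> a \<in> A \<Longrightarrow> w \<in> carrier W \<Longrightarrow>
     ract W t (ract W s w b) a = ract W s (ract W t w a) b"
  using fd t unfolding fd_module_def by blast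

lemma factor_map_in:
  assumes s: "s < length ls" and b: "b \<in> carrier (path_algebra K (ls ! s))" and z: "z \<in> B"
  shows "factor_map s b z \<in> B"
proof -
  obtain w x where wx: "z = (w, x)" "w \<in> carrier W" "x \<in> carrier M" using z by auto
  consider "s < t" | "t \<le> s" "s < t + 2" | "t + 2 \<le> s" by linarith
  then show ?thesis
  proof cases
    case 1 then show ?thesis using b t wx module_hom_in[OF other_hom, of s b w]
      by (simp add: factor_map_def nth_ls)
  next
    case 2 then show ?thesis using b wx len_as ract_M_in[of "s - t" x b]
      by (simp add: factor_map_def nth_ls)
  next
    case 3 then show ?thesis using b s wx module_hom_in[OF other_hom, of "s - 1" b w]
      by (simp add: factor_map_def nth_ls length_ls)
  qed
qed

lemma factor_map_hom:
  "s < length ls \<Longrightarrow> b \<in> carrier (path_algebra K (ls ! s)) \<Longrightarrow> free_map K (factor_map s b) \<in> module_hom K F F"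
  by (intro R.free_map_hom factor_map_in)

lemma ev_factor_map_gen:
  assumes "s < length ls" "b \<in> carrier (path_algebra K (ls ! s))" "z \<in> B"
  shows "ev y (free_map K (factor_map s b) (free_gen K z)) = ev y (free_gen K (factor_map s b z))"
  using R.free_map_gen[of B "factor_map s b" B, OF factor_map_in[OF assms(1,2)] assms(3)] by simp

text \<open>A factor that is carried along acts on the coordinates, because it commutes with the action of the factor with index \<open>t\<close>.\<close>

lemma ev_other:
  assumes s: "s < length ls" and b: "b \<in> carrier (path_algebra K (ls ! s))" and y: "y \<in> vertices as"
    and f: "f \<in> carrier F" and s': "s < t \<and> s' = s \<or> t + 2 \<le> s \<and> s' = s - 1"
  shows "ev y (free_map K (factor_map s b) f) = ract W s' (ev y f) b"
proof -
  have s'': "s' < length ms" "s' \<noteq> t" "ls ! s = ms ! s'"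
    using s s' t nth_ls[of s] by (auto simp: length_ls)
  then have b': "b \<in> carrier (path_algebra K (ms ! s'))" using b by simp
  show ?thesis
  proof (rule R.free_space_hom_eq[OF module_axioms module_hom_comp[OF factor_map_hom[OF s b] ev_hom[OF y]]
      module_hom_comp[OF ev_hom[OF y] other_hom[OF s''(1) b']] _ f])
    fix z assume z: "z \<in> B"
    then obtain w x where wx: "z = (w, x)" "w \<in> carrier W" "x \<in> carrier M" by auto
    have "factor_map s b z = (ract W s' w b, x)" using s' wx by (auto simp: factor_map_def)
    then have "ev y (free_map K (factor_map s b) (free_gen K z)) = ract W t (ract W s' w b) (coeffs y x)"
      using wx y module_hom_in[OF other_hom[OF s''(1) b'] wx(2)]
      by (subst ev_factor_map_gen[OF s b z]) (simp add: ev_gen)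
    also have "\<dots> = ract W s' (ev y (free_gen K z)) b"
      using wx y by (simp add: other_commute[OF s''(1,2) b'] coeffs_in ev_gen)
    finally show "ev y (free_map K (factor_map s b) (free_gen K z)) = ract W s' (ev y (free_gen K z)) b" .
  qed
qed

lemma new_summand_in:
  assumes s: "s < length as" and b: "b \<in> carrier (path_algebra K (as ! s))" and y: "y \<in> vertices as"
    and f: "f \<in> carrier F" and c: "c \<in> {1..y ! s}"
  shows "b (c, y ! s) \<odot>\<^bsub>W\<^esub> tr (h (y[s := c])) (h y) (ev (y[s := c]) f) \<in> carrier W"
proof -
  have y': "y[s := c] \<in> vertices as" "h (y[s := c]) \<le> h y"
    using c y s h_mono[OF y s, of c] by (auto intro: vertices_update)
  show ?thesis using h_range[OF y] h_range[OF y'(1)] y'(2)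
    by (intro smult_closed coeff_in[OF b] tr_in ev_in y'(1) f) auto
qed

lemma ev_new:
  assumes s: "t \<le> s" "s < t + 2" and b: "b \<in> carrier (path_algebra K (ls ! s))" and y: "y \<in> vertices as"
    and f: "f \<in> carrier F"
  shows "ev y (free_map K (factor_map s b) f) =
    (\<Oplus>\<^bsub>W\<^esub>c\<in>{1..y ! (s - t)}. b (c, y ! (s - t)) \<odot>\<^bsub>W\<^esub> tr (h (y[s - t := c])) (h y) (ev (y[s - t := c]) f))"
proof -
  have sl: "s < length ls" and sa: "s - t < length as" and b': "b \<in> carrier (path_algebra K (as ! (s - t)))"
    using s t b nth_ls(2)[OF s] len_as by (auto simp: length_ls)
  have y': "y[s - t := c] \<in> vertices as" "h (y[s - t := c]) \<le> h y" if "c \<in> {1..y ! (s - t)}" for c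
    using that y sa h_mono[OF y sa, of c] by (auto intro: vertices_update)
  show ?thesis
  proof (rule R.free_space_hom_eq[OF module_axioms module_hom_comp[OF factor_map_hom[OF sl b] ev_hom[OF y]] _ _ f])
    show "(\<lambda>f. \<Oplus>\<^bsub>W\<^esub>c\<in>{1..y ! (s - t)}. b (c, y ! (s - t)) \<odot>\<^bsub>W\<^esub> tr (h (y[s - t := c])) (h y) (ev (y[s - t := c]) f))
        \<in> module_hom K F W"
    proof (intro module_hom_sum module_hom_scale coeff_in[OF b'])
      fix c assume c: "c \<in> {1..y ! (s - t)}"
      show "(\<lambda>f. tr (h (y[s - t := c])) (h y) (ev (y[s - t := c]) f)) \<in> module_hom K F W"
        using h_range[OF y] h_range[OF y'(1)[OF c]] y'(2)[OF c]
        by (intro module_hom_comp[OF ev_hom[OF y'(1)[OF c]] tr_hom]) auto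
    qed
    fix z assume z: "z \<in> B"
    then obtain w x where wx: "z = (w, x)" "w \<in> carrier W" "x \<in> carrier M" by auto
    have "factor_map s b z = (w, ract M (s - t) x b)" using s wx by (auto simp: factor_map_def)
    then have "ev y (free_map K (factor_map s b) (free_gen K z)) = ract W t w (coeffs y (ract M (s - t) x b))"
      using wx y ract_M_in[OF sa wx(3) b'] by (subst ev_factor_map_gen[OF sl b z]) (simp add: ev_gen)
    also have "\<dots> = (\<Oplus>\<^bsub>W\<^esub>c\<in>{1..y ! (s - t)}. b (c, y ! (s - t)) \<odot>\<^bsub>W\<^esub> tr (h (y[s - t := c])) (h y) (ev (y[s - t := c]) (free_gen K z)))"
      unfolding act_coeffs_ract[OF sa y wx(3) b' wx(2)]
      unfolding wx(1)
    proof (rule finsum_cong', simp, rule Pi_I, goal_cases)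
      case (1 c) then show ?case by (rule new_summand_in[OF sa b' y gen_in[OF wx(2,3)]])
    next
      case (2 c) then show ?case using y'(1)[OF 2] wx by (simp add: ev_gen)
    qed
    finally show "ev y (free_map K (factor_map s b) (free_gen K z)) =
       (\<Oplus>\<^bsub>W\<^esub>c\<in>{1..y ! (s - t)}. b (c, y ! (s - t)) \<odot>\<^bsub>W\<^esub> tr (h (y[s - t := c])) (h y) (ev (y[s - t := c]) (free_gen K z)))" .
  qed
qed

lemma ev_factor_map_cong:
  assumes s: "s < length ls" and b: "b \<in> carrier (path_algebra K (ls ! s))" and y: "y \<in> vertices as"
    and f: "f \<in> carrier F" and g: "g \<in> carrier F" and eq: "\<And>y. y \<in> vertices as \<Longrightarrow> ev y f = ev y g"
  shows "ev y (free_map K (factor_map s b) f) = ev y (free_map K (factor_map s b) g)"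
proof -
  consider "s < t" | "t + 2 \<le> s" | "t \<le> s" "s < t + 2" by linarith
  then show ?thesis
  proof cases
    case 3
    then have sa: "s - t < length as" and b': "b \<in> carrier (path_algebra K (as ! (s - t)))"
      using len_as b nth_ls(2)[of s] by auto
    then have "ev (y[s - t := c]) f = ev (y[s - t := c]) g" if "c \<in> {1..y ! (s - t)}" for c
      using that y by (intro eq vertices_update) auto
    then have "(\<Oplus>\<^bsub>W\<^esub>c\<in>{1..y ! (s - t)}. b (c, y ! (s - t)) \<odot>\<^bsub>W\<^esub> tr (h (y[s - t := c])) (h y) (ev (y[s - t := c]) f)) =
       (\<Oplus>\<^bsub>W\<^esub>c\<in>{1..y ! (s - t)}. b (c, y ! (s - t)) \<odot>\<^bsub>W\<^esub> tr (h (y[s - t := c])) (h y) (ev (y[s - t := c]) g))"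
      using new_summand_in[OF sa b' y g] by (intro finsum_cong') auto
    then show ?thesis using ev_new[OF 3 b y] f g by simp
  qed (use ev_other[OF s b y] f g eq[OF y] in auto)
qed

lemma T_ract:
  assumes s: "s < length ls" and b: "b \<in> carrier (path_algebra K (ls ! s))" and f: "f \<in> carrier F"
  shows "ract T s (cls f) b = cls (free_map K (factor_map s b) f)"
  unfolding T_simps
proof (rule coset_map_const)
  show "cls f \<noteq> {}" using cls_self[OF f] by auto
  fix x assume "x \<in> cls f"
  then have x: "x \<in> carrier F" "\<And>y. y \<in> vertices as \<Longrightarrow> ev y x = ev y f" by (auto simp: cls_eq[OF f])
  show "Nker +>\<^bsub>F\<^esub> free_map K (factor_map s b) x = cls (free_map K (factor_map s b) f)"
    unfolding cls_def[symmetric]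
    using cls_iff[OF module_hom_in[OF factor_map_hom[OF s b] x(1)] module_hom_in[OF factor_map_hom[OF s b] f]]
      ev_factor_map_cong[OF s b _ x(1) f x(2)] by blast
qed

lemma T_ract_in: "s < length ls \<Longrightarrow> b \<in> carrier (path_algebra K (ls ! s)) \<Longrightarrow> C \<in> carrier T \<Longrightarrow> ract T s C b \<in> carrier T"
  by (elim T_cases) (simp add: T_ract cls_in module_hom_in[OF factor_map_hom])

lemma evq_ract_other:
  assumes "s < length ls" "b \<in> carrier (path_algebra K (ls ! s))" "y \<in> vertices as" "C \<in> carrier T"
    "s < t \<and> s' = s \<or> t + 2 \<le> s \<and> s' = s - 1"
  shows "evq y (ract T s C b) = ract W s' (evq y C) b"
  using assms(4) by (elim T_cases)
    (simp add: T_ract[OF assms(1,2)] evq_cls[OF _ assms(3)] module_hom_in[OF factor_map_hom[OF assms(1,2)]] ev_other[OF assms(1-3) _ assms(5)])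

lemma evq_ract_new:
  assumes s: "t \<le> s" "s < t + 2" and b: "b \<in> carrier (path_algebra K (ls ! s))" and y: "y \<in> vertices as"
    and C: "C \<in> carrier T"
  shows "evq y (ract T s C b) =
    (\<Oplus>\<^bsub>W\<^esub>c\<in>{1..y ! (s - t)}. b (c, y ! (s - t)) \<odot>\<^bsub>W\<^esub> tr (h (y[s - t := c])) (h y) (evq (y[s - t := c]) C))"
proof -
  obtain f where f: "f \<in> carrier F" "C = cls f" using C by (elim T_cases)
  have sl: "s < length ls" and sa: "s - t < length as" and b': "b \<in> carrier (path_algebra K (as ! (s - t)))"
    using s t b nth_ls(2)[OF s] len_as by (auto simp: length_ls)
  have e: "evq (y[s - t := c]) C = ev (y[s - t := c]) f" if "c \<in> {1..y ! (s - t)}" for c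
    using that y sa f by (auto intro!: evq_cls vertices_update)
  have "evq y (ract T s C b) = ev y (free_map K (factor_map s b) f)"
    using f y by (simp add: T_ract[OF sl b] evq_cls module_hom_in[OF factor_map_hom[OF sl b]])
  also have "\<dots> = (\<Oplus>\<^bsub>W\<^esub>c\<in>{1..y ! (s - t)}. b (c, y ! (s - t)) \<odot>\<^bsub>W\<^esub> tr (h (y[s - t := c])) (h y) (evq (y[s - t := c]) C))"
    unfolding ev_new[OF s b y f(1)] using new_summand_in[OF sa b' y f(1)] e by (intro finsum_cong') auto
  finally show ?thesis .
qed

end

text \<open>The coordinates are natural in \<open>W\<close>, because \<open>g\<close> commutes with the action by which they are defined.\<close>

lemma tensor_factor_map_evq:
  assumes W: "pullback_tensor K W ms t as h" and W': "pullback_tensor K W' ms t as h"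
    and g: "g \<in> Hom (mod_cat K ms) W W'"
  shows "tensor_factor_map K (ms ! t) t (pullback_bimod K as h) W W' g
      \<in> carrier (tensor_factor K (ms ! t) t W (pullback_bimod K as h)) \<rightarrow>\<^sub>E
        carrier (tensor_factor K (ms ! t) t W' (pullback_bimod K as h))" (is ?in)
    and "y \<in> vertices as \<Longrightarrow> C \<in> carrier (tensor_factor K (ms ! t) t W (pullback_bimod K as h)) \<Longrightarrow>
      pullback_tensor.evq K W' t h y (tensor_factor_map K (ms ! t) t (pullback_bimod K as h) W W' g C) =
      g (pullback_tensor.evq K W t h y C)"
proof -
  interpret W: pullback_tensor K W ms t as h by fact
  interpret W': pullback_tensor K W' ms t as h by fact
  let ?m = "free_map K (\<lambda>(v, x). (g v, x))"
  have gh: "g \<in> module_hom K W W'" using g by (simp add: Hom_mod_cat)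
  have gB: "(case z of (v, x) \<Rightarrow> (g v, x)) \<in> W'.B" if "z \<in> W.B" for z
    using that module_hom_in[OF gh] by auto
  have mh: "?m \<in> module_hom K W.F W'.F" using gB by (rule W.R.free_map_hom)
  have ev: "W'.ev y (?m f) = g (W.ev y f)" if y: "y \<in> vertices as" and f: "f \<in> carrier W.F" for y f
  proof (rule W.R.free_space_hom_eq[OF W'.module_axioms module_hom_comp[OF mh W'.ev_hom[OF y]]
      module_hom_comp[OF W.ev_hom[OF y] gh] _ f])
    fix z assume z: "z \<in> W.B"
    then obtain w x where wx: "z = (w, x)" "w \<in> carrier W" "x \<in> carrier W.M" by auto
    have "?m (free_gen K z) = free_gen K (g w, x)"
      using W.R.free_map_gen[of W.B "\<lambda>(v, x). (g v, x)" W'.B, OF gB z] wx by simp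
    then have "W'.ev y (?m (free_gen K z)) = ract W' t (g w) (W'.coeffs y x)"
      using W'.ev_gen[OF y module_hom_in[OF gh wx(2)] wx(3)] by simp
    also have "ract W' t (g w) (W.coeffs y x) = g (ract W t w (W.coeffs y x))"
      using g W.t wx W.coeffs_in[OF y wx(3)] by (simp add: Hom_mod_cat)
    finally show "W'.ev y (?m (free_gen K z)) = g (W.ev y (free_gen K z))"
      using W.ev_gen[OF y wx(2,3)] wx(1) by simp
  qed
  have map: "tensor_factor_map K (ms ! t) t W.M W W' g (W.cls f) = W'.cls (?m f)" if f: "f \<in> carrier W.F" for f
  proof -
    have "coset_map W'.F W'.Nker ?m (W.cls f) = W'.cls (?m f)"
    proof (rule coset_map_const)
      show "W.cls f \<noteq> {}" using W.cls_self[OF f] by auto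
      fix x assume "x \<in> W.cls f"
      then have x: "x \<in> carrier W.F" "\<And>y. y \<in> vertices as \<Longrightarrow> W.ev y x = W.ev y f" by (auto simp: W.cls_eq[OF f])
      show "W'.Nker +>\<^bsub>W'.F\<^esub> ?m x = W'.cls (?m f)"
        unfolding W'.cls_def[symmetric]
        using W'.cls_iff[OF module_hom_in[OF mh x(1)] module_hom_in[OF mh f]] ev[OF _ x(1)] ev[OF _ f] x(2) by simp
    qed
    then show ?thesis using W.cls_in[OF f] by (simp add: tensor_factor_map_def)
  qed
  show ?in
  proof (rule PiE_I)
    fix C assume "C \<in> carrier W.T"
    then show "tensor_factor_map K (ms ! t) t W.M W W' g C \<in> carrier W'.T"
      by (elim W.T_cases) (simp add: map W'.cls_in module_hom_in[OF mh])
  qed (simp add: tensor_factor_map_def)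
  show "W'.evq y (tensor_factor_map K (ms ! t) t W.M W W' g C) = g (W.evq y C)"
    if "y \<in> vertices as" "C \<in> carrier W.T"
    using that(2) by (elim W.T_cases) (simp add: map W'.evq_cls W.evq_cls module_hom_in[OF mh] ev that(1))
qed

section \<open>Composites of pullbacks\<close>

context pullback_coords
begin

lemma EV_path:
  assumes x: "x \<in> vertices ls" and s: "s < length ls" and w: "w \<in> carrier W" and c: "1 \<le> c" "c \<le> d" "d \<le> ls ! s"
  shows "EV x (ract W s w (path K c d)) =
     (if d = x ! s then tr (H (x[s := c])) (H x) (EV (x[s := c]) w) else \<zero>\<^bsub>V\<^esub>)"
proof (cases "d = x ! s")
  case True
  have "EV x (ract W s w (path K c d)) = path K c d (c, x ! s) \<odot>\<^bsub>V\<^esub> tr (H (x[s := c])) (H x) (EV (x[s := c]) w)"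
    unfolding EV_ract[OF x s w path_in[OF c]]
  proof (rule finsum_single)
    fix e assume "e \<in> {1..x ! s}" "e \<noteq> c"
    then show "path K c d (e, x ! s) \<odot>\<^bsub>V\<^esub> tr (H (x[s := e])) (H x) (EV (x[s := e]) w) = \<zero>\<^bsub>V\<^esub>"
      using x s w by (simp add: path_def free_gen_def tr_H_in EV_in vertices_update)
  qed (use c True summand_in[OF x s w path_in[OF c]] in auto)
  then show ?thesis using True c x s w by (simp add: path_def free_gen_def tr_H_in EV_in vertices_update)
next
  case False
  have "EV x (ract W s w (path K c d)) = \<zero>\<^bsub>V\<^esub>"
    unfolding EV_ract[OF x s w path_in[OF c]]
    by (rule add.finprod_one_eqI) (use False x s w in \<open>simp add: path_def free_gen_def tr_H_in EV_in vertices_update\<close>)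
  then show ?thesis using False by simp
qed

end

lemma coords_cong:
  assumes "pullback_coords K V N r W ls H EV" and eq: "\<And>x. x \<in> vertices ls \<Longrightarrow> H x = H' x"
  shows "pullback_coords K V N r W ls H' EV"
proof -
  interpret pullback_coords K V N r W ls H EV by fact
  show ?thesis
  \<comment> \<open>The numbered cases are those axioms of \<open>pullback_coords\<close> that mention \<open>H\<close>.\<close>
  proof (unfold_locales, goal_cases)
    case (1 x) then show ?case using H_range eq by simp
  next
    case (2 x s c) then show ?case using H_mono eq vertices_update by metis
  next
    case (9 x w) then show ?case using EV_comp[of x w] eq by simp
  next
    case (10 x s w a)
    have "(\<Oplus>\<^bsub>V\<^esub>c\<in>{1..x ! s}. a (c, x ! s) \<odot>\<^bsub>V\<^esub> tr (H (x[s := c])) (H x) (EV (x[s := c]) w)) =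
      (\<Oplus>\<^bsub>V\<^esub>c\<in>{1..x ! s}. a (c, x ! s) \<odot>\<^bsub>V\<^esub> tr (H' (x[s := c])) (H' x) (EV (x[s := c]) w))"
      using summand_in[OF 10] eq[OF 10(1)] eq[OF vertices_update[OF 10(1) _ _ 10(2)]] by (intro finsum_cong') auto
    then show ?case using EV_ract[OF 10] by simp
  next
    case (12 u) then show ?case using EV_surj[of u] eq by simp
  qed (auto intro: zero_W add_W smult_W ract_W EV_hom EV_zero EV_inj)
qed

text \<open>Tensoring with respect to the factor \<open>t\<close> replaces the entry \<open>h y\<close> of a vertex by the pair of entries \<open>y\<close>. So
\<open>merge t h\<close> is the induced map from the vertices of the new product quiver to those of the old one, and
\<open>merged t\<close> extracts the pair. The function \<open>unmerge\<close> reinserts a pair.\<close>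

definition merged :: "nat \<Rightarrow> nat list \<Rightarrow> nat list" where
  "merged t x = take 2 (drop t x)"

definition merge :: "nat \<Rightarrow> (nat list \<Rightarrow> nat) \<Rightarrow> nat list \<Rightarrow> nat list" where
  "merge t h x = take t x @ [h (merged t x)] @ drop (t + 2) x"

lemma nth_merged: "t + 2 \<le> length x \<Longrightarrow> s < 2 \<Longrightarrow> merged t x ! s = x ! (t + s)"
  by (simp add: merged_def)

lemma length_merged: "t + 2 \<le> length x \<Longrightarrow> length (merged t x) = 2"
  by (simp add: merged_def)

lemma length_merge: "t + 2 \<le> length x \<Longrightarrow> length (merge t h x) = length x - 1"
  by (simp add: merge_def)

lemma nth_merge:
  "t + 2 \<le> length x \<Longrightarrow> s < length x - 1 \<Longrightarrow>
     merge t h x ! s = (if s < t then x ! s else if s = t then h (merged t x) else x ! (s + 1))"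
  by (auto simp: merge_def nth_append nth_Cons split: nat.splits intro!: arg_cong[of _ _ "\<lambda>k. x ! k"])

lemma merged_update_other: "s < t \<or> t + 2 \<le> s \<Longrightarrow> merged t (x[s := c]) = merged t x"
  by (auto simp: merged_def drop_update_swap take_update_cancel)

lemma merged_update_new: "t \<le> s \<Longrightarrow> merged t (x[s := c]) = (merged t x)[s - t := c]"
  by (simp add: merged_def drop_update_swap take_update_swap)

lemma merge_update_other:
  assumes "t + 2 \<le> length x" "s < t \<and> s' = s \<or> t + 2 \<le> s \<and> s' = s - 1"
  shows "merge t h (x[s := c]) = (merge t h x)[s' := c]"
proof -
  have m: "merged t (x[s := c]) = merged t x" using assms by (intro merged_update_other) auto
  show ?thesis
  proof (rule nth_equalityI)
    show "length (merge t h (x[s := c])) = length ((merge t h x)[s' := c])"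
      using assms(1) by (simp add: length_merge)
    fix k assume "k < length (merge t h (x[s := c]))"
    then have k: "k < length x - 1" using assms(1) by (simp add: length_merge)
    have l: "t + 2 \<le> length (x[s := c])" using assms(1) by simp
    have k': "k < length (x[s := c]) - 1" using k by simp
    have km: "k < length (merge t h x)" using k assms(1) by (simp add: length_merge)
    from assms(2) consider "s < t" "s' = s" | "t < s'" "s = Suc s'" by (cases s) auto
    then show "merge t h (x[s := c]) ! k = (merge t h x)[s' := c] ! k"
    proof cases
      case 1 then show ?thesis
        unfolding nth_merge[OF l k'] m by (cases "k = s'") (use k km assms(1) in \<open>simp_all add: nth_merge\<close>)
    next
      case 2 then show ?thesis
        unfolding nth_merge[OF l k'] m by (cases "k = s'") (use k km assms(1) in \<open>simp_all add: nth_merge\<close>)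
    qed
  qed
qed

lemma merge_update_new:
  assumes "t + 2 \<le> length x" "t \<le> s" "s < t + 2"
  shows "merge t h (x[s := c]) = (merge t h x)[t := h ((merged t x)[s - t := c])]"
  using assms by (intro nth_equalityI) (auto simp: length_merge nth_merge nth_list_update merged_update_new)

definition unmerge :: "nat \<Rightarrow> nat list \<Rightarrow> nat list \<Rightarrow> nat list" where
  "unmerge t z y = take t z @ y @ drop (t + 1) z"

lemma merged_unmerge: "t < length z \<Longrightarrow> length y = 2 \<Longrightarrow> merged t (unmerge t z y) = y"
  by (simp add: merged_def unmerge_def)

lemma merge_unmerge: "t < length z \<Longrightarrow> length y = 2 \<Longrightarrow> h y = z ! t \<Longrightarrow> merge t h (unmerge t z y) = z"
  by (simp add: merge_def merged_unmerge) (simp add: unmerge_def id_take_nth_drop[symmetric])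

lemma unmerge_merge: "t + 2 \<le> length x \<Longrightarrow> unmerge t (merge t h x) (merged t x) = x"
  by (simp add: merge_def unmerge_def merged_def) (metis append_take_drop_id drop_drop add.commute add_2_eq_Suc')

context pullback_tensor
begin

lemma vertices_ls:
  assumes "x \<in> vertices ls"
  shows "t + 2 \<le> length x" "merged t x \<in> vertices as" "merge t h x \<in> vertices ms"
proof -
  have len: "length x = length ms + 1" using assms by (simp add: vertices_def length_ls)
  then show l: "t + 2 \<le> length x" using t by simp
  have x: "1 \<le> x ! s \<and> x ! s \<le> ls ! s" if "s < length ms + 1" for s
    using assms that by (simp add: vertices_def length_ls)
  show m: "merged t x \<in> vertices as"
    unfolding vertices_def
  proof (intro CollectI conjI allI impI)
    show "length (merged t x) = length as" using l len_as by (simp add: length_merged)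
    fix s assume "s < length as"
    then show "1 \<le> merged t x ! s" "merged t x ! s \<le> as ! s"
      using x[of "t + s"] nth_ls(2)[of "t + s"] l len_as t by (simp_all add: nth_merged)
  qed
  show "merge t h x \<in> vertices ms"
    unfolding vertices_def
  proof (intro CollectI conjI allI impI)
    show "length (merge t h x) = length ms" using l len by (simp add: length_merge)
    fix s assume s: "s < length ms"
    consider "s < t" | "s = t" | "t < s" by linarith
    then have "1 \<le> merge t h x ! s \<and> merge t h x ! s \<le> ms ! s"
    proof cases
      case 1 then show ?thesis using x[of s] s l len nth_ls(1)[of s] by (simp add: nth_merge)
    next
      case 2 then show ?thesis using h_range[OF m] s l len by (simp add: nth_merge)
    next
      case 3 then show ?thesis using x[of "s + 1"] s l len nth_ls(3)[of "s + 1"] by (simp add: nth_merge)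
    qed
    then show "1 \<le> merge t h x ! s" "merge t h x ! s \<le> ms ! s" by auto
  qed
qed

lemma unmerge_vertices:
  assumes "z \<in> vertices ms" "y \<in> vertices as"
  shows "unmerge t z y \<in> vertices ls"
  unfolding vertices_def
proof (intro CollectI conjI allI impI)
  have z: "length z = length ms" "\<And>s. s < length ms \<Longrightarrow> 1 \<le> z ! s \<and> z ! s \<le> ms ! s"
    and y: "length y = 2" "\<And>s. s < 2 \<Longrightarrow> 1 \<le> y ! s \<and> y ! s \<le> as ! s"
    using assms len_as by (auto simp: vertices_def)
  show "length (unmerge t z y) = length ls" using z(1) y(1) t by (simp add: unmerge_def length_ls)
  fix s assume s: "s < length ls"
  consider "s < t" | "t \<le> s" "s < t + 2" | "t + 2 \<le> s" by linarith
  then have "1 \<le> unmerge t z y ! s \<and> unmerge t z y ! s \<le> ls ! s"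
  proof cases
    case 1 then show ?thesis using z t nth_ls(1)[of s] by (simp add: unmerge_def nth_append)
  next
    case 2
    then have "s - t < 2" by linarith
    then show ?thesis using 2 z(1) y t nth_ls(2)[of s] by (simp add: unmerge_def nth_append)
  next
    case 3
    then obtain k where k: "s = t + 2 + k" using le_Suc_ex by blast
    have "unmerge t z y ! s = z ! (s - 1)" using z(1) y(1) t s by (simp add: k unmerge_def nth_append length_ls)
    then show ?thesis using z(2)[of "s - 1"] s 3 nth_ls(3)[of s] by (simp add: length_ls)
  qed
  then show "1 \<le> unmerge t z y ! s" "unmerge t z y ! s \<le> ls ! s" by auto
qed

text \<open>Coordinates compose: if \<open>W\<close> is the pullback of \<open>V\<close> along \<open>H\<close>, then its tensor product with the bimodule of \<open>h\<close> is
the pullback of \<open>V\<close> along \<open>H\<close> after \<open>merge t h\<close>. The coordinate of the tensor product at the pair \<open>y\<close> lies in the part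
of \<open>W\<close> at \<open>h y\<close>. In the coordinates of \<open>W\<close> this means that it is supported on those \<open>z\<close> with \<open>z ! t = h y\<close>, and such
\<open>z\<close> together with \<open>y\<close> amount to one vertex of the new product.\<close>

lemma coords_T:
  assumes "pullback_coords K V N r W ms H EV"
  shows "pullback_coords K V N r T ls (\<lambda>x. H (merge t h x)) (\<lambda>x C. EV (merge t h x) (evq (merged t x) C))"
proof -
  interpret W: pullback_coords K V N r W ms H EV by fact
  have len_merged: "s < t + 2 \<Longrightarrow> s - t < length as" for s using len_as t by auto
  have other: "merge t h x ! s' = x ! s \<and> s' < length ms \<and> ls ! s = ms ! s'"
    if "x \<in> vertices ls" "s < length ls" "s < t \<and> s' = s \<or> t + 2 \<le> s \<and> s' = s - 1" for x s s'
    using that vertices_ls(1)[OF that(1)] nth_ls[of s] t by (auto simp: nth_merge vertices_def length_ls)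
  show ?thesis
  \<comment> \<open>The numbered cases are the axioms of \<open>pullback_coords\<close>, in their order. In each, a factor of the
    product is either carried along or one of the two new factors.\<close>
  proof (unfold_locales, goal_cases)
    case (1 x) then show ?case using W.H_range vertices_ls by blast
  next
    case (2 x s c)
    note bx = vertices_ls[OF 2(1)]
    consider s' where "s < t \<and> s' = s \<or> t + 2 \<le> s \<and> s' = s - 1" | "t \<le> s" "s < t + 2"
      by (metis not_less)
    then show ?case
    proof cases
      case 1
      then show ?thesis using W.H_mono[OF bx(3), of s' c] other[OF 2(1,2) 1] 2 merge_update_other[OF bx(1) 1]
        by simp
    next
      case 2
      let ?y = "(merged t x)[s - t := c]"
      have "c \<le> merged t x ! (s - t)" using \<open>c \<le> x ! s\<close> 2 nth_merged[OF bx(1), of "s - t"] by simp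
      then have "?y \<in> vertices as" "h ?y \<le> h (merged t x)"
        using \<open>1 \<le> c\<close> len_merged[OF 2(2)] bx(2) by (auto intro: vertices_update h_mono)
      then show ?thesis using W.H_mono[OF bx(3) t, of "h ?y"] h_range[of ?y] bx(1) t
        by (simp add: merge_update_new[OF bx(1) 2] nth_merge)
    qed
  next
    case 3 then show ?case by (rule T_zero_in)
  next
    case (4 w w') then show ?case by (rule T_add_in)
  next
    case (5 k w) then show ?case by (rule T_smult_in)
  next
    case (6 s w a) then show ?case by (rule_tac T_ract_in)
  next
    case (7 x) then show ?case using vertices_ls by (intro module_hom_comp[OF evq_hom W.EV_hom])
  next
    case (8 x) then show ?case using vertices_ls by (simp add: evq_zero W.EV_zero)
  next
    case (9 x C) then show ?case using vertices_ls by (simp add: W.EV_comp module_hom_in[OF evq_hom])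
  next
    case (10 x s C b)
    note bx = vertices_ls[OF 10(1)]
    let ?z = "merge t h x" and ?y = "merged t x"
    consider s' where "s < t \<and> s' = s \<or> t + 2 \<le> s \<and> s' = s - 1" | "t \<le> s" "s < t + 2"
      by (metis not_less)
    then show ?case
    proof cases
      case 1
      note o = other[OF 10(1,2) 1]
      then have b': "b \<in> carrier (path_algebra K (ms ! s'))" using 10(4) by simp
      have "merged t (x[s := c]) = merged t x" for c using 1 by (intro merged_update_other) auto
      then show ?thesis
        using W.EV_ract[OF bx(3) _ module_hom_in[OF evq_hom[OF bx(2)] 10(3)] b'] o
        by (simp add: evq_ract_other[OF 10(2,4) bx(2) 10(3) 1] merge_update_other[OF bx(1) 1])
    next
      case 2
      have xs: "?y ! (s - t) = x ! s" using 2 nth_merged[OF bx(1), of "s - t"] by simp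
      have b: "b \<in> carrier (path_algebra K (as ! (s - t)))" using 10(4) nth_ls(2)[OF 2] by simp
      have yc: "?y[s - t := c] \<in> vertices as" "h (?y[s - t := c]) \<le> h ?y" if "c \<in> {1..x ! s}" for c
        using that bx(2) len_merged[OF 2(2)] by (auto simp: xs intro: vertices_update h_mono)
      have zt: "?z ! t = h ?y" using bx(1) by (simp add: nth_merge)
      let ?u = "\<lambda>c. evq (?y[s - t := c]) C"
      have u: "?u c \<in> carrier W" if "c \<in> {1..x ! s}" for c
        using module_hom_in[OF evq_hom[OF yc(1)[OF that]] 10(3)] .
      have tu: "tr (h (?y[s - t := c])) (h ?y) (?u c) \<in> carrier W" if "c \<in> {1..x ! s}" for c
        using u[OF that] yc[OF that] h_range[OF bx(2)] h_range[OF yc(1)[OF that]] by (intro tr_in) auto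
      have "EV ?z (evq ?y (ract T s C b)) =
          (\<Oplus>\<^bsub>V\<^esub>c\<in>{1..x ! s}. EV ?z (b (c, x ! s) \<odot>\<^bsub>W\<^esub> tr (h (?y[s - t := c])) (h ?y) (?u c)))"
        unfolding evq_ract_new[OF 2 10(4) bx(2) 10(3)] xs using tu coeff_in[OF b]
        by (intro W.EV_finsum bx(3)) auto
      also have "\<dots> = (\<Oplus>\<^bsub>V\<^esub>c\<in>{1..x ! s}. b (c, x ! s) \<odot>\<^bsub>V\<^esub>
           W.tr (H (?z[t := h (?y[s - t := c])])) (H ?z) (EV (?z[t := h (?y[s - t := c])]) (?u c)))"
      proof (rule W.finsum_cong', simp, rule Pi_I, goal_cases)
        case (1 c)
        note y = yc[OF 1] h_range[OF yc(1)[OF 1]]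
        show ?case using y u[OF 1] bx(3) t zt
          by (intro W.smult_closed coeff_in[OF b] W.tr_H_in W.EV_in vertices_update) auto
      next
        case (2 c)
        note y = yc[OF 2] h_range[OF yc(1)[OF 2]] h_range[OF bx(2)]
        have "EV ?z (tr (h (?y[s - t := c])) (h ?y) (?u c)) =
            W.tr (H (?z[t := h (?y[s - t := c])])) (H ?z) (EV (?z[t := h (?y[s - t := c])]) (?u c))"
          using W.EV_path[OF bx(3) t u[OF 2], of "h (?y[s - t := c])" "h ?y"] y zt
          by (simp add: tr_def)
        then show ?case using tu[OF 2] coeff_in[OF b] by (simp add: W.EV_smult[OF bx(3)])
      qed
      finally show ?thesis
        by (simp add: merge_update_new[OF bx(1) 2] merged_update_new[OF 2(1)])
    qed
  next
    case (11 C D)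
    show ?case
    proof (rule evq_inj[OF 11(1,2)], rule W.EV_inj)
      fix y assume y: "y \<in> vertices as"
      note h_y = h_range[OF y]
      show C: "evq y C \<in> carrier W" and D: "evq y D \<in> carrier W"
        using module_hom_in[OF evq_hom[OF y]] 11 by auto
      fix z assume z: "z \<in> vertices ms"
      show "EV z (evq y C) = EV z (evq y D)"
      proof (cases "h y = z ! t")
        case True
        have "t < length z" "length y = 2" using y z t len_as by (auto simp: vertices_def)
        then show ?thesis using 11(3)[OF unmerge_vertices[OF z y]] True by (simp add: merge_unmerge merged_unmerge)
      next
        case False
        have "EV z (evq y E) = \<zero>\<^bsub>V\<^esub>" if E: "E \<in> carrier T" for E
          using W.EV_path[OF z t module_hom_in[OF evq_hom[OF y] E], of "h y" "h y"] False h_y evq_comp[OF y E]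
          by (simp add: tr_def)
        then show ?thesis using 11 by simp
      qed
    qed
  next
    case (12 u)
    have "\<exists>w \<in> carrier W. \<forall>z \<in> vertices ms. EV z w = (if z ! t = h y then u (unmerge t z y) else \<zero>\<^bsub>V\<^esub>)"
      if y: "y \<in> vertices as" for y
    proof (rule W.EV_surj)
      fix z assume z: "z \<in> vertices ms"
      have "t < length z" "length y = 2" using y z t len_as by (auto simp: vertices_def)
      then show "(if z ! t = h y then u (unmerge t z y) else \<zero>\<^bsub>V\<^esub>) \<in> carrier V \<and>
          W.tr (H z) (H z) (if z ! t = h y then u (unmerge t z y) else \<zero>\<^bsub>V\<^esub>) =
          (if z ! t = h y then u (unmerge t z y) else \<zero>\<^bsub>V\<^esub>)"
        using 12[OF unmerge_vertices[OF z y]] W.H_range[OF z]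
        by (auto simp: merge_unmerge module_hom_zero[OF W.module_axioms W.module_axioms W.tr_hom])
    qed
    then obtain w where w: "\<And>y. y \<in> vertices as \<Longrightarrow> w y \<in> carrier W"
      "\<And>y z. y \<in> vertices as \<Longrightarrow> z \<in> vertices ms \<Longrightarrow> EV z (w y) = (if z ! t = h y then u (unmerge t z y) else \<zero>\<^bsub>V\<^esub>)"
      by metis
    have "\<exists>C \<in> carrier T. \<forall>y \<in> vertices as. evq y C = w y"
    proof (rule evq_surj)
      fix y assume y: "y \<in> vertices as"
      note h_y = h_range[OF y]
      have "tr (h y) (h y) (w y) = w y"
      proof (rule W.EV_inj)
        fix z assume z: "z \<in> vertices ms"
        have "z[t := h y] = z" if "z ! t = h y" using that list_update_id by metis
        then show "EV z (tr (h y) (h y) (w y)) = EV z (w y)"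
          using W.EV_path[OF z t w(1)[OF y], of "h y" "h y"] h_y w(2)[OF y z] W.EV_comp[OF z w(1)[OF y]]
          by (auto simp: tr_def)
      qed (use w(1)[OF y] h_y in \<open>auto intro: tr_in\<close>)
      then show "w y \<in> carrier W \<and> tr (h y) (h y) (w y) = w y" using w(1)[OF y] by simp
    qed
    then obtain C where C: "C \<in> carrier T" "\<And>y. y \<in> vertices as \<Longrightarrow> evq y C = w y" by blast
    show ?case
    proof (intro bexI[OF _ C(1)] ballI)
      fix x assume "x \<in> vertices ls"
      note bx = vertices_ls[OF this]
      show "EV (merge t h x) (evq (merged t x) C) = u x"
        using bx(1) by (simp add: C(2)[OF bx(2)] w(2)[OF bx(2,3)] unmerge_merge nth_merge)
    qed
  qed
qed

end

definition tensor_functor where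
  "tensor_functor K N t M = \<lparr>fobj = (\<lambda>V. tensor_factor K N t V M), farr = tensor_factor_map K N t M\<rparr>"

lemma coord_functor_tensor:
  assumes F: "coord_functor K N ms H F ev" and t: "t < length ms" and len_as: "length as = 2"
    and h: "\<And>y. y \<in> vertices as \<Longrightarrow> 1 \<le> h y \<and> h y \<le> ms ! t"
      "\<And>y s c. y \<in> vertices as \<Longrightarrow> s < length as \<Longrightarrow> 1 \<le> c \<Longrightarrow> c \<le> y ! s \<Longrightarrow> h (y[s := c]) \<le> h y"
  shows "coord_functor K N (take t ms @ as @ drop (t + 1) ms) (\<lambda>x. H (merge t h x))
     (tensor_functor K (ms ! t) t (pullback_bimod K as h) \<circ>\<^sub>F F)
     (\<lambda>V x C. ev V (merge t h x) (pullback_tensor.evq K (fobj F V) t h (merged t x) C))"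
proof -
  have loc: "pullback_tensor K (fobj F V) ms t as h" if V: "fd_module K [N] V" for V
  proof -
    note fd = coord_functor_obj[OF F V]
    show ?thesis using fd_module_path_rep[OF fd t] fd t len_as h
      by (intro pullback_tensor.intro pullback_tensor_axioms.intro) auto
  qed
  show ?thesis
    unfolding coord_functor_def functor_comp_def tensor_functor_def functor_data.simps
  proof (intro conjI allI impI ballI, goal_cases)
    case (1 V)
    interpret pullback_tensor K "fobj F V" ms t as h by (rule loc[OF 1])
    show ?case using coords_T[OF coord_functorD(1)[OF F 1]] by (simp add: ls_def)
  next
    case (2 V V' f)
    show ?case using tensor_factor_map_evq(1)[OF loc[OF 2(1)] loc[OF 2(2)] coord_functor_arr[OF F 2]] .
  next
    case (3 V V' f x C)
    interpret pullback_tensor K "fobj F V" ms t as h by (rule loc[OF 3(1)])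
    have x: "x \<in> vertices ls" using 3(4) by (simp add: ls_def)
    show ?case
      using tensor_factor_map_evq(2)[OF loc[OF 3(1)] loc[OF 3(2)] coord_functor_arr[OF F 3(1-3)] vertices_ls(2)[OF x] 3(5)]
        coord_functorD(3)[OF F 3(1-3) vertices_ls(3)[OF x] module_hom_in[OF evq_hom[OF vertices_ls(2)[OF x]] 3(5)]]
      by simp
  qed
qed

lemma coord_functor_cong:
  assumes "coord_functor K N ls H F ev" "\<And>x. x \<in> vertices ls \<Longrightarrow> H x = H' x"
  shows "coord_functor K N ls H' F ev"
proof -
  have "pullback_coords K V N (ract V 0) (fobj F V) ls H' (ev V)" if "fd_module K [N] V" for V
    by (rule coords_cong[where H = H, OF coord_functorD(1)[OF assms(1) that] assms(2)])
  then show ?thesis using assms(1) unfolding coord_functor_def by blast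
qed

section \<open>The functors \<open>\<nabla>\<close>\<close>

text \<open>The monotone map along which \<open>\<nabla>\<close> is the pullback: when a chain of \<open>n\<close> vertices is
inserted in place of the vertex \<open>i\<close>, the pair \<open>[i, \<nu>]\<close> goes to the inserted vertex with number \<open>\<nu>\<close>, and any other
pair \<open>[\<mu>, \<nu>]\<close> to the new place of \<open>\<mu>\<close>.\<close>

definition nabla_height :: "nat \<Rightarrow> nat \<Rightarrow> nat list \<Rightarrow> nat" where
  "nabla_height i n y = (if y ! 0 < i then y ! 0 else if y ! 0 = i then i + y ! 1 - 1 else y ! 0 + n - 1)"

lemma vertices_pair: "y \<in> vertices [a, b] \<longleftrightarrow> (\<exists>\<mu> \<nu>. y = [\<mu>, \<nu>] \<and> 1 \<le> \<mu> \<and> \<mu> \<le> a \<and> 1 \<le> \<nu> \<and> \<nu> \<le> b)"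
  by (auto simp: vertices_def length_Suc_conv All_less_Suc)

lemma vertices_triple: "x \<in> vertices [a, b, c] \<longleftrightarrow>
    (\<exists>\<mu> \<nu> \<pi>. x = [\<mu>, \<nu>, \<pi>] \<and> 1 \<le> \<mu> \<and> \<mu> \<le> a \<and> 1 \<le> \<nu> \<and> \<nu> \<le> b \<and> 1 \<le> \<pi> \<and> \<pi> \<le> c)"
  by (auto simp: vertices_def length_Suc_conv All_less_Suc)

lemma nabla_bimod_pullback:
  assumes "1 \<le> i"
  shows "nabla_bimod K m i n = pullback_bimod K [m, n] (nabla_height i n)"
proof -
  have "nabla_support m i n = subgraph [m, n] (nabla_height i n)"
    unfolding nabla_support_def subgraph_def
    using assms by (auto simp: vertices_pair nabla_height_def split: if_splits)
  then show ?thesis by (simp add: nabla_bimod_def pullback_bimod_def)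
qed

lemma nabla_height_range:
  "1 \<le> i \<Longrightarrow> i \<le> m \<Longrightarrow> y \<in> vertices [m, n] \<Longrightarrow> 1 \<le> nabla_height i n y \<and> nabla_height i n y \<le> m + n - 1"
  by (auto simp: vertices_pair nabla_height_def)

lemma nabla_height_mono:
  "y \<in> vertices [m, n] \<Longrightarrow> s < length [m, n] \<Longrightarrow> 1 \<le> c \<Longrightarrow> c \<le> y ! s \<Longrightarrow>
     nabla_height i n (y[s := c]) \<le> nabla_height i n y"
  by (auto simp: vertices_pair nabla_height_def less_Suc_eq)

lemma coord_functor_nabla:
  assumes "coord_functor K N ms H F ev" "t < length ms" "ms ! t = m + n - 1" "1 \<le> i" "i \<le> m"
  shows "\<exists>ev'. coord_functor K N (take t ms @ [m, n] @ drop (t + 1) ms) (\<lambda>x. H (merge t (nabla_height i n) x))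
     (nabla_factor K t m i n \<circ>\<^sub>F F) ev'"
proof -
  have eq: "nabla_factor K t m i n = tensor_functor K (ms ! t) t (pullback_bimod K [m, n] (nabla_height i n))"
    by (simp add: nabla_factor_def tensor_functor_def nabla_bimod_pullback[OF assms(4)] assms(3))
  have "1 \<le> nabla_height i n y \<and> nabla_height i n y \<le> ms ! t" if "y \<in> vertices [m, n]" for y
    using nabla_height_range[OF assms(4,5) that] assms(3) by simp
  from coord_functor_tensor[where as = "[m, n]", OF assms(1,2) _ this nabla_height_mono[where m = m and n = n and i = i]]
  show ?thesis unfolding eq by (intro exI) simp
qed

lemma functor_comp_id: "F \<circ>\<^sub>F id_functor = F"
  by (simp add: functor_comp_def id_functor_def)

text \<open>Inserting a chain into a vertex of an inserted chain, or inserting the two chains one after the other, gives the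
same map. The vertex \<open>j\<close> of the first inserted chain is the vertex \<open>j + i - 1\<close> of the result, which is smaller than
the images of all vertices greater than \<open>i\<close> because \<open>j \<le> n\<close>.\<close>

lemma nabla_height_assoc:
  assumes "1 \<le> i" "1 \<le> j" "j \<le> n" "1 \<le> \<mu>" "1 \<le> \<nu>" "\<nu> \<le> n" "1 \<le> \<pi>" "\<pi> \<le> p"
  shows "nabla_height i (n + p - 1) [\<mu>, nabla_height j p [\<nu>, \<pi>]] =
     nabla_height (j + i - 1) p [nabla_height i n [\<mu>, \<nu>], \<pi>]"
proof -
  consider "\<mu> < i" | "\<mu> = i" "\<nu> < j" | "\<mu> = i" "\<nu> = j" | "\<mu> = i" "j < \<nu>" | "i < \<mu>" by linarith
  then show ?thesis using assms by cases (auto simp: nabla_height_def)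
qed

theorem corollary4p4:
  fixes K :: "('k, 'r) ring_scheme" and m n p i j :: nat
  assumes "field K"
    and "1 \<le> m" "1 \<le> n" "1 \<le> p"
    and "1 \<le> i" "i \<le> m" "1 \<le> j" "j \<le> n"
  shows "naturally_isomorphic
           (mod_cat K [m + n + p - 2] :: (('k, 'a) multimod, 'a \<Rightarrow> 'a) category)
           (mod_cat K [m, n, p])
           (Id_nabla K n j p \<circ>\<^sub>F nabla K m i (n + p - 1))
           (nabla_Id K m i n \<circ>\<^sub>F nabla K (m + n - 1) (j + i - 1) p)"
proof -
  define N where "N = m + n + p - 2"
  have N: "N = m + (n + p - 1) - 1" "N = (m + n - 1) + p - 1" using assms by (simp_all add: N_def)
  have ji: "1 \<le> j + i - 1" "j + i - 1 \<le> m + n - 1" using assms by simp_all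
  note I = id_coord_functor[where 'a = 'a, of K N]
  obtain e1 where F1: "coord_functor K N [m, n + p - 1] (\<lambda>x. merge 0 (nabla_height i (n + p - 1)) x ! 0)
      (nabla K m i (n + p - 1) :: (('k, 'a) multimod, 'a \<Rightarrow> 'a, _, _) functor_data) e1"
    using coord_functor_nabla[OF I, of 0 m "n + p - 1" i] N(1) assms(5,6) by (auto simp: functor_comp_id)
  obtain e2 where F2: "coord_functor K N [m, n, p]
      (\<lambda>x. merge 0 (nabla_height i (n + p - 1)) (merge 1 (nabla_height j p) x) ! 0)
      (Id_nabla K n j p \<circ>\<^sub>F (nabla K m i (n + p - 1) :: (('k, 'a) multimod, 'a \<Rightarrow> 'a, _, _) functor_data)) e2"
    using coord_functor_nabla[OF F1, of 1 n p j] assms(7,8) by auto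
  obtain e3 where G1: "coord_functor K N [m + n - 1, p] (\<lambda>x. merge 0 (nabla_height (j + i - 1) p) x ! 0)
      (nabla K (m + n - 1) (j + i - 1) p :: (('k, 'a) multimod, 'a \<Rightarrow> 'a, _, _) functor_data) e3"
    using coord_functor_nabla[OF I, of 0 "m + n - 1" p "j + i - 1"] N(2) ji by (auto simp: functor_comp_id)
  obtain e4 where G2: "coord_functor K N [m, n, p]
      (\<lambda>x. merge 0 (nabla_height (j + i - 1) p) (merge 0 (nabla_height i n) x) ! 0)
      (nabla_Id K m i n \<circ>\<^sub>F (nabla K (m + n - 1) (j + i - 1) p :: (('k, 'a) multimod, 'a \<Rightarrow> 'a, _, _) functor_data)) e4"
    using coord_functor_nabla[OF G1, of 0 m n i] assms(5,6) by auto
  have "merge 0 (nabla_height (j + i - 1) p) (merge 0 (nabla_height i n) x) ! 0 =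
      merge 0 (nabla_height i (n + p - 1)) (merge 1 (nabla_height j p) x) ! 0" if "x \<in> vertices [m, n, p]" for x
    using that nabla_height_assoc[OF assms(5,7,8)] by (auto simp: vertices_triple merge_def merged_def numeral_2_eq_2)
  from coord_functors_isomorphic[OF F2 coord_functor_cong[OF G2 this]] show ?thesis unfolding N_def .
qed

end
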